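(* There is an absolute constant $c>0$ such that the following holds. Let $n\ge 2$, $K\ge 1$ be integers and $\varepsilon>1/\log n$ a real number. If $A\subseteq S_n$ is a $K$-approximate group with $\mu(A)\ge e^{-cn^{1-\varepsilon}}$, then there is a subgroup $H\le S_n$ with $\mu(H)\ge \mu(A)^{5/\varepsilon}$ such that $A\subseteq YH$ for some $Y\subseteq A$ with $|Y|\le K^6|A|/|H|$.
   Context: $S_n$ is the symmetric group on $[n]$ and $\mu(A)=|A|/n!$ for $A\subseteq S_n$. $\log$ is the natural logarithm. A subset $A$ of a group $G$ is a $K$-approximate group if $\mathrm{id}\in A=A^{-1}$ and $A^2\subseteq XA$ for some $X\subseteq G$ with $|X|=K$. Here $A^2=\{ab:a,b\in A\}$, $XA=\{xa:x\in X,a\in A\}$ and $YH=\{yh:y\in Y,h\in H\}$. *)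

theory Defs
  imports Complex_Main "HOL-Algebra.Sym_Groups"
begin

text \<open>The size of the covering set is required to be exactly \<open>K\<close>, and \<open>finite X\<close> excludes
  infinite sets, whose \<open>card\<close> is 0.\<close>

definition approximate_group :: "('a, 'b) monoid_scheme \<Rightarrow> nat \<Rightarrow> 'a set \<Rightarrow> bool" where
  "approximate_group G K A \<longleftrightarrow>
     A \<subseteq> carrier G \<and> \<one>\<^bsub>G\<^esub> \<in> A \<and> A = set_inv\<^bsub>G\<^esub> A \<and>
     (\<exists>X. X \<subseteq> carrier G \<and> finite X \<and> card X = K \<and> A <#>\<^bsub>G\<^esub> A \<subseteq> X <#>\<^bsub>G\<^esub> A)"

text \<open>Normalised counting measure on \<open>S\<^sub>n\<close>, the carrier of \<open>sym_group n\<close>.\<close>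

definition sym_density :: "nat \<Rightarrow> (nat \<Rightarrow> nat) set \<Rightarrow> real" where
  "sym_density n A = real (card A) / fact n"

end

theory Submission
  imports Defs
begin

text \<open>Call a set \<open>F\<close> of permutations of \<open>m\<close> points, of density \<open>\<phi>\<close>, \<open>r\<close>-global if prescribing the images of \<open>t\<close>
  points raises its density by a factor of at most \<open>r ^ t\<close>. The engine is a growth theorem: if \<open>F\<close> is \<open>r\<close>-global,
  \<open>\<phi> \<le> 1/32\<close> and \<open>r ^ 5 * ln (1 / \<phi>)\<close> is at most a small multiple of \<open>m\<close>, then the set of quotients of \<open>F\<close> has
  density at least \<open>\<phi> powr (4/5)\<close>. By Cauchy--Schwarz it suffices to bound the norm of the image of the indicator
  of \<open>F\<close> under the operator that sums a function over its left translates by \<open>F\<close>. This operator commutes with right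
  translations. On functions orthogonal to all (sign-twisted) functions of low degree its top singular space is
  therefore right invariant, and it contains many almost orthogonal unit vectors, so that the singular value is
  small. The low-degree part of the indicator is small by a level inequality, proved by lifting functions
  to the product space of all maps, where the Efron--Stein decomposition is available.

  For an approximate group \<open>A\<close>, choose a point stabiliser \<open>H\<close> of a set \<open>I\<close> and a coset \<open>gH\<close> that maximise
  the density of \<open>A\<close> on \<open>gH\<close> times \<open>n powr (- \<epsilon> * card I / 5)\<close>. Then the translate of \<open>A \<inter> gH\<close> into \<open>H\<close> is global in
  \<open>H\<close>, with density \<open>\<phi>\<close> say, while its quotients lie in \<open>K\<close> sets of density at most \<open>\<phi>\<close>. The growth theorem gives
  \<open>K ^ 5 * \<phi> \<ge> 1\<close>, and counting inside the product set of \<open>A\<close> bounds the number of cosets of \<open>H\<close> that meet \<open>A\<close>.\<close>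

section \<open>Product spaces and the level inequality\<close>

text \<open>The singular value bound is a multiplicity argument: the squared Hilbert--Schmidt norm
  of the operator is only \<open>card F * fact m\<close>, so a singular value shared by many almost
  orthogonal vectors is small. Explicit vectors replace the dimensions of irreducible
  representations. The sign is the obstacle: it spans a one-dimensional right-invariant space
  orthogonal to low degree, so low degree times sign has to be split off as well. The exponents fit
  as follows. Growth gives \<phi>^(4/5) \<le> K \<phi>, hence K^5 \<phi> \<ge> 1; counting in the
  product set costs one more K, whence K^6. Growth needs r^5 ln (1/\<phi>) at most linear in the
  number of points, and r = n^(\<epsilon>/5) turns this into the assumed density of A. Optimality of
  the coset gives r^|I| \<mu>(A) \<le> 1, that is n^(-|I|) \<ge> \<mu>(A)^(5/\<epsilon>); as
  \<epsilon> ln n > 1, it also makes I small against n. If K = 1, then K^5 \<phi> \<ge> 1 would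
  force \<phi> = 1, beyond the range \<phi> \<le> 1/32 of the growth theorem; there A is itself a
  subgroup.\<close>

definition linop :: "(('x \<Rightarrow> real) \<Rightarrow> ('z \<Rightarrow> real)) \<Rightarrow> bool" where
  "linop \<Phi> \<longleftrightarrow> (\<forall>f g. \<Phi> (\<lambda>y. f y + g y) = (\<lambda>y. \<Phi> f y + \<Phi> g y)) \<and>
                (\<forall>c f. \<Phi> (\<lambda>y. c * f y) = (\<lambda>y. c * \<Phi> f y))"

lemma linop_add: "linop \<Phi> \<Longrightarrow> \<Phi> (\<lambda>y. f y + g y) = (\<lambda>y. \<Phi> f y + \<Phi> g y)"
  by (simp add: linop_def)

lemma linop_scale: "linop \<Phi> \<Longrightarrow> \<Phi> (\<lambda>y. c * f y) = (\<lambda>y. c * \<Phi> f y)"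
  by (simp add: linop_def)

lemma linop_diff: assumes "linop \<Phi>" shows "\<Phi> (\<lambda>y. f y - g y) = (\<lambda>y. \<Phi> f y - \<Phi> g y)"
  using linop_add[OF assms, of f "\<lambda>y. (-1) * g y"] linop_scale[OF assms, of "-1" g] by simp

lemma linop_zero: assumes "linop \<Phi>" shows "\<Phi> (\<lambda>y. 0) = (\<lambda>y. 0)"
  using linop_scale[OF assms, of 0 "\<lambda>y. 0"] by simp

lemma linop_sum: assumes "linop \<Phi>"
  shows "\<Phi> (\<lambda>y. \<Sum>k\<in>A. f k y) = (\<lambda>y. \<Sum>k\<in>A. \<Phi> (f k) y)"
proof (induction A rule: infinite_finite_induct)
  case (insert x F)
  then show ?case using linop_add[OF assms, of "f x" "\<lambda>y. \<Sum>k\<in>F. f k y"] by simp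
qed (simp_all add: linop_zero[OF assms])

lemma sq_sum_le: "((x::real) - y)\<^sup>2 \<le> 2 * x\<^sup>2 + 2 * y\<^sup>2"
  using zero_le_power2[of "x + y"] by (simp add: power2_eq_square algebra_simps)

lemma Cauchy_Schwarz_real_sum:
  "(\<Sum>x\<in>A. f x * g x :: real)\<^sup>2 \<le> (\<Sum>x\<in>A. (f x)\<^sup>2) * (\<Sum>x\<in>A. (g x)\<^sup>2)"
proof -
  let ?a = "\<Sum>x\<in>A. (f x)\<^sup>2" and ?b = "\<Sum>x\<in>A. f x * g x" and ?c = "\<Sum>x\<in>A. (g x)\<^sup>2"
  have nn: "?a * t\<^sup>2 + 2 * ?b * t + ?c \<ge> 0" for t
  proof -
    have "0 \<le> (\<Sum>x\<in>A. (f x * t + g x)\<^sup>2)" by (intro sum_nonneg) simp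
    also have "\<dots> = ?a * t\<^sup>2 + 2 * ?b * t + ?c"
      by (simp add: power2_eq_square algebra_simps sum.distrib sum_distrib_left sum_distrib_right)
    finally show ?thesis .
  qed
  have a0: "?a \<ge> 0" and c0: "?c \<ge> 0" by (auto intro: sum_nonneg)
  show ?thesis
  proof (cases "?a = 0")
    case True
    have "?b = 0"
    proof (rule ccontr)
      assume "?b \<noteq> 0"
      then show False using nn[of "- (?c + 1) / (2 * ?b)"] True by simp
    qed
    then show ?thesis using True by simp
  next
    case False
    then have "0 \<le> ?a * (- ?b / ?a)\<^sup>2 + 2 * ?b * (- ?b / ?a) + ?c" by (intro nn)
    also have "\<dots> = ?c - ?b\<^sup>2 / ?a" using False by (simp add: power2_eq_square field_simps)
    finally have "?b\<^sup>2 / ?a \<le> ?c" by simp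
    then show ?thesis using False a0 by (simp add: divide_le_eq mult.commute)
  qed
qed

section \<open>Averaging, difference and noise operators on a finite product space\<close>

locale prod_space =
  fixes V :: "'a set" and Om :: "'b set"
  assumes finV: "finite V" and finOm: "finite Om" and Om_ne: "Om \<noteq> {}"
begin

definition E :: "'a \<Rightarrow> (('a \<Rightarrow> 'b) \<Rightarrow> real) \<Rightarrow> ('a \<Rightarrow> 'b) \<Rightarrow> real" where
  "E i f = (\<lambda>y. (\<Sum>z\<in>Om. f (y(i := z))) / real (card Om))"

definition D :: "'a \<Rightarrow> (('a \<Rightarrow> 'b) \<Rightarrow> real) \<Rightarrow> ('a \<Rightarrow> 'b) \<Rightarrow> real" where
  "D i f = (\<lambda>y. f y - E i f y)"

text \<open>Noise with correlation 1/2 in the coordinate \<open>i\<close>: the mean part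
  \<open>E i f\<close> is kept and \<open>D i f\<close> is halved.\<close>

definition N :: "'a \<Rightarrow> (('a \<Rightarrow> 'b) \<Rightarrow> real) \<Rightarrow> ('a \<Rightarrow> 'b) \<Rightarrow> real" where
  "N i f = (\<lambda>y. (f y + E i f y) / 2)"

text \<open>Products of commuting operators over \<open>S\<close>. For infinite \<open>S\<close> the
  fold returns \<open>f\<close>, hence the finiteness assumptions below.\<close>

definition EE where "EE S f = Finite_Set.fold E f S"
definition DD where "DD S f = Finite_Set.fold D f S"
definition NN where "NN S f = Finite_Set.fold N f S"

lemma card_Om: "real (card Om) > 0" using finOm Om_ne by (simp add: card_gt_0_iff)

lemma linop_E: "linop (E i)"
  unfolding linop_def E_def
  by (auto simp: sum.distrib add_divide_distrib sum_distrib_left)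

lemma linop_D: "linop (D i)"
  unfolding linop_def D_def using linop_E[of i] by (auto simp: linop_def algebra_simps)

lemma linop_N: "linop (N i)"
  unfolding linop_def N_def using linop_E[of i] by (auto simp: linop_def algebra_simps add_divide_distrib)

lemma E_idem: "E i (E i f) = E i f"
  unfolding E_def using card_Om by (simp add: fun_eq_iff)

lemma E_commute: "E i (E j f) = E j (E i f)"
proof (cases "i = j")
  case False
  then have "(\<Sum>z\<in>Om. \<Sum>w\<in>Om. f (y(i := z, j := w))) = (\<Sum>z\<in>Om. \<Sum>w\<in>Om. f (y(j := z, i := w)))" for y
    by (subst sum.swap) (simp add: fun_upd_twist[OF False])
  then show ?thesis unfolding E_def
    by (simp add: fun_eq_iff sum_divide_distrib[symmetric])
qed simp

lemma E_mult: "E i (\<lambda>y. E i f y * g y) = (\<lambda>y. E i f y * E i g y)"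
  unfolding E_def by (simp add: fun_eq_iff sum_distrib_left)

lemma E_mono: "(\<And>y. f y \<le> g y) \<Longrightarrow> E i f y \<le> E i g y"
  unfolding E_def by (intro divide_right_mono sum_mono) auto

lemma E_const: "E i (\<lambda>y. c) = (\<lambda>y. c)"
  unfolding E_def using card_Om by simp

lemma E_D: "E i (D i f) = (\<lambda>y. 0)"
  unfolding D_def using linop_diff[OF linop_E, of i f "E i f"] by (simp add: E_idem)

lemma E_D_commute: "E i (D j f) = D j (E i f)"
  unfolding D_def using linop_diff[OF linop_E, of i f "E j f"] by (simp add: E_commute)

lemma D_commute: "D i (D j f) = D j (D i f)"
  using E_D_commute[of i j f] E_D_commute[of j i f] linop_diff[OF linop_E]
  unfolding D_def by (simp add: fun_eq_iff E_commute)

lemma D_idem: "D i (D i f) = D i f"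
  unfolding D_def[of i "D i f"] by (simp add: E_D)

lemma E_N_commute: "E i (N j f) = N j (E i f)"
proof -
  have N: "N j f = (\<lambda>y. (1/2) * (f y + E j f y))" for j f unfolding N_def by simp
  show ?thesis unfolding N linop_scale[OF linop_E] linop_add[OF linop_E] by (simp add: E_commute)
qed

lemma N_commute: "N i (N j f) = N j (N i f)"
proof -
  have *: "N i (N j f) = (\<lambda>y. (f y + E j f y + E i f y + E i (E j f) y) / 4)" for i j f
    unfolding N_def[of i "N j f"] E_N_commute unfolding N_def by (auto simp: field_simps E_commute)
  show ?thesis unfolding * by (simp add: fun_eq_iff E_commute[of i j] algebra_simps)
qed

text \<open>\<open>E\<close> and \<open>D\<close> are idempotent, so an element may be inserted
  twice; \<open>N\<close> is not, which is why \<open>NN_insert\<close> assumes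
  \<open>i \<notin> S\<close>.\<close>

sublocale E: comp_fun_idem E by standard (auto simp: fun_eq_iff E_commute E_idem)
sublocale D: comp_fun_idem D by standard (auto simp: fun_eq_iff D_commute D_idem)
sublocale N: comp_fun_commute N by standard (auto simp: fun_eq_iff N_commute)

lemma EE_empty [simp]: "EE {} f = f" by (simp add: EE_def)
lemma DD_empty [simp]: "DD {} f = f" by (simp add: DD_def)
lemma NN_empty [simp]: "NN {} f = f" by (simp add: NN_def)
lemma EE_insert: "finite S \<Longrightarrow> EE (insert i S) f = E i (EE S f)"
  by (simp add: EE_def)
lemma EE_insert2: "finite S \<Longrightarrow> EE (insert i S) f = EE S (E i f)"
  unfolding EE_def by (rule E.fold_insert_idem2)
lemma DD_insert: "finite S \<Longrightarrow> DD (insert i S) f = D i (DD S f)"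
  by (simp add: DD_def)
lemma DD_insert2: "finite S \<Longrightarrow> DD (insert i S) f = DD S (D i f)"
  unfolding DD_def by (rule D.fold_insert_idem2)
lemma NN_insert: "finite S \<Longrightarrow> i \<notin> S \<Longrightarrow> NN (insert i S) f = N i (NN S f)"
  by (simp add: NN_def)
lemma NN_insert2: "finite S \<Longrightarrow> i \<notin> S \<Longrightarrow> NN (insert i S) f = NN S (N i f)"
  unfolding NN_def by (rule N.fold_insert2)

lemma linop_comp: "linop \<Phi> \<Longrightarrow> linop \<Psi> \<Longrightarrow> linop (\<lambda>f. \<Phi> (\<Psi> f))"
  by (simp add: linop_def)

lemma linop_EE: "finite S \<Longrightarrow> linop (EE S)"
proof (induction S rule: finite_induct)
  case empty show ?case by (simp add: linop_def)
next
  case (insert x F)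
  have "EE (insert x F) = (\<lambda>f. E x (EE F f))" using insert by (auto simp: EE_insert)
  then show ?case using linop_comp[OF linop_E insert(3), of x] by simp
qed
lemma linop_DD: "finite S \<Longrightarrow> linop (DD S)"
proof (induction S rule: finite_induct)
  case empty show ?case by (simp add: linop_def)
next
  case (insert x F)
  have "DD (insert x F) = (\<lambda>f. D x (DD F f))" using insert by (auto simp: DD_insert)
  then show ?case using linop_comp[OF linop_D insert(3), of x] by simp
qed
lemma linop_NN: "finite S \<Longrightarrow> linop (NN S)"
proof (induction S rule: finite_induct)
  case empty show ?case by (simp add: linop_def)
next
  case (insert x F)
  have "NN (insert x F) = (\<lambda>f. N x (NN F f))" using insert by (auto simp: NN_insert)
  then show ?case using linop_comp[OF linop_N insert(3), of x] by simp
qed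

lemma E_EE_commute: "finite S \<Longrightarrow> E i (EE S f) = EE S (E i f)"
  by (simp add: EE_insert[symmetric] EE_insert2[symmetric])
lemma E_DD_commute: "finite S \<Longrightarrow> E i (DD S f) = DD S (E i f)"
  by (induction S arbitrary: f rule: finite_induct) (simp_all add: DD_insert E_D_commute)
lemma E_NN_commute: "finite S \<Longrightarrow> E i (NN S f) = NN S (E i f)"
  by (induction S arbitrary: f rule: finite_induct) (simp_all add: NN_insert E_N_commute)
lemma EE_Un: "finite S \<Longrightarrow> finite R \<Longrightarrow> EE S (EE R f) = EE (S \<union> R) f"
  by (induction S arbitrary: f rule: finite_induct) (simp_all add: EE_insert)

lemma EE_mono: "finite S \<Longrightarrow> (\<And>y. f y \<le> g y) \<Longrightarrow> EE S f y \<le> EE S g y"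
  by (induction S arbitrary: y rule: finite_induct) (simp_all add: EE_insert E_mono)
lemma EE_const: "finite S \<Longrightarrow> EE S (\<lambda>y. c) = (\<lambda>y. c)"
  by (induction S rule: finite_induct) (simp_all add: EE_insert E_const)
lemma EE_nonneg: "finite S \<Longrightarrow> (\<And>y. 0 \<le> f y) \<Longrightarrow> 0 \<le> EE S f y"
  using EE_mono[of S "\<lambda>y. 0" f y] by (simp add: EE_const)

lemma E_square_le: "(E i f y)\<^sup>2 \<le> E i (\<lambda>y. (f y)\<^sup>2) y"
proof -
  have "(\<Sum>z\<in>Om. f (y(i := z)) * 1)\<^sup>2 \<le> (\<Sum>z\<in>Om. (f (y(i := z)))\<^sup>2) * (\<Sum>z\<in>Om. 1\<^sup>2)"
    by (rule Cauchy_Schwarz_real_sum)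
  then show ?thesis unfolding E_def using card_Om by (simp add: power2_eq_square field_simps)
qed

lemma EE_square_le: "finite S \<Longrightarrow> (EE S f y)\<^sup>2 \<le> EE S (\<lambda>y. (f y)\<^sup>2) y"
proof (induction S arbitrary: y rule: finite_induct)
  case (insert x F)
  have "(E x (EE F f) y)\<^sup>2 \<le> E x (\<lambda>y. (EE F f y)\<^sup>2) y" by (rule E_square_le)
  also have "\<dots> \<le> E x (EE F (\<lambda>y. (f y)\<^sup>2)) y" by (rule E_mono) (rule insert)
  finally show ?case using insert by (simp add: EE_insert)
qed simp

text \<open>All coordinates in \<open>V\<close> are averaged out, so the base point only fixes the
  coordinates outside \<open>V\<close>.\<close>

definition ex :: "(('a \<Rightarrow> 'b) \<Rightarrow> real) \<Rightarrow> real" where "ex f = EE V f (\<lambda>_. undefined)"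

lemma ex_E: "i \<in> V \<Longrightarrow> ex (E i f) = ex f"
  unfolding ex_def using finV by (metis EE_insert2 insert_absorb)
lemma ex_EE: "S \<subseteq> V \<Longrightarrow> ex (EE S f) = ex f"
  unfolding ex_def using finV by (metis EE_Un finite_subset sup.absorb1)
lemma ex_mono: "(\<And>y. f y \<le> g y) \<Longrightarrow> ex f \<le> ex g" unfolding ex_def by (rule EE_mono[OF finV])
lemma ex_nonneg: "(\<And>y. 0 \<le> f y) \<Longrightarrow> 0 \<le> ex f" unfolding ex_def by (rule EE_nonneg[OF finV])
lemma ex_const: "ex (\<lambda>y. c) = c" unfolding ex_def by (simp add: EE_const finV)
lemma ex_add: "ex (\<lambda>y. f y + g y) = ex f + ex g"
  unfolding ex_def by (simp add: linop_add[OF linop_EE[OF finV]])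
lemma ex_scale: "ex (\<lambda>y. c * f y) = c * ex f"
  unfolding ex_def by (simp add: linop_scale[OF linop_EE[OF finV]])
lemma ex_sum: "ex (\<lambda>y. \<Sum>k\<in>A. f k y) = (\<Sum>k\<in>A. ex (f k))"
  unfolding ex_def by (simp add: linop_sum[OF linop_EE[OF finV]])

lemma EE_explicit:
  assumes "finite S"
  shows "EE S f y = (\<Sum>z\<in>PiE S (\<lambda>_. Om). f (\<lambda>i. if i \<in> S then z i else y i)) / real (card Om) ^ card S"
  using assms
proof (induction S arbitrary: f y rule: finite_induct)
  case (insert x F)
  have "EE (insert x F) f y = E x (EE F f) y" using insert by (simp add: EE_insert)
  also have "\<dots> = (\<Sum>w\<in>Om. \<Sum>z\<in>PiE F (\<lambda>_. Om). f (\<lambda>i. if i \<in> insert x F then (z(x:=w)) i else y i))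
       / real (card Om) ^ card (insert x F)"
    unfolding E_def insert.IH using insert(1,2)
    by (simp add: sum_divide_distrib) (intro sum.cong refl arg_cong2[where f="(/)"] arg_cong[where f=f], auto)
  also have "(\<Sum>w\<in>Om. \<Sum>z\<in>PiE F (\<lambda>_. Om). f (\<lambda>i. if i \<in> insert x F then (z(x:=w)) i else y i))
     = (\<Sum>(w,z)\<in>Om \<times> PiE F (\<lambda>_. Om). f (\<lambda>i. if i \<in> insert x F then (z(x:=w)) i else y i))"
    by (simp add: sum.cartesian_product)
  also have "\<dots> = (\<Sum>z\<in>PiE (insert x F) (\<lambda>_. Om). f (\<lambda>i. if i \<in> insert x F then z i else y i))"
    unfolding PiE_insert_eq
    by (subst sum.reindex[OF inj_combinator[OF insert(2)]]) (auto simp: case_prod_unfold intro!: sum.cong)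
  finally show ?case .
qed simp

section \<open>The fourth-moment inequality for the noise operator\<close>

lemma E_mult_inv: "E n A = A \<Longrightarrow> E n (\<lambda>y. A y * h y) = (\<lambda>y. A y * E n h y)"
  using E_mult[of n A h] by simp

lemma E_inv_mult: "E n A = A \<Longrightarrow> E n B = B \<Longrightarrow> E n (\<lambda>y. A y * B y) = (\<lambda>y. A y * B y)"
  by (simp add: E_mult_inv)

lemma E_inv_power2: "E n A = A \<Longrightarrow> E n (\<lambda>y. (A y)\<^sup>2) = (\<lambda>y. (A y)\<^sup>2)"
  unfolding power2_eq_square by (rule E_inv_mult)

lemma ex_mult_zero: "n \<in> V \<Longrightarrow> E n A = A \<Longrightarrow> E n B = (\<lambda>y. 0) \<Longrightarrow> ex (\<lambda>y. A y * B y) = 0"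
  using ex_E[of n "\<lambda>y. A y * B y"] by (simp add: E_mult_inv ex_const)

lemma E_D_split: "f = (\<lambda>y. E n f y + D n f y)" by (simp add: D_def)

text \<open>The fourth-moment inequality below tensorises over the coordinates in \<open>U\<close> with this choice of
  right-hand side, following Keevash, Lifshitz and Minzer.\<close>

definition fourth_form where
  "fourth_form U f g = (\<Sum>S\<in>Pow U. ex (\<lambda>y. EE (U - S) (\<lambda>y. (DD S f y)\<^sup>2) y * EE (U - S) (\<lambda>y. (DD S g y)\<^sup>2) y))"

text \<open>Sort the index sets by whether they contain \<open>n\<close>. Those that do give exactly
  the term with both \<open>D n f\<close> and \<open>D n g\<close>. For the others,
  \<open>E n f\<close> and \<open>D n f\<close> are orthogonal along \<open>n\<close>, so the
  averaged square splits into an \<open>n\<close>-invariant part \<open>?A\<close> and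
  \<open>E n ?B\<close>. In the product of two such sums the mixed terms may drop \<open>E n\<close>
  under \<open>ex\<close>, since \<open>?A\<close> is \<open>n\<close>-invariant, and the product of
  the two \<open>E n ?B\<close> is nonnegative and discarded.\<close>

lemma fourth_form_insert:
  assumes "finite U" "n \<notin> U" "n \<in> V"
  shows "fourth_form U (E n f) (E n g) + fourth_form U (E n f) (D n g)
       + fourth_form U (D n f) (E n g) + fourth_form U (D n f) (D n g)
       \<le> fourth_form (insert n U) f g"
proof -
  let ?t = "\<lambda>U S f g. ex (\<lambda>y. EE (U - S) (\<lambda>y. (DD S f y)\<^sup>2) y * EE (U - S) (\<lambda>y. (DD S g y)\<^sup>2) y)"
  have split: "fourth_form (insert n U) f g = (\<Sum>S\<in>Pow U. ?t (insert n U) S f g) + (\<Sum>S\<in>Pow U. ?t (insert n U) (insert n S) f g)"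
  proof -
    have "inj_on (insert n) (Pow U)" using assms(2) by (auto simp: inj_on_def)
    moreover have "Pow U \<inter> insert n ` Pow U = {}" using assms(2) by auto
    ultimately show ?thesis unfolding fourth_form_def Pow_insert using assms(1)
      by (subst sum.union_disjoint) (auto simp: sum.reindex)
  qed
  have second: "?t (insert n U) (insert n S) f g = ?t U S (D n f) (D n g)" if "S \<in> Pow U" for S
  proof -
    have "insert n U - insert n S = U - S" using assms(2) that by auto
    moreover have "finite S" using that assms(1) finite_subset by auto
    ultimately show ?thesis by (simp add: DD_insert2)
  qed
  have first: "?t U S (E n f) (E n g) + ?t U S (E n f) (D n g) + ?t U S (D n f) (E n g) \<le> ?t (insert n U) S f g"
    if "S \<in> Pow U" for S
  proof -
    have finS: "finite S" using that assms(1) finite_subset by auto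
    have finUS: "finite (U - S)" using assms(1) by simp
    have US: "insert n U - S = insert n (U - S)" using assms(2) that by auto
    have dec: "EE (insert n (U - S)) (\<lambda>y. (DD S h y)\<^sup>2)
       = (\<lambda>y. EE (U - S) (\<lambda>y. (DD S (E n h) y)\<^sup>2) y + E n (EE (U - S) (\<lambda>y. (DD S (D n h) y)\<^sup>2)) y)" for h
    proof -
      let ?a = "DD S (E n h)" and ?b = "DD S (D n h)"
      have a: "E n ?a = ?a" by (simp add: E_DD_commute finS E_idem)
      have b: "E n ?b = (\<lambda>y. 0)" by (simp add: E_DD_commute finS E_D linop_zero[OF linop_DD])
      have h: "DD S h = (\<lambda>y. ?a y + ?b y)"
        using linop_add[OF linop_DD[OF finS], of "E n h" "D n h"] E_D_split[of h n] by simp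
      have "E n (\<lambda>y. (DD S h y)\<^sup>2) = (\<lambda>y. (?a y)\<^sup>2 + E n (\<lambda>y. (?b y)\<^sup>2) y)"
      proof -
        have "(\<lambda>y. (DD S h y)\<^sup>2) = (\<lambda>y. ((?a y)\<^sup>2 + 2 * (?a y * ?b y)) + (?b y)\<^sup>2)"
          unfolding h by (simp add: power2_eq_square algebra_simps)
        then show ?thesis
          by (simp add: linop_add[OF linop_E] linop_scale[OF linop_E] E_mult_inv[OF a] E_inv_power2[OF a] b)
      qed
      then show ?thesis
        by (simp add: EE_insert2 finUS E_EE_commute linop_add[OF linop_EE])
    qed
    let ?A = "\<lambda>h. EE (U - S) (\<lambda>y. (DD S (E n h) y)\<^sup>2)"
    let ?B = "\<lambda>h. EE (U - S) (\<lambda>y. (DD S (D n h) y)\<^sup>2)"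
    have Ainv: "E n (?A h) = ?A h" for h
      by (simp add: E_EE_commute finUS E_inv_power2 E_DD_commute finS E_idem)
    have Bnn: "?B h y \<ge> 0" for h y by (rule EE_nonneg[OF finUS]) simp
    have AB: "ex (\<lambda>y. ?A h y * E n (?B k) y) = ex (\<lambda>y. ?A h y * ?B k y)" for h k
      using ex_E[OF assms(3), of "\<lambda>y. ?A h y * ?B k y"] by (simp add: E_mult_inv[OF Ainv])
    have BA: "ex (\<lambda>y. E n (?B k) y * ?A h y) = ex (\<lambda>y. ?B k y * ?A h y)" for h k
      using AB[of h k] by (simp add: mult.commute)
    have EBnn: "E n (?B h) y \<ge> 0" for h y using E_mono[of "\<lambda>y. 0" "?B h" n y] Bnn by (simp add: E_const)
    have "?t (insert n U) S f g = ex (\<lambda>y. (?A f y + E n (?B f) y) * (?A g y + E n (?B g) y))"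
      unfolding US dec ..
    also have "\<dots> = ex (\<lambda>y. ((?A f y * ?A g y + ?A f y * E n (?B g) y) + E n (?B f) y * ?A g y) + E n (?B f) y * E n (?B g) y)"
      by (simp add: algebra_simps)
    also have "\<dots> = ?t U S (E n f) (E n g) + ?t U S (E n f) (D n g) + ?t U S (D n f) (E n g) + ex (\<lambda>y. E n (?B f) y * E n (?B g) y)"
      by (simp add: ex_add AB BA)
    finally show ?thesis using ex_nonneg[of "\<lambda>y. E n (?B f) y * E n (?B g) y"] EBnn by simp
  qed
  have "fourth_form U (E n f) (E n g) + fourth_form U (E n f) (D n g) + fourth_form U (D n f) (E n g)
      = (\<Sum>S\<in>Pow U. ?t U S (E n f) (E n g) + ?t U S (E n f) (D n g) + ?t U S (D n f) (E n g))"
    unfolding fourth_form_def by (simp add: sum.distrib)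
  also have "\<dots> \<le> (\<Sum>S\<in>Pow U. ?t (insert n U) S f g)" by (intro sum_mono first)
  finally show ?thesis unfolding split using second by (simp add: fourth_form_def)
qed

text \<open>One coordinate at a time: \<open>N n h\<close> is \<open>E n h\<close> plus half of
  \<open>D n h\<close>, the four resulting pairs are estimated by induction, and
  \<open>fourth_form_insert\<close> collects them. The halving is what lets the pointwise inequality
  \<open>pt\<close> hold without a loss in the constant.\<close>

lemma noise_fourth_moment:
  assumes "finite U" "U \<subseteq> V"
  shows "ex (\<lambda>y. (NN U f y)\<^sup>2 * (NN U g y)\<^sup>2) \<le> fourth_form U f g"
  using assms
proof (induction U arbitrary: f g rule: finite_induct)
  case empty then show ?case by (simp add: fourth_form_def)
next
  case (insert n U)
  have n: "n \<in> V" and U: "U \<subseteq> V" using insert.prems by auto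
  have NNs: "NN (insert n U) h = (\<lambda>y. NN U (E n h) y + (1/2) * NN U (D n h) y)" for h
  proof -
    have "N n h = (\<lambda>y. E n h y + (1/2) * D n h y)" by (auto simp: N_def D_def field_simps)
    then have "NN (insert n U) h = NN U (\<lambda>y. E n h y + (1/2) * D n h y)"
      using NN_insert2[OF insert(1,2), of h] by simp
    then show ?thesis
      by (simp only: linop_add[OF linop_NN[OF insert(1)]] linop_scale[OF linop_NN[OF insert(1)]])
  qed
  let ?A = "NN U (E n f)" and ?B = "NN U (D n f)" and ?C = "NN U (E n g)" and ?H = "NN U (D n g)"
  have inv': "E n ?A = ?A" "E n ?C = ?C" "E n ?B = (\<lambda>y. 0)" "E n ?H = (\<lambda>y. 0)"
    by (simp_all add: E_NN_commute insert(1) E_idem E_D linop_zero[OF linop_NN])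
  have z1: "ex (\<lambda>y. ((?A y)\<^sup>2 * ?C y) * ?H y) = 0"
    by (intro ex_mult_zero[OF n] E_inv_mult E_inv_power2 inv')
  have z2: "ex (\<lambda>y. ((?C y)\<^sup>2 * ?A y) * ?B y) = 0"
    by (intro ex_mult_zero[OF n] E_inv_mult E_inv_power2 inv')
  \<comment> \<open>The last two terms have mean zero by \<open>z1\<close> and \<open>z2\<close>, so
    they may be added freely; they cancel the terms of the expansion that are linear in
    \<open>h\<close> or in \<open>b\<close> alone. The rest is a sum of squares.\<close>
  have pt: "(a + (1/2) * b)\<^sup>2 * (c + (1/2) * h)\<^sup>2 \<le>
     ((((a\<^sup>2 * c\<^sup>2 + a\<^sup>2 * h\<^sup>2) + b\<^sup>2 * c\<^sup>2) + b\<^sup>2 * h\<^sup>2) + (a\<^sup>2 * c) * h) + (c\<^sup>2 * a) * b" for a b c h :: real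
  proof -
    have "((((a\<^sup>2 * c\<^sup>2 + a\<^sup>2 * h\<^sup>2) + b\<^sup>2 * c\<^sup>2) + b\<^sup>2 * h\<^sup>2) + (a\<^sup>2 * c) * h) + (c\<^sup>2 * a) * b
       - (a + (1/2) * b)\<^sup>2 * (c + (1/2) * h)\<^sup>2
       = (1/2) * (a * h - c * b)\<^sup>2 + (1/8) * (a * h - b * h)\<^sup>2 + (1/8) * (b * c - b * h)\<^sup>2
        + (11/16) * (b * h)\<^sup>2 + (1/8) * (a * h)\<^sup>2 + (1/8) * (b * c)\<^sup>2"
      by (simp add: power2_eq_square algebra_simps)
    also have "\<dots> \<ge> 0" by (intro add_nonneg_nonneg mult_nonneg_nonneg) simp_all
    finally show ?thesis by (simp only: diff_ge_0_iff_ge)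
  qed
  have "ex (\<lambda>y. (NN (insert n U) f y)\<^sup>2 * (NN (insert n U) g y)\<^sup>2)
    \<le> ex (\<lambda>y. (((((?A y)\<^sup>2 * (?C y)\<^sup>2 + (?A y)\<^sup>2 * (?H y)\<^sup>2) + (?B y)\<^sup>2 * (?C y)\<^sup>2) + (?B y)\<^sup>2 * (?H y)\<^sup>2)
        + ((?A y)\<^sup>2 * ?C y) * ?H y) + ((?C y)\<^sup>2 * ?A y) * ?B y)"
    unfolding NNs by (intro ex_mono pt)
  also have "\<dots> = ex (\<lambda>y. (?A y)\<^sup>2 * (?C y)\<^sup>2) + ex (\<lambda>y. (?A y)\<^sup>2 * (?H y)\<^sup>2)
     + ex (\<lambda>y. (?B y)\<^sup>2 * (?C y)\<^sup>2) + ex (\<lambda>y. (?B y)\<^sup>2 * (?H y)\<^sup>2)"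
    unfolding ex_add z1 z2 by simp
  also have "\<dots> \<le> fourth_form U (E n f) (E n g) + fourth_form U (E n f) (D n g)
       + fourth_form U (D n f) (E n g) + fourth_form U (D n f) (D n g)"
    by (intro add_mono insert.IH U)
  also have "\<dots> \<le> fourth_form (insert n U) f g" by (rule fourth_form_insert) (use insert n in auto)
  finally show ?case .
qed

text \<open>The Efron--Stein component of \<open>f\<close> indexed by \<open>R\<close>.\<close>

definition es_part :: "'a set \<Rightarrow> (('a \<Rightarrow> 'b) \<Rightarrow> real) \<Rightarrow> ('a \<Rightarrow> 'b) \<Rightarrow> real" where
  "es_part R f = EE (V - R) (DD R f)"

lemma Efron_Stein_sum_aux: "finite U \<Longrightarrow> (\<lambda>y. \<Sum>R\<in>Pow U. EE (U - R) (DD R f) y) = f"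
proof (induction U arbitrary: f rule: finite_induct)
  case (insert n U)
  have inj: "inj_on (insert n) (Pow U)" using insert(2) by (auto simp: inj_on_def)
  have disj: "Pow U \<inter> insert n ` Pow U = {}" using insert(2) by auto
  have 1: "EE (insert n U - R) (DD R f) = EE (U - R) (DD R (E n f))" if "R \<in> Pow U" for R
  proof -
    have "insert n U - R = insert n (U - R)" using insert(2) that by auto
    moreover have "finite R" using that insert(1) finite_subset by auto
    ultimately show ?thesis using insert(1) by (simp add: EE_insert2 E_DD_commute)
  qed
  have 2: "EE (insert n U - insert n R) (DD (insert n R) f) = EE (U - R) (DD R (D n f))" if "R \<in> Pow U" for R
  proof -
    have "insert n U - insert n R = U - R" using insert(2) that by auto
    moreover have "finite R" using that insert(1) finite_subset by auto
    ultimately show ?thesis by (simp add: DD_insert2)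
  qed
  have "(\<Sum>R\<in>Pow (insert n U). EE (insert n U - R) (DD R f) y)
     = (\<Sum>R\<in>Pow U. EE (insert n U - R) (DD R f) y)
       + (\<Sum>R\<in>Pow U. EE (insert n U - insert n R) (DD (insert n R) f) y)" for y
    unfolding Pow_insert using insert(1) disj inj
    by (subst sum.union_disjoint) (simp_all add: sum.reindex)
  then have "(\<Sum>R\<in>Pow (insert n U). EE (insert n U - R) (DD R f) y)
     = (\<Sum>R\<in>Pow U. EE (U - R) (DD R (E n f)) y) + (\<Sum>R\<in>Pow U. EE (U - R) (DD R (D n f)) y)" for y
    using 1 2 by simp
  then show ?case using insert.IH[of "E n f"] insert.IH[of "D n f"] by (simp add: fun_eq_iff D_def)
qed simp

lemma Efron_Stein_sum: "(\<lambda>y. \<Sum>R\<in>Pow V. es_part R f y) = f"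
  unfolding es_part_def by (rule Efron_Stein_sum_aux[OF finV])

lemma linop_es_part: "R \<subseteq> V \<Longrightarrow> linop (es_part R)"
  unfolding es_part_def[abs_def]
  by (rule linop_comp[OF linop_EE linop_DD]) (use finV finite_subset in auto)

lemma E_es_part_out: "n \<in> V - R \<Longrightarrow> E n (es_part R f) = es_part R f"
  unfolding es_part_def using finV by (metis EE_insert finite_Diff insert_absorb)

lemma E_es_part_in: "R \<subseteq> V \<Longrightarrow> n \<in> R \<Longrightarrow> E n (es_part R f) = (\<lambda>y. 0)"
proof -
  assume R: "R \<subseteq> V" "n \<in> R"
  then have fin: "finite R" "finite (V - R)" using finV finite_subset by auto
  have "DD R f = D n (DD R f)" using R fin by (metis DD_insert insert_absorb)
  then have "E n (DD R f) = (\<lambda>y. 0)" by (metis E_D)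
  then show ?thesis unfolding es_part_def by (simp add: E_EE_commute fin linop_zero[OF linop_EE])
qed

lemma NN_es_part:
  assumes "R \<subseteq> V" "U \<subseteq> V"
  shows "NN U (es_part R f) = (\<lambda>y. (1/2) ^ card (R \<inter> U) * es_part R f y)"
proof -
  have "finite U" using assms finV finite_subset by auto
  then show ?thesis using assms(2)
  proof (induction U rule: finite_induct)
    case (insert n U)
    have IH: "NN U (es_part R f) = (\<lambda>y. (1/2) ^ card (R \<inter> U) * es_part R f y)" using insert by simp
    show ?case
    proof (cases "n \<in> R")
      case True
      then have "card (R \<inter> insert n U) = Suc (card (R \<inter> U))" using insert(1,2) by simp
      then show ?thesis using insert(1,2) True assms(1)
        by (simp add: NN_insert IH N_def linop_scale[OF linop_E] E_es_part_in)
    next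
      case False
      then have "R \<inter> insert n U = R \<inter> U" "n \<in> V - R" using insert by auto
      then show ?thesis using insert(1,2)
        by (simp add: NN_insert IH N_def linop_scale[OF linop_E] E_es_part_out fun_eq_iff)
    qed
  qed simp
qed

lemma DD_es_part:
  assumes "R \<subseteq> V" "S \<subseteq> V"
  shows "DD S (es_part R f) = (if S \<subseteq> R then es_part R f else (\<lambda>y. 0))"
proof -
  have "finite S" using assms finV finite_subset by auto
  then show ?thesis using assms(2)
  proof (induction S rule: finite_induct)
    case (insert n S)
    have IH: "DD S (es_part R f) = (if S \<subseteq> R then es_part R f else (\<lambda>y. 0))" using insert by simp
    have "D n (es_part R f) = (if n \<in> R then es_part R f else (\<lambda>y. 0))"
      using E_es_part_in[OF assms(1), of n f] E_es_part_out[of n R f] insert by (auto simp: D_def)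
    then show ?case using insert(1) by (auto simp: DD_insert IH linop_zero[OF linop_D])
  qed simp
qed

text \<open>The index sets differ in a coordinate outside \<open>S\<close>; along it one factor is
  constant and the other has mean zero.\<close>

lemma es_part_orthogonal:
  assumes "R \<subseteq> V" "R' \<subseteq> V" "S \<subseteq> R" "S \<subseteq> R'" "R \<noteq> R'"
  shows "EE (V - S) (\<lambda>y. es_part R f y * es_part R' g y) = (\<lambda>y. 0)"
proof -
  have main: "EE (V - S) (\<lambda>y. es_part R f y * es_part R' g y) = (\<lambda>y. 0)"
    if R: "R \<subseteq> V" "R' \<subseteq> V" "S \<subseteq> R'" "i \<in> R" "i \<notin> R'" for R R' f g i
  proof -
    have i: "i \<in> V - S" "i \<in> V - R'" using R by auto
    have "E i (\<lambda>y. es_part R' g y * es_part R f y) = (\<lambda>y. 0)"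
      by (simp add: E_mult_inv E_es_part_out[OF i(2)] E_es_part_in[OF R(1) R(4)])
    then have "E i (\<lambda>y. es_part R f y * es_part R' g y) = (\<lambda>y. 0)" by (simp add: mult.commute)
    moreover have "EE (V - S) h = EE (V - S) (E i h)" for h
      using finV i(1) by (metis EE_insert2 finite_Diff insert_absorb)
    ultimately show ?thesis using finV by (metis linop_zero[OF linop_EE] finite_Diff)
  qed
  obtain i where "i \<in> R \<and> i \<notin> R' \<or> i \<in> R' \<and> i \<notin> R" using assms by blast
  then show ?thesis using main[of R R' i f g] main[of R' R i g f] assms by (auto simp: mult.commute)
qed

text \<open>Parseval conditional on the coordinates in \<open>S\<close>: \<open>DD S\<close> kills
  the components whose index set does not contain \<open>S\<close>, and the remaining ones are
  orthogonal already after averaging outside \<open>S\<close>.\<close>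

lemma EE_DD_square:
  assumes "S \<subseteq> V"
  shows "EE (V - S) (\<lambda>y. (DD S (\<lambda>y. \<Sum>R\<in>Pow V. c R * es_part R f y) y)\<^sup>2) y
       = (\<Sum>R\<in>{R\<in>Pow V. S \<subseteq> R}. (c R)\<^sup>2 * EE (V - S) (\<lambda>y. (es_part R f y)\<^sup>2) y)"
proof -
  let ?P = "{R\<in>Pow V. S \<subseteq> R}"
  have finS: "finite S" "finite (V - S)" using assms finV finite_subset by auto
  have finP: "finite ?P" using finV by simp
  have 1: "DD S (\<lambda>y. \<Sum>R\<in>Pow V. c R * es_part R f y) = (\<lambda>y. \<Sum>R\<in>?P. c R * es_part R f y)"
  proof -
    have "DD S (\<lambda>y. \<Sum>R\<in>Pow V. c R * es_part R f y) = (\<lambda>y. \<Sum>R\<in>Pow V. if S \<subseteq> R then c R * es_part R f y else 0)"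
      unfolding linop_sum[OF linop_DD[OF finS(1)]] linop_scale[OF linop_DD[OF finS(1)]]
      using assms by (intro ext sum.cong) (auto simp: DD_es_part)
    then show ?thesis using finV by (simp add: sum.If_cases Int_def fun_eq_iff)
  qed
  have "EE (V - S) (\<lambda>y. (\<Sum>R\<in>?P. c R * es_part R f y)\<^sup>2) = (\<lambda>y. \<Sum>R\<in>?P. \<Sum>R'\<in>?P. (c R * c R') * EE (V - S) (\<lambda>y. es_part R f y * es_part R' f y) y)"
  proof -
    have "(\<lambda>y. (\<Sum>R\<in>?P. c R * es_part R f y)\<^sup>2) = (\<lambda>y. \<Sum>R\<in>?P. \<Sum>R'\<in>?P. (c R * c R') * (es_part R f y * es_part R' f y))"
      by (simp add: power2_eq_square sum_product algebra_simps)
    then show ?thesis by (simp add: linop_sum[OF linop_EE] linop_scale[OF linop_EE] finS)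
  qed
  also have "\<dots> = (\<lambda>y. \<Sum>R\<in>?P. \<Sum>R'\<in>?P. if R' = R then (c R)\<^sup>2 * EE (V - S) (\<lambda>y. (es_part R f y)\<^sup>2) y else 0)"
    by (intro ext sum.cong refl) (auto simp: es_part_orthogonal power2_eq_square)
  also have "\<dots> = (\<lambda>y. \<Sum>R\<in>?P. (c R)\<^sup>2 * EE (V - S) (\<lambda>y. (es_part R f y)\<^sup>2) y)"
    using finP by (simp add: sum.delta')
  finally show ?thesis unfolding 1 by (simp add: fun_eq_iff)
qed

text \<open>\<open>DD S f\<close> is a signed sum of the \<open>2 ^ card S\<close> averages
  \<open>EE R f\<close>; this is Cauchy--Schwarz for that sum.\<close>

lemma DD_square_le:
  assumes "finite S"
  shows "(DD S f y)\<^sup>2 \<le> 2 ^ card S * (\<Sum>R\<in>Pow S. (EE R f y)\<^sup>2)"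
  using assms
proof (induction S arbitrary: f rule: finite_induct)
  case (insert n S)
  have inj: "inj_on (insert n) (Pow S)" using insert(2) by (auto simp: inj_on_def)
  have disj: "Pow S \<inter> insert n ` Pow S = {}" using insert(2) by auto
  have "DD (insert n S) f y = DD S f y - DD S (E n f) y"
    using linop_diff[OF linop_DD[OF insert(1)], of f "E n f"] by (simp add: DD_insert2 insert D_def fun_eq_iff)
  then have "(DD (insert n S) f y)\<^sup>2 \<le> 2 * (DD S f y)\<^sup>2 + 2 * (DD S (E n f) y)\<^sup>2" by (simp add: sq_sum_le)
  also have "\<dots> \<le> 2 * (2 ^ card S * (\<Sum>R\<in>Pow S. (EE R f y)\<^sup>2)) + 2 * (2 ^ card S * (\<Sum>R\<in>Pow S. (EE R (E n f) y)\<^sup>2))"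
    using insert.IH[of f] insert.IH[of "E n f"] by simp
  also have "(\<Sum>R\<in>Pow S. (EE R (E n f) y)\<^sup>2) = (\<Sum>R\<in>Pow S. (EE (insert n R) f y)\<^sup>2)"
    using insert(1) by (intro sum.cong refl) (metis EE_insert2 PowD finite_subset)
  also have "2 * (2 ^ card S * (\<Sum>R\<in>Pow S. (EE R f y)\<^sup>2)) + 2 * (2 ^ card S * (\<Sum>R\<in>Pow S. (EE (insert n R) f y)\<^sup>2))
     = 2 ^ card (insert n S) * (\<Sum>R\<in>Pow (insert n S). (EE R f y)\<^sup>2)"
    unfolding Pow_insert using insert(1,2) disj inj
    by (subst sum.union_disjoint) (auto simp: sum.reindex algebra_simps)
  finally show ?case .
qed simp

lemma ex_Cauchy_Schwarz: "(ex (\<lambda>y. f y * g y))\<^sup>2 \<le> ex (\<lambda>y. (f y)\<^sup>2) * ex (\<lambda>y. (g y)\<^sup>2)"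
proof -
  let ?P = "PiE V (\<lambda>_. Om)" and ?h = "\<lambda>z i. if i \<in> V then z i else undefined"
  have "(\<Sum>z\<in>?P. f (?h z) * g (?h z))\<^sup>2 \<le> (\<Sum>z\<in>?P. (f (?h z))\<^sup>2) * (\<Sum>z\<in>?P. (g (?h z))\<^sup>2)"
    by (rule Cauchy_Schwarz_real_sum)
  then show ?thesis unfolding ex_def EE_explicit[OF finV] using card_Om
    by (simp add: divide_right_mono power2_eq_square)
qed

section \<open>Low-degree truncation and the level inequality\<close>

definition lowdeg :: "nat \<Rightarrow> (('a \<Rightarrow> 'b) \<Rightarrow> real) \<Rightarrow> ('a \<Rightarrow> 'b) \<Rightarrow> real" where
  "lowdeg d f = (\<lambda>y. \<Sum>R\<in>{R\<in>Pow V. card R \<le> d}. es_part R f y)"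

lemma lowdeg_alt: "lowdeg d f = (\<lambda>y. \<Sum>R\<in>Pow V. (if card R \<le> d then 1 else 0) * es_part R f y)"
  unfolding lowdeg_def using finV
  by (intro ext sum.mono_neutral_cong_left) auto

lemma ex_es_part_orthogonal: "R \<subseteq> V \<Longrightarrow> R' \<subseteq> V \<Longrightarrow> R \<noteq> R' \<Longrightarrow> ex (\<lambda>y. es_part R f y * es_part R' g y) = 0"
  unfolding ex_def using es_part_orthogonal[of R R' "{}" f g] by simp

lemma ex_es_part_sums:
  "ex (\<lambda>y. (\<Sum>R\<in>Pow V. a R * es_part R f y) * (\<Sum>R\<in>Pow V. b R * es_part R g y))
   = (\<Sum>R\<in>Pow V. a R * b R * ex (\<lambda>y. es_part R f y * es_part R g y))"
proof -
  have "ex (\<lambda>y. (\<Sum>R\<in>Pow V. a R * es_part R f y) * (\<Sum>R\<in>Pow V. b R * es_part R g y))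
    = ex (\<lambda>y. \<Sum>R\<in>Pow V. \<Sum>R'\<in>Pow V. (a R * b R') * (es_part R f y * es_part R' g y))"
    by (simp add: sum_product algebra_simps)
  also have "\<dots> = (\<Sum>R\<in>Pow V. \<Sum>R'\<in>Pow V. (a R * b R') * ex (\<lambda>y. es_part R f y * es_part R' g y))"
    by (simp add: ex_sum ex_scale)
  also have "\<dots> = (\<Sum>R\<in>Pow V. \<Sum>R'\<in>Pow V. if R' = R then a R * b R * ex (\<lambda>y. es_part R f y * es_part R g y) else 0)"
    by (intro sum.cong refl) (auto simp: ex_es_part_orthogonal)
  also have "\<dots> = (\<Sum>R\<in>Pow V. a R * b R * ex (\<lambda>y. es_part R f y * es_part R g y))"
    using finV by (simp add: sum.delta')
  finally show ?thesis .
qed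

lemma ex_lowdeg: "ex (\<lambda>y. lowdeg d f y * lowdeg d g y) = ex (\<lambda>y. f y * lowdeg d g y)"
proof -
  have f: "f = (\<lambda>y. \<Sum>R\<in>Pow V. 1 * es_part R f y)" using Efron_Stein_sum[of f] by simp
  have "ex (\<lambda>y. f y * lowdeg d g y) = (\<Sum>R\<in>Pow V. 1 * (if card R \<le> d then 1 else 0) * ex (\<lambda>y. es_part R f y * es_part R g y))"
    by (subst f) (simp only: lowdeg_alt ex_es_part_sums)
  moreover have "ex (\<lambda>y. lowdeg d f y * lowdeg d g y) = (\<Sum>R\<in>Pow V. (if card R \<le> d then 1 else 0) * (if card R \<le> d then 1 else 0) * ex (\<lambda>y. es_part R f y * es_part R g y))"
    by (simp only: lowdeg_alt ex_es_part_sums)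
  ultimately show ?thesis by (simp add: if_distrib cong: if_cong)
qed

text \<open>Duality: the squared norm \<open>W\<close> of the low-degree part \<open>?p\<close> is
  its correlation with \<open>f\<close>, so it is at most the mean of \<open>F\<close> times the
  absolute value of \<open>?p\<close>. As \<open>F\<close> has mean at most \<phi>, this mean is
  small unless the fourth moment of \<open>?p\<close> is large. The latter is controlled by writing
  \<open>?p\<close> as the noise of a function \<open>q\<close> and using globalness for the
  derivatives \<open>DD S q\<close>.\<close>

lemma level_inequality:
  assumes f: "\<And>y. \<bar>f y\<bar> \<le> F y" and F1: "\<And>y. F y \<le> 1" and r: "r \<ge> 1" and phi: "\<phi> \<ge> 0"
    and is_global: "\<And>R y. R \<subseteq> V \<Longrightarrow> EE (V - R) F y \<le> r ^ card R * \<phi>"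
  shows "(ex (\<lambda>y. (lowdeg d f y)\<^sup>2)) ^ 3 \<le> \<phi> ^ 4 * (80 * r) ^ d"
proof -
  let ?p = "lowdeg d f"
  define W where "W = ex (\<lambda>y. (?p y)\<^sup>2)"
  define c where "c R = (if card R \<le> d then 2 ^ card R else 0 :: real)" for R :: "'a set"
  \<comment> \<open>The preimage of \<open>?p\<close> under \<open>NN V\<close>: noise multiplies
    the component of \<open>R\<close> by \<open>(1/2) ^ card R\<close>, which the weight
    \<open>c R\<close> undoes.\<close>
  define q where "q = (\<lambda>y. \<Sum>R\<in>Pow V. c R * es_part R f y)"
  have F0: "F y \<ge> 0" for y using f[of y] by linarith
  have W0: "W \<ge> 0" unfolding W_def by (rule ex_nonneg) simp
  have Wsum: "W = (\<Sum>R\<in>Pow V. (if card R \<le> d then 1 else 0) * ex (\<lambda>y. (es_part R f y)\<^sup>2))"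
    unfolding W_def lowdeg_alt power2_eq_square ex_es_part_sums by (intro sum.cong) auto
  have NNq: "NN V q = ?p"
  proof -
    have "NN V q = (\<lambda>y. \<Sum>R\<in>Pow V. c R * NN V (es_part R f) y)"
      unfolding q_def linop_sum[OF linop_NN[OF finV]] linop_scale[OF linop_NN[OF finV]] ..
    also have "\<dots> = ?p"
      unfolding lowdeg_alt
    proof (intro ext sum.cong refl)
      fix y R assume "R \<in> Pow V"
      then have "NN V (es_part R f) y = (1/2) ^ card R * es_part R f y"
        by (simp add: NN_es_part Int_absorb2)
      then show "c R * NN V (es_part R f) y = (if card R \<le> d then 1 else 0) * es_part R f y"
        by (simp add: c_def power_one_over)
    qed
    finally show ?thesis .
  qed
  define G where "G S = EE (V - S) (\<lambda>y. (DD S q y)\<^sup>2)" for S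
  have G: "G S y = (\<Sum>R\<in>{R\<in>Pow V. S \<subseteq> R}. (c R)\<^sup>2 * EE (V - S) (\<lambda>y. (es_part R f y)\<^sup>2) y)"
    if "S \<subseteq> V" for S y unfolding G_def q_def by (rule EE_DD_square[OF that])
  have finS: "finite S" "finite (V - S)" if "S \<subseteq> V" for S using that finV finite_subset by auto
  have G0: "G S y \<ge> 0" if "S \<subseteq> V" for S y unfolding G_def by (rule EE_nonneg) (use finS[OF that] in auto)
  have cle: "(c R)\<^sup>2 \<le> 4 ^ d" for R
  proof (cases "card R \<le> d")
    case True
    have "(2 ^ card R)\<^sup>2 = (4::real) ^ card R"
      unfolding power2_eq_square power_mult_distrib[symmetric] by simp
    also have "\<dots> \<le> 4 ^ d" using True by (intro power_increasing) auto
    finally show ?thesis using True by (simp add: c_def)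
  qed (simp add: c_def)
  \<comment> \<open>One factor \<open>2 ^ card S\<close> is the Cauchy--Schwarz loss in
    \<open>DD_square_le\<close>, the other the number of summands. In each summand only the
    coordinates in \<open>S - R\<close> stay fixed, and the density given them is bounded by
    globalness.\<close>
  have glob2: "EE (V - S) (\<lambda>y. (DD S f y)\<^sup>2) y \<le> 4 ^ card S * (r ^ card S * \<phi>)" if S: "S \<subseteq> V" for S y
  proof -
    have "EE (V - S) (\<lambda>y. (DD S f y)\<^sup>2) y \<le> EE (V - S) (\<lambda>y. 2 ^ card S * (\<Sum>R\<in>Pow S. (EE R f y)\<^sup>2)) y"
      by (intro EE_mono DD_square_le finS S)
    also have "\<dots> = 2 ^ card S * (\<Sum>R\<in>Pow S. EE (V - S) (\<lambda>y. (EE R f y)\<^sup>2) y)"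
      unfolding linop_scale[OF linop_EE[OF finS(2)[OF S]]] linop_sum[OF linop_EE[OF finS(2)[OF S]]] ..
    also have "\<dots> \<le> 2 ^ card S * (\<Sum>R\<in>Pow S. r ^ card S * \<phi>)"
    proof (intro mult_left_mono sum_mono)
      fix R assume R: "R \<in> Pow S"
      then have RV: "R \<subseteq> V" using S by auto
      have "EE (V - S) (\<lambda>y. (EE R f y)\<^sup>2) y \<le> EE (V - S) (EE R (\<lambda>y. (f y)\<^sup>2)) y"
        by (intro EE_mono EE_square_le finS S RV)
      also have "\<dots> = EE (V - (S - R)) (\<lambda>y. (f y)\<^sup>2) y"
      proof -
        have "V - S \<union> R = V - (S - R)" using R S by auto
        then show ?thesis by (simp add: EE_Un finS S RV)
      qed
      also have "\<dots> \<le> EE (V - (S - R)) F y"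
      proof (intro EE_mono)
        show "(f y)\<^sup>2 \<le> F y" for y
        proof -
          have "(f y)\<^sup>2 = \<bar>f y\<bar> * \<bar>f y\<bar>" by (simp add: power2_eq_square)
          also have "\<dots> \<le> F y * 1" using f[of y] F1[of y] by (intro mult_mono) (auto intro: F0)
          finally show ?thesis by simp
        qed
      qed (use finV in simp)
      also have "\<dots> \<le> r ^ card (S - R) * \<phi>" by (rule is_global) (use S in auto)
      also have "\<dots> \<le> r ^ card S * \<phi>"
        using r phi by (intro mult_right_mono power_increasing card_mono finS S) auto
      finally show "EE (V - S) (\<lambda>y. (EE R f y)\<^sup>2) y \<le> r ^ card S * \<phi>" .
    qed simp
    also have "\<dots> = 4 ^ card S * (r ^ card S * \<phi>)"
    proof -
      have "(2::real) ^ card S * 2 ^ card S = 4 ^ card S" unfolding power_mult_distrib[symmetric] by simp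
      then show ?thesis using finS(1)[OF S] by (simp add: card_Pow algebra_simps)
    qed
    finally show ?thesis .
  qed
  have Gle: "G S y \<le> 4 ^ d * (4 ^ card S * (r ^ card S * \<phi>))" if S: "S \<subseteq> V" for S y
  proof -
    have "G S y \<le> (\<Sum>R\<in>{R\<in>Pow V. S \<subseteq> R}. 4 ^ d * EE (V - S) (\<lambda>y. (es_part R f y)\<^sup>2) y)"
      unfolding G[OF S] by (intro sum_mono mult_right_mono cle EE_nonneg finS S) auto
    also have "\<dots> = 4 ^ d * EE (V - S) (\<lambda>y. (DD S (\<lambda>y. \<Sum>R\<in>Pow V. 1 * es_part R f y) y)\<^sup>2) y"
      unfolding EE_DD_square[OF S] by (simp add: sum_distrib_left)
    also have "(\<lambda>y. \<Sum>R\<in>Pow V. 1 * es_part R f y) = f" using Efron_Stein_sum[of f] by simp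
    also have "4 ^ d * EE (V - S) (\<lambda>y. (DD S f y)\<^sup>2) y \<le> 4 ^ d * (4 ^ card S * (r ^ card S * \<phi>))"
      by (intro mult_left_mono glob2 S) simp
    finally show ?thesis .
  qed
  let ?w = "\<lambda>R. ex (\<lambda>y. (es_part R f y)\<^sup>2)"
  have w0: "?w R \<ge> 0" for R by (rule ex_nonneg) simp
  have exG: "ex (G S) = (\<Sum>R\<in>{R\<in>Pow V. S \<subseteq> R}. (c R)\<^sup>2 * ?w R)" if S: "S \<subseteq> V" for S
  proof -
    have "G S = (\<lambda>y. \<Sum>R\<in>{R\<in>Pow V. S \<subseteq> R}. (c R)\<^sup>2 * EE (V - S) (\<lambda>y. (es_part R f y)\<^sup>2) y)"
      using G[OF S] by auto
    then show ?thesis by (simp only: ex_sum ex_scale ex_EE[OF Diff_subset])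
  qed
  have fourth: "ex (\<lambda>y. (?p y)\<^sup>2 * (?p y)\<^sup>2) \<le> (80 * r) ^ d * \<phi> * W"
  proof -
    have "ex (\<lambda>y. (?p y)\<^sup>2 * (?p y)\<^sup>2) \<le> fourth_form V q q"
      using noise_fourth_moment[OF finV order.refl, of q q] unfolding NNq .
    also have "\<dots> = (\<Sum>S\<in>Pow V. ex (\<lambda>y. G S y * G S y))" unfolding fourth_form_def G_def ..
    also have "\<dots> \<le> (\<Sum>S\<in>Pow V. (4 ^ d * (4 ^ card S * (r ^ card S * \<phi>))) * ex (G S))"
    proof (intro sum_mono)
      fix S assume "S \<in> Pow V"
      then have S: "S \<subseteq> V" by simp
      have "ex (\<lambda>y. G S y * G S y) \<le> ex (\<lambda>y. (4 ^ d * (4 ^ card S * (r ^ card S * \<phi>))) * G S y)"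
        by (intro ex_mono mult_right_mono Gle G0 S)
      then show "ex (\<lambda>y. G S y * G S y) \<le> (4 ^ d * (4 ^ card S * (r ^ card S * \<phi>))) * ex (G S)"
        by (simp only: ex_scale)
    qed
    also have "\<dots> = (\<Sum>S\<in>Pow V. \<Sum>R\<in>{R\<in>Pow V. S \<subseteq> R}. (4 ^ d * \<phi>) * ((4 * r) ^ card S * ((c R)\<^sup>2 * ?w R)))"
      by (intro sum.cong refl) (simp add: exG sum_distrib_left power_mult_distrib algebra_simps)
    also have "\<dots> = (\<Sum>R\<in>Pow V. \<Sum>S\<in>{S\<in>Pow V. S \<subseteq> R}. (4 ^ d * \<phi>) * ((4 * r) ^ card S * ((c R)\<^sup>2 * ?w R)))"
      by (intro sum.swap_restrict) (use finV in auto)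
    also have "\<dots> = (\<Sum>R\<in>Pow V. (4 ^ d * \<phi>) * ((c R)\<^sup>2 * ?w R) * (\<Sum>S\<in>Pow R. (4 * r) ^ card S))"
    proof (intro sum.cong refl)
      fix R assume "R \<in> Pow V"
      then have "{S \<in> Pow V. S \<subseteq> R} = Pow R" by auto
      then show "(\<Sum>S\<in>{S\<in>Pow V. S \<subseteq> R}. (4 ^ d * \<phi>) * ((4 * r) ^ card S * ((c R)\<^sup>2 * ?w R)))
         = (4 ^ d * \<phi>) * ((c R)\<^sup>2 * ?w R) * (\<Sum>S\<in>Pow R. (4 * r) ^ card S)"
        by (simp add: sum_distrib_left sum_distrib_right algebra_simps)
    qed
    also have "\<dots> \<le> (\<Sum>R\<in>Pow V. ((80 * r) ^ d * \<phi>) * ((if card R \<le> d then 1 else 0) * ?w R))"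
    proof (intro sum_mono)
      fix R assume "R \<in> Pow V"
      then have finR: "finite R" using finS by auto
      have pow: "(\<Sum>S\<in>Pow R. (4 * r) ^ card S) = (1 + 4 * r) ^ card R"
        using finR
      proof (induction R rule: finite_induct)
        case (insert n U)
        have inj: "inj_on (insert n) (Pow U)" using insert(2) by (auto simp: inj_on_def)
        have disj: "Pow U \<inter> insert n ` Pow U = {}" using insert(2) by auto
        have "card (insert n S) = Suc (card S)" if "S \<in> Pow U" for S
          using that insert(1,2) finite_subset by (subst card_insert_disjoint) auto
        then have "(\<Sum>S\<in>Pow U. (4 * r) ^ card (insert n S)) = 4 * r * (\<Sum>S\<in>Pow U. (4 * r) ^ card S)"
          by (simp add: sum_distrib_left)
        then show ?case unfolding Pow_insert using insert disj inj
          by (subst sum.union_disjoint) (simp_all add: sum.reindex algebra_simps)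
      qed simp
      show "(4 ^ d * \<phi>) * ((c R)\<^sup>2 * ?w R) * (\<Sum>S\<in>Pow R. (4 * r) ^ card S)
          \<le> ((80 * r) ^ d * \<phi>) * ((if card R \<le> d then 1 else 0) * ?w R)"
      proof (cases "card R \<le> d")
        case True
        have "(4 ^ d * \<phi>) * ((c R)\<^sup>2 * ?w R) * (1 + 4 * r) ^ card R \<le> (4 ^ d * \<phi>) * (4 ^ d * ?w R) * (5 * r) ^ d"
        proof (intro mult_mono mult_left_mono mult_right_mono cle w0)
          have "(1 + 4 * r) ^ card R \<le> (5 * r) ^ card R" using r by (intro power_mono) auto
          also have "\<dots> \<le> (5 * r) ^ d" using r True by (intro power_increasing) auto
          finally show "(1 + 4 * r) ^ card R \<le> (5 * r) ^ d" .
        qed (use phi w0 r in auto)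
        also have "\<dots> = ((80 * r) ^ d * \<phi>) * ?w R"
        proof -
          \<comment> \<open>The weight \<open>c\<close> costs a factor 4 per degree twice, once in
            the pointwise bound \<open>Gle\<close> and once in \<open>exG\<close>; the sum over the
            subsets of \<open>R\<close> costs \<open>1 + 4 * r\<close>, at most
            \<open>5 * r\<close>.\<close>
          have "(80 * r) ^ d = (4 * 4 * (5 * r)) ^ d" by simp
          also have "\<dots> = 4 ^ d * 4 ^ d * (5 * r) ^ d" by (simp only: power_mult_distrib)
          finally show ?thesis by (simp only: mult.assoc mult.left_commute mult.commute)
        qed
        finally show ?thesis using True pow by simp
      qed (simp add: c_def)
    qed
    also have "\<dots> = (80 * r) ^ d * \<phi> * W" unfolding Wsum by (simp add: sum_distrib_left)
    finally show ?thesis .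
  qed
  have exF: "ex F \<le> \<phi>" using is_global[of "{}" "\<lambda>_. undefined"] by (simp add: ex_def)
  have exF0: "ex F \<ge> 0" by (intro ex_nonneg F0)
  have FF: "(ex (\<lambda>y. F y * h y))\<^sup>2 \<le> \<phi> * ex (\<lambda>y. F y * (h y)\<^sup>2)" for h
  proof -
    have "(ex (\<lambda>y. sqrt (F y) * (sqrt (F y) * h y)))\<^sup>2 \<le> ex (\<lambda>y. (sqrt (F y))\<^sup>2) * ex (\<lambda>y. (sqrt (F y) * h y)\<^sup>2)"
      by (rule ex_Cauchy_Schwarz)
    also have "\<dots> \<le> \<phi> * ex (\<lambda>y. F y * (h y)\<^sup>2)"
      using exF F0 by (intro mult_mono) (auto simp: power_mult_distrib phi intro!: ex_nonneg)
    finally show ?thesis using F0 by (simp add: mult.assoc[symmetric])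
  qed
  have "W = ex (\<lambda>y. f y * ?p y)" unfolding W_def using ex_lowdeg[of d f f] by (simp add: power2_eq_square)
  also have "\<dots> \<le> ex (\<lambda>y. F y * \<bar>?p y\<bar>)"
  proof (rule ex_mono)
    fix y
    have "f y * ?p y \<le> \<bar>f y\<bar> * \<bar>?p y\<bar>" unfolding abs_mult[symmetric] by (rule abs_ge_self)
    also have "\<dots> \<le> F y * \<bar>?p y\<bar>" by (intro mult_right_mono f) simp
    finally show "f y * ?p y \<le> F y * \<bar>?p y\<bar>" .
  qed
  \<comment> \<open>Cauchy--Schwarz with weight \<open>F\<close>, applied twice: the first
    application is squared and gives two factors \<phi>, the second one more, and the fourth moment
    contributes the last.\<close>
  finally have "W ^ 4 \<le> (ex (\<lambda>y. F y * \<bar>?p y\<bar>)) ^ 4" using W0 by (intro power_mono)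
  also have "\<dots> = ((ex (\<lambda>y. F y * \<bar>?p y\<bar>))\<^sup>2)\<^sup>2" by simp
  also have "\<dots> \<le> (\<phi> * ex (\<lambda>y. F y * \<bar>?p y\<bar>\<^sup>2))\<^sup>2" by (intro power_mono FF) simp
  also have "\<dots> = \<phi>\<^sup>2 * (ex (\<lambda>y. F y * (?p y)\<^sup>2))\<^sup>2" by (simp add: power_mult_distrib)
  also have "\<dots> \<le> \<phi>\<^sup>2 * (\<phi> * ex (\<lambda>y. F y * ((?p y)\<^sup>2)\<^sup>2))" by (intro mult_left_mono FF) simp
  also have "\<dots> \<le> \<phi>\<^sup>2 * (\<phi> * ex (\<lambda>y. 1 * ((?p y)\<^sup>2 * (?p y)\<^sup>2)))"
  proof (intro mult_left_mono ex_mono)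
    show "F y * ((?p y)\<^sup>2)\<^sup>2 \<le> 1 * ((?p y)\<^sup>2 * (?p y)\<^sup>2)" for y
      using mult_right_mono[OF F1[of y], of "((?p y)\<^sup>2)\<^sup>2"] by (simp add: power2_eq_square)
  qed (auto simp: phi)
  also have "\<dots> \<le> \<phi>\<^sup>2 * (\<phi> * ((80 * r) ^ d * \<phi> * W))"
    using fourth by (intro mult_left_mono) (auto simp: phi)
  finally have main: "W ^ 3 * W \<le> (\<phi> ^ 4 * (80 * r) ^ d) * W"
    by (simp only: power4_eq_xxxx power3_eq_cube power2_eq_square mult.assoc mult.left_commute mult.commute)
  show ?thesis
  proof (cases "W = 0")
    case True
    then show ?thesis unfolding W_def[symmetric] using phi r by simp
  next
    case False
    then show ?thesis unfolding W_def[symmetric] using main W0 by simp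
  qed
qed

end

section \<open>Quadratic forms on finite sets\<close>

definition ip :: "'x set \<Rightarrow> ('x \<Rightarrow> real) \<Rightarrow> ('x \<Rightarrow> real) \<Rightarrow> real" where
  "ip X u v = (\<Sum>x\<in>X. u x * v x)"

text \<open>\<open>perp X (perp X A)\<close> plays the role of the linear span of \<open>A\<close>.\<close>

definition perp :: "'x set \<Rightarrow> ('x \<Rightarrow> real) set \<Rightarrow> ('x \<Rightarrow> real) set" where
  "perp X A = {v. \<forall>u\<in>A. ip X u v = 0}"

lemma ip_commute: "ip X u v = ip X v u" by (simp add: ip_def mult.commute)
lemma ip_add_right: "ip X u (\<lambda>x. v x + w x) = ip X u v + ip X u w"
  by (simp add: ip_def sum.distrib algebra_simps)
lemma ip_add_left: "ip X (\<lambda>x. v x + w x) u = ip X v u + ip X w u"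
  by (simp add: ip_def sum.distrib algebra_simps)
lemma ip_scale_right: "ip X u (\<lambda>x. c * v x) = c * ip X u v"
  by (simp add: ip_def sum_distrib_left algebra_simps)
lemma ip_scale_left: "ip X (\<lambda>x. c * v x) u = c * ip X v u"
  by (simp add: ip_def sum_distrib_left algebra_simps)
lemma ip_diff_right: "ip X u (\<lambda>x. v x - w x) = ip X u v - ip X u w"
  by (simp add: ip_def sum_subtractf algebra_simps)
lemma ip_sum_right: "ip X u (\<lambda>x. \<Sum>i\<in>I. v i x) = (\<Sum>i\<in>I. ip X u (v i))"
  unfolding ip_def by (subst sum.swap) (simp add: sum_distrib_left)
lemma ip_sum_left: "ip X (\<lambda>x. \<Sum>i\<in>I. v i x) u = (\<Sum>i\<in>I. ip X (v i) u)"
  unfolding ip_commute[of X _ u] by (rule ip_sum_right)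
lemma ip_nonneg: "ip X u u \<ge> 0" by (auto simp: ip_def intro: sum_nonneg)
lemma ip_cong: "(\<And>x. x \<in> X \<Longrightarrow> u x = u' x) \<Longrightarrow> (\<And>x. x \<in> X \<Longrightarrow> v x = v' x) \<Longrightarrow> ip X u v = ip X u' v'"
  by (simp add: ip_def)
lemma ip_self_eq_0: "finite X \<Longrightarrow> ip X u u = 0 \<longleftrightarrow> (\<forall>x\<in>X. u x = 0)"
  unfolding ip_def by (subst sum_nonneg_eq_0_iff) auto
lemma ip_Cauchy_Schwarz: "(ip X u v)\<^sup>2 \<le> ip X u u * ip X v v"
  using Cauchy_Schwarz_real_sum[of u v X] by (simp add: ip_def power2_eq_square)

lemma ip_self_0: "finite X \<Longrightarrow> ip X u u = 0 \<Longrightarrow> ip X u v = 0 \<and> ip X v u = 0"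
  using ip_Cauchy_Schwarz[of X u v] by (simp add: ip_commute)

lemma perp_add: "v \<in> perp X A \<Longrightarrow> w \<in> perp X A \<Longrightarrow> (\<lambda>x. v x + w x) \<in> perp X A"
  by (simp add: perp_def ip_add_right)
lemma perp_diff: "v \<in> perp X A \<Longrightarrow> w \<in> perp X A \<Longrightarrow> (\<lambda>x. v x - w x) \<in> perp X A"
  by (simp add: perp_def ip_diff_right)
lemma perp_scale: "v \<in> perp X A \<Longrightarrow> (\<lambda>x. c * v x) \<in> perp X A"
  by (simp add: perp_def ip_scale_right)
lemma perp_antimono: "A \<subseteq> B \<Longrightarrow> perp X B \<subseteq> perp X A" by (auto simp: perp_def)
lemma subset_perp_perp: "A \<subseteq> perp X (perp X A)" by (auto simp: perp_def ip_commute)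

lemma orthogonal_decomposition:
  assumes X: "finite X" and "finite A"
  shows "\<exists>p h. f = (\<lambda>x. p x + h x) \<and> p \<in> perp X (perp X A) \<and> h \<in> perp X A"
  using assms(2)
proof (induction A arbitrary: f rule: finite_induct)
  case empty
  show ?case
    by (rule exI[of _ "\<lambda>x. 0"], rule exI[of _ f]) (simp add: perp_def ip_def)
next
  case (insert a A)
  from insert.IH[of a] obtain pa ha where a: "a = (\<lambda>x. pa x + ha x)" "pa \<in> perp X (perp X A)" "ha \<in> perp X A"
    by blast
  from insert.IH[of f] obtain p h where f: "f = (\<lambda>x. p x + h x)" "p \<in> perp X (perp X A)" "h \<in> perp X A"
    by blast
  have sub: "perp X (perp X A) \<subseteq> perp X (perp X (insert a A))"
    by (intro perp_antimono) (auto simp: perp_def)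
  have aperp: "a \<in> perp X (perp X (insert a A))" using subset_perp_perp[of "insert a A" X] by auto
  have ha: "ha = (\<lambda>x. a x - pa x)" using a(1) by simp
  have haperp: "ha \<in> perp X (perp X (insert a A))"
    unfolding ha using aperp a(2) sub by (intro perp_diff) auto
  \<comment> \<open>One Gram--Schmidt step. If \<open>a\<close> agrees on \<open>X\<close> with its
    projection, then \<open>ha\<close> vanishes on \<open>X\<close> and there is nothing to
    remove.\<close>
  define c where "c = (if ip X ha ha = 0 then 0 else ip X ha h / ip X ha ha)"
  have pah: "ip X pa h = 0" using a(2) f(3) by (simp add: perp_def ip_commute)
  have paha: "ip X pa ha = 0" using a(2,3) by (simp add: perp_def ip_commute)
  have "ip X a (\<lambda>x. h x - c * ha x) = ip X ha h - c * ip X ha ha"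
    unfolding ip_diff_right ip_scale_right by (subst (1 2) a(1)) (simp add: ip_add_left pah paha)
  also have "\<dots> = 0" using ip_self_0[OF X, of ha h] by (auto simp: c_def)
  finally have 1: "ip X a (\<lambda>x. h x - c * ha x) = 0" .
  have 2: "(\<lambda>x. h x - c * ha x) \<in> perp X A" by (intro perp_diff perp_scale f a)
  have "(\<lambda>x. h x - c * ha x) \<in> perp X (insert a A)" using 1 2 by (simp add: perp_def)
  moreover have "(\<lambda>x. p x + c * ha x) \<in> perp X (perp X (insert a A))"
    using f(2) sub haperp by (intro perp_add perp_scale) auto
  moreover have "f = (\<lambda>x. (p x + c * ha x) + (h x - c * ha x))" using f(1) by simp
  ultimately show ?case
    by (intro exI[of _ "\<lambda>x. p x + c * ha x"] exI[of _ "\<lambda>x. h x - c * ha x"] conjI)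
qed

section \<open>Compactness and extremal vectors of quadratic forms\<close>

lemma pointwise_convergent_subsequence:
  fixes f :: "nat \<Rightarrow> 'x \<Rightarrow> real"
  assumes "finite X" and "\<And>n x. x \<in> X \<Longrightarrow> \<bar>f n x\<bar> \<le> C"
  shows "\<exists>r l. strict_mono (r :: nat \<Rightarrow> nat) \<and> (\<forall>x\<in>X. (\<lambda>n. f (r n) x) \<longlonglongrightarrow> l x)"
  using assms
proof (induction X rule: finite_induct)
  case empty
  show ?case by (rule exI[of _ id]) (auto simp: strict_mono_def)
next
  case (insert a X)
  then obtain r l where r: "strict_mono (r :: nat \<Rightarrow> nat)" "\<forall>x\<in>X. (\<lambda>n. f (r n) x) \<longlonglongrightarrow> l x"
    by auto
  obtain s where s: "strict_mono (s :: nat \<Rightarrow> nat)" "monoseq (\<lambda>n. f (r (s n)) a)"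
    using seq_monosub[of "\<lambda>n. f (r n) a"] by auto
  have "Bseq (\<lambda>n. f (r (s n)) a)" using insert.prems by (intro BseqI'[of _ C]) auto
  then obtain L where L: "(\<lambda>n. f (r (s n)) a) \<longlonglongrightarrow> L"
    using Bseq_monoseq_convergent[OF _ s(2)] by (auto simp: convergent_def)
  have "(\<lambda>n. f ((r \<circ> s) n) x) \<longlonglongrightarrow> (l(a := L)) x" if "x \<in> insert a X" for x
  proof (cases "x = a")
    case False
    then have "(\<lambda>n. f (r n) x) \<longlonglongrightarrow> l x" using r(2) that by auto
    then have "((\<lambda>n. f (r n) x) \<circ> s) \<longlonglongrightarrow> l x" using s(1) LIMSEQ_subseq_LIMSEQ by blast
    then show ?thesis using False by (simp add: o_def)
  qed (use L in simp)
  moreover have "strict_mono (r \<circ> s)" using r(1) s(1) by (rule strict_mono_o)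
  ultimately show ?case by blast
qed

definition qform :: "'x set \<Rightarrow> ('x \<Rightarrow> 'x \<Rightarrow> real) \<Rightarrow> ('x \<Rightarrow> real) \<Rightarrow> ('x \<Rightarrow> real) \<Rightarrow> real" where
  "qform X K v w = (\<Sum>x\<in>X. \<Sum>y\<in>X. K x y * v x * w y)"

lemma qform_add_left: "qform X K (\<lambda>x. u x + v x) w = qform X K u w + qform X K v w"
  by (simp add: qform_def sum.distrib algebra_simps)
lemma qform_add_right: "qform X K w (\<lambda>x. u x + v x) = qform X K w u + qform X K w v"
  by (simp add: qform_def sum.distrib algebra_simps)
lemma qform_scale_left: "qform X K (\<lambda>x. c * u x) w = c * qform X K u w"
  by (simp add: qform_def sum_distrib_left algebra_simps)
lemma qform_scale_right: "qform X K w (\<lambda>x. c * u x) = c * qform X K w u"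
  by (simp add: qform_def sum_distrib_left algebra_simps)
lemma qform_sym: assumes "\<And>x y. x \<in> X \<Longrightarrow> y \<in> X \<Longrightarrow> K x y = K y x" shows "qform X K v w = qform X K w v"
  unfolding qform_def by (subst sum.swap) (intro sum.cong refl, simp add: assms algebra_simps)
lemma qform_ip: "qform X K u v = ip X u (\<lambda>x. \<Sum>y\<in>X. K x y * v y)"
  by (simp add: qform_def ip_def sum_distrib_left algebra_simps)

lemma linear_coeff_zero:
  assumes "\<And>t::real. 2 * t * a + t\<^sup>2 * b \<le> 0" shows "a = 0"
proof (rule ccontr)
  assume "a \<noteq> 0"
  define t where "t = a / (\<bar>b\<bar> + 1)"
  have t2: "t\<^sup>2 > 0" using \<open>a \<noteq> 0\<close> unfolding t_def by auto
  have "a = t * (\<bar>b\<bar> + 1)" unfolding t_def by simp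
  then have "2 * t * a + t\<^sup>2 * b = t\<^sup>2 * (2 * (\<bar>b\<bar> + 1) + b)"
    by (simp add: power2_eq_square algebra_simps)
  also have "\<dots> > 0" using t2 by (intro mult_pos_pos) auto
  finally show False using assms[of t] by simp
qed

text \<open>The Rayleigh quotient attains its maximum on the unit sphere of \<open>perp X A\<close>.
  The eigenvalue relation is tested only against \<open>perp X A\<close>: \<open>v\<close> is an
  eigenvector of the compression of \<open>K\<close> to that subspace.\<close>

theorem top_eigenvector:
  assumes X: "finite X" and sym: "\<And>x y. x \<in> X \<Longrightarrow> y \<in> X \<Longrightarrow> K x y = K y x"
    and ne: "v0 \<in> perp X A" "ip X v0 v0 > 0"
  shows "\<exists>v \<mu>. v \<in> perp X A \<and> ip X v v = 1 \<and> (\<forall>w\<in>perp X A. qform X K v w = \<mu> * ip X v w)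
     \<and> (\<forall>w\<in>perp X A. qform X K w w \<le> \<mu> * ip X w w)"
proof -
  define S where "S = {v \<in> perp X A. ip X v v = 1}"
  define C where "C = (\<Sum>x\<in>X. \<Sum>y\<in>X. \<bar>K x y\<bar>)"
  have normalize: "(\<lambda>x. (1 / sqrt (ip X v v)) * v x) \<in> S" if "v \<in> perp X A" "ip X v v > 0" for v
  proof -
    have "1 / sqrt s * (1 / sqrt s * s) = 1" if "s > 0" for s :: real
      using that real_sqrt_mult_self[of s] by (simp add: field_simps)
    then show ?thesis
      using that unfolding S_def by (simp only: mem_Collect_eq perp_scale ip_scale_left ip_scale_right)
  qed
  have small: "\<bar>v x\<bar> \<le> 1" if "v \<in> S" "x \<in> X" for v x
  proof -
    have "(v x)\<^sup>2 \<le> (\<Sum>x\<in>X. (v x)\<^sup>2)" using X that(2) by (intro member_le_sum) auto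
    then have "(v x)\<^sup>2 \<le> 1" using that(1) by (simp add: S_def ip_def power2_eq_square)
    then show ?thesis by (simp add: abs_square_le_1)
  qed
  have bdd: "qform X K v v \<le> C" if "v \<in> S" for v
    unfolding qform_def C_def
  proof (intro sum_mono)
    fix x y assume "x \<in> X" "y \<in> X"
    then have "\<bar>K x y * v x * v y\<bar> \<le> \<bar>K x y\<bar> * 1 * 1"
      unfolding abs_mult using small[OF that] by (intro mult_mono) auto
    then show "K x y * v x * v y \<le> \<bar>K x y\<bar>" by simp
  qed
  define M where "M = (SUP v\<in>S. qform X K v v)"
  have Sne: "S \<noteq> {}" using normalize[OF ne] by auto
  have bdda: "bdd_above ((\<lambda>v. qform X K v v) ` S)" using bdd by (auto simp: bdd_above_def)
  have leM: "qform X K v v \<le> M" if "v \<in> S" for v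
    unfolding M_def using bdda that by (rule cSUP_upper2) simp
  have "\<exists>v\<in>S. qform X K v v > M - inverse (real (Suc n))" for n
    using less_cSUP_iff[OF Sne bdda, of "M - inverse (real (Suc n))"] by (simp add: M_def)
  then obtain f where f: "\<And>n. f n \<in> S" "\<And>n. qform X K (f n) (f n) > M - inverse (real (Suc n))"
    by metis
  obtain r l where r: "strict_mono (r :: nat \<Rightarrow> nat)" and l: "\<And>x. x \<in> X \<Longrightarrow> (\<lambda>n. f (r n) x) \<longlonglongrightarrow> l x"
    using pointwise_convergent_subsequence[OF X, of f 1] small f(1) by metis
  have ip_lim: "(\<lambda>n. ip X u (f (r n))) \<longlonglongrightarrow> ip X u l" for u
    unfolding ip_def by (intro tendsto_intros l)
  have lperp: "l \<in> perp X A"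
    unfolding perp_def
  proof (safe)
    fix u assume "u \<in> A"
    then have "ip X u (f (r n)) = 0" for n using f(1) by (auto simp: S_def perp_def)
    then show "ip X u l = 0" using ip_lim[of u] by (simp add: LIMSEQ_const_iff)
  qed
  have "(\<lambda>n. ip X (f (r n)) (f (r n))) \<longlonglongrightarrow> ip X l l"
    unfolding ip_def by (intro tendsto_intros l)
  moreover have "ip X (f n) (f n) = 1" for n using f(1) by (simp add: S_def)
  ultimately have l1: "ip X l l = 1" by (simp add: LIMSEQ_const_iff)
  have lS: "l \<in> S" using lperp l1 by (simp add: S_def)
  have qlim: "(\<lambda>n. qform X K (f (r n)) (f (r n))) \<longlonglongrightarrow> qform X K l l"
    unfolding qform_def by (intro tendsto_intros l)
  have "(\<lambda>n. M - inverse (real (Suc (r n)))) \<longlonglongrightarrow> M - 0"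
    using LIMSEQ_subseq_LIMSEQ[OF LIMSEQ_inverse_real_of_nat r] by (intro tendsto_intros) (simp add: o_def)
  then have "M \<le> qform X K l l"
    using qlim f(2) by (intro LIMSEQ_le[of _ M]) (auto intro: less_imp_le)
  then have lM: "qform X K l l = M" using leM[OF lS] by simp
  have max: "qform X K w w \<le> M * ip X w w" if w: "w \<in> perp X A" for w
  proof (cases "ip X w w = 0")
    case True
    then have "w x = 0" if "x \<in> X" for x using ip_self_eq_0[OF X] that by auto
    then have "qform X K w w = 0" by (simp add: qform_def)
    then show ?thesis using True by simp
  next
    case False
    then have pos: "ip X w w > 0" using ip_nonneg[of X w] by simp
    let ?c = "1 / sqrt (ip X w w)"
    have "?c * (?c * qform X K w w) \<le> M"
      using leM[OF normalize[OF w pos]] unfolding qform_scale_left qform_scale_right by simp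
    then show ?thesis using pos by (simp add: divide_le_eq)
  qed
  have eig: "qform X K l w = M * ip X l w" if w: "w \<in> perp X A" for w
  proof -
    \<comment> \<open>First variation: \<open>l + t w\<close> cannot beat the maximum for any
      \<open>t\<close>, so the coefficient of \<open>t\<close> vanishes.\<close>
    have "2 * t * (qform X K l w - M * ip X l w) + t\<^sup>2 * (qform X K w w - M * ip X w w) \<le> 0" for t
    proof -
      have "(\<lambda>x. l x + t * w x) \<in> perp X A" by (intro perp_add perp_scale lperp w)
      from max[OF this] show ?thesis
        unfolding qform_add_left qform_add_right qform_scale_left qform_scale_right
          ip_add_left ip_add_right ip_scale_left ip_scale_right
        using qform_sym[of X K w l, OF sym] ip_commute[of X w l] lM l1
        by (simp add: power2_eq_square algebra_simps)
    qed
    then have "qform X K l w - M * ip X l w = 0" by (rule linear_coeff_zero)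
    then show ?thesis by simp
  qed
  show ?thesis using lperp l1 eig max by blast
qed

section \<open>Functions on a symmetric group\<close>

definition character :: "'a set \<Rightarrow> (('a \<Rightarrow> 'a) \<Rightarrow> real) \<Rightarrow> bool" where
  "character V \<chi> \<longleftrightarrow> (\<forall>\<sigma> \<tau>. \<sigma> permutes V \<longrightarrow> \<tau> permutes V \<longrightarrow> \<chi> (\<sigma> \<circ> \<tau>) = \<chi> \<sigma> * \<chi> \<tau>) \<and>
     (\<forall>\<sigma>. \<sigma> permutes V \<longrightarrow> \<chi> \<sigma> * \<chi> \<sigma> = 1)"

lemma character_one: "character V (\<lambda>_. 1)" by (simp add: character_def)

lemma character_sign: "finite V \<Longrightarrow> character V (\<lambda>\<sigma>. real_of_int (sign \<sigma>))"
  unfolding character_def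
  by (auto simp: sign_compose permutes_imp_permutation of_int_mult[symmetric] simp del: of_int_mult)

definition rt :: "('a \<Rightarrow> 'a) \<Rightarrow> (('a \<Rightarrow> 'a) \<Rightarrow> real) \<Rightarrow> ('a \<Rightarrow> 'a) \<Rightarrow> real" where
  "rt \<sigma> v = (\<lambda>x. v (x \<circ> \<sigma>))"

lemma rt_rt: "rt \<sigma> (rt \<tau> v) = rt (\<sigma> \<circ> \<tau>) v" by (simp add: rt_def comp_assoc)
lemma rt_id [simp]: "rt id v = v" by (simp add: rt_def)
locale sym_space =
  fixes V :: "'a set"
  assumes finV: "finite V"
begin

abbreviation m where "m \<equiv> card V"
definition P where "P = {\<sigma>. \<sigma> permutes V}"
definition Stab where "Stab T = {\<sigma>. \<sigma> permutes (V - T)}"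
text \<open>For \<open>x\<close> in \<open>P\<close> this is the left coset
  \<open>x \<circ> Stab T\<close> (see \<open>Cyl_bij\<close>), so right multiplication by
  \<open>Stab T\<close> preserves it.\<close>

definition Cyl where "Cyl x T = {y \<in> P. \<forall>t\<in>T. y t = x t}"

lemma finP: "finite P" unfolding P_def by (rule finite_permutations[OF finV])
lemma cardP: "card P = fact m" unfolding P_def by (rule card_permutations[OF refl finV])
lemma finStab: "finite (Stab T)" unfolding Stab_def using finV by (intro finite_permutations) auto
lemma cardStab: "T \<subseteq> V \<Longrightarrow> card (Stab T) = fact (m - card T)"
  unfolding Stab_def using finV by (intro card_permutations) (auto simp: card_Diff_subset finite_subset)
lemma Stab_subset: "Stab T \<subseteq> P" unfolding Stab_def P_def by (auto intro: permutes_subset)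
lemma id_P [simp]: "id \<in> P" by (simp add: P_def)
lemma id_Stab [simp]: "id \<in> Stab T" by (simp add: Stab_def)
lemma comp_P: "x \<in> P \<Longrightarrow> y \<in> P \<Longrightarrow> x \<circ> y \<in> P" by (simp add: P_def permutes_compose)
lemma inv_P: "x \<in> P \<Longrightarrow> inv' x \<in> P" by (simp add: P_def permutes_inv)
lemma comp_Stab: "x \<in> Stab T \<Longrightarrow> y \<in> Stab T \<Longrightarrow> x \<circ> y \<in> Stab T" by (simp add: Stab_def permutes_compose)
lemma inv_Stab: "x \<in> Stab T \<Longrightarrow> inv' x \<in> Stab T" by (simp add: Stab_def permutes_inv)
lemma inv_comp: "x \<in> P \<Longrightarrow> inv' x \<circ> x = id" "x \<in> P \<Longrightarrow> x \<circ> inv' x = id"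
  by (simp_all add: P_def permutes_inv_o)
lemma inv_cancel: "x \<in> P \<Longrightarrow> inv' x \<circ> (x \<circ> y) = y" "x \<in> P \<Longrightarrow> x \<circ> (inv' x \<circ> y) = y"
  "x \<in> P \<Longrightarrow> (y \<circ> x) \<circ> inv' x = y" "x \<in> P \<Longrightarrow> (y \<circ> inv' x) \<circ> x = y"
  by (simp_all add: inv_comp comp_assoc[symmetric]) (simp_all add: inv_comp comp_assoc)
lemma inv_inv_P: "x \<in> P \<Longrightarrow> inv' (inv' x) = x" by (simp add: P_def permutes_inv_inv)
lemma Stab_fix: "\<sigma> \<in> Stab T \<Longrightarrow> t \<in> T \<Longrightarrow> \<sigma> t = t" by (simp add: Stab_def permutes_def)
lemma Stab_iff: "\<sigma> \<in> Stab T \<longleftrightarrow> \<sigma> \<in> P \<and> (\<forall>t\<in>T. \<sigma> t = t)"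
  unfolding Stab_def P_def by (auto simp: permutes_def)
lemma P_apply: "x \<in> P \<Longrightarrow> t \<in> V \<Longrightarrow> x t \<in> V" by (simp add: P_def permutes_in_image)
lemma P_inj: "x \<in> P \<Longrightarrow> x s = x t \<longleftrightarrow> s = t" unfolding P_def by (metis permutes_def mem_Collect_eq)
lemma P_inv_apply: "x \<in> P \<Longrightarrow> inv' x (x t) = t" "x \<in> P \<Longrightarrow> x (inv' x t) = t"
  by (simp_all add: P_def permutes_inverses)

lemma bij_right: "\<sigma> \<in> P \<Longrightarrow> bij_betw (\<lambda>x. x \<circ> \<sigma>) P P"
  by (rule bij_betw_byWitness[where f' = "\<lambda>x. x \<circ> inv' \<sigma>"]) (auto simp: inv_cancel comp_P inv_P)
lemma bij_left: "\<sigma> \<in> P \<Longrightarrow> bij_betw (\<lambda>x. \<sigma> \<circ> x) P P"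
  by (rule bij_betw_byWitness[where f' = "\<lambda>x. inv' \<sigma> \<circ> x"]) (auto simp: inv_cancel comp_P inv_P)
lemma bij_right_Stab: "\<sigma> \<in> Stab T \<Longrightarrow> bij_betw (\<lambda>x. x \<circ> \<sigma>) (Stab T) (Stab T)"
  using subsetD[OF Stab_subset, of \<sigma> T]
  by (intro bij_betw_byWitness[where f' = "\<lambda>x. x \<circ> inv' \<sigma>"]) (auto simp: inv_cancel comp_Stab inv_Stab)
lemma bij_left_Stab: "\<sigma> \<in> Stab T \<Longrightarrow> bij_betw (\<lambda>x. \<sigma> \<circ> x) (Stab T) (Stab T)"
  using subsetD[OF Stab_subset, of \<sigma> T]
  by (intro bij_betw_byWitness[where f' = "\<lambda>x. inv' \<sigma> \<circ> x"]) (auto simp: inv_cancel comp_Stab inv_Stab)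

lemma sum_right: "\<sigma> \<in> P \<Longrightarrow> (\<Sum>x\<in>P. f (x \<circ> \<sigma>)) = (\<Sum>x\<in>P. f x)"
  by (rule sum.reindex_bij_betw[OF bij_right])
lemma sum_left: "\<sigma> \<in> P \<Longrightarrow> (\<Sum>x\<in>P. f (\<sigma> \<circ> x)) = (\<Sum>x\<in>P. f x)"
  by (rule sum.reindex_bij_betw[OF bij_left])
lemma sum_right_Stab: "\<sigma> \<in> Stab T \<Longrightarrow> (\<Sum>x\<in>Stab T. f (x \<circ> \<sigma>)) = (\<Sum>x\<in>Stab T. f x)"
  by (rule sum.reindex_bij_betw[OF bij_right_Stab])
lemma sum_left_Stab: "\<sigma> \<in> Stab T \<Longrightarrow> (\<Sum>x\<in>Stab T. f (\<sigma> \<circ> x)) = (\<Sum>x\<in>Stab T. f x)"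
  by (rule sum.reindex_bij_betw[OF bij_left_Stab])

lemma Cyl_bij: assumes "x \<in> P" shows "bij_betw (\<lambda>\<rho>. x \<circ> \<rho>) (Stab T) (Cyl x T)"
proof (rule bij_betw_byWitness[where f' = "\<lambda>y. inv' x \<circ> y"])
  show "(\<lambda>\<rho>. x \<circ> \<rho>) ` Stab T \<subseteq> Cyl x T" using assms subsetD[OF Stab_subset, of _ T] by (auto simp: Cyl_def comp_P Stab_fix)
  show "(\<lambda>y. inv' x \<circ> y) ` Cyl x T \<subseteq> Stab T"
    using assms by (auto simp: Cyl_def Stab_iff comp_P inv_P P_inv_apply)
qed (use assms in \<open>auto simp: inv_cancel\<close>)

lemma sum_Cyl: "x \<in> P \<Longrightarrow> (\<Sum>y\<in>Cyl x T. f y) = (\<Sum>\<rho>\<in>Stab T. f (x \<circ> \<rho>))"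
  using sum.reindex_bij_betw[OF Cyl_bij, of x f T] by simp

lemma extend_injection:
  assumes "T \<subseteq> V" "inj_on J T" "J ` T \<subseteq> V"
  shows "\<exists>\<sigma>\<in>P. \<forall>t\<in>T. \<sigma> t = J t"
proof -
  have finT: "finite T" using assms(1) finV finite_subset by auto
  have "card (V - T) = card (V - J ` T)"
    using assms finT by (simp add: card_Diff_subset card_image)
  then obtain g where g: "bij_betw g (V - T) (V - J ` T)"
    using finV by (metis finite_same_card_bij finite_Diff)
  define \<sigma> where "\<sigma> x = (if x \<in> T then J x else if x \<in> V then g x else x)" for x
  have b1: "bij_betw \<sigma> T (J ` T)" using assms(2) by (subst bij_betw_cong[of _ _ J]) (auto simp: \<sigma>_def bij_betw_def)
  have b2: "bij_betw \<sigma> (V - T) (V - J ` T)" using g by (subst bij_betw_cong[of _ _ g]) (auto simp: \<sigma>_def)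
  have "bij_betw \<sigma> (T \<union> (V - T)) (J ` T \<union> (V - J ` T))" by (rule bij_betw_combine[OF b1 b2]) auto
  then have "bij_betw \<sigma> V V" using assms by (simp add: Un_absorb1 Un_Diff_cancel)
  then have "\<sigma> \<in> P" unfolding P_def by (auto intro!: bij_imp_permutes simp: \<sigma>_def assms(1)[THEN subsetD])
  then show ?thesis by (auto simp: \<sigma>_def intro: bexI[of _ \<sigma>])
qed

lemma ip_rt: "\<sigma> \<in> P \<Longrightarrow> ip P (rt \<sigma> u) (rt \<sigma> v) = ip P u v"
  unfolding ip_def rt_def using sum_right[of \<sigma> "\<lambda>x. u x * v x"] by simp

lemma ip_rt_left: "\<sigma> \<in> P \<Longrightarrow> ip P (rt \<sigma> u) v = ip P u (rt (inv' \<sigma>) v)"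
  using ip_rt[of "inv' \<sigma>" "rt \<sigma> u" v] by (simp add: inv_P rt_rt inv_comp)

section \<open>Cylinder functions and right-invariant subspaces\<close>

definition cylfun where
  "cylfun \<chi> x T = (\<lambda>y. if y \<in> Cyl x T then \<chi> y else (0::real))"

definition Cyls where
  "Cyls \<chi> d = {cylfun \<chi> x T |x T. x \<in> P \<and> T \<subseteq> V \<and> card T \<le> d}"

lemma finite_Cyls: "finite (Cyls \<chi> d)"
proof -
  have "Cyls \<chi> d \<subseteq> (\<lambda>(x,T). cylfun \<chi> x T) ` (P \<times> Pow V)" by (auto simp: Cyls_def)
  then show ?thesis using finP finV by (meson finite_subset finite_imageI finite_SigmaI finite_Pow_iff)
qed

lemma ip_cylfun: "ip P (cylfun \<chi> x T) h = (\<Sum>y\<in>Cyl x T. \<chi> y * h y)"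
proof -
  have "Cyl x T \<subseteq> P" by (auto simp: Cyl_def)
  then show ?thesis unfolding ip_def cylfun_def
    by (intro sum.mono_neutral_cong_right) (auto simp: finP)
qed

lemma perp_Cyls: "h \<in> perp P (Cyls \<chi> d) \<longleftrightarrow>
   (\<forall>x T. x \<in> P \<longrightarrow> T \<subseteq> V \<longrightarrow> card T \<le> d \<longrightarrow> (\<Sum>y\<in>Cyl x T. \<chi> y * h y) = 0)"
  unfolding perp_def Cyls_def ip_cylfun[symmetric] by auto

lemma rt_perp_Cyls:
  assumes \<chi>: "character V \<chi>" and h: "h \<in> perp P (Cyls \<chi> d)" and s: "\<sigma> \<in> P"
  shows "rt \<sigma> h \<in> perp P (Cyls \<chi> d)"
  unfolding perp_Cyls
proof (intro allI impI)
  fix x T assume x: "x \<in> P" and T: "T \<subseteq> V" "card T \<le> d"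
  have b: "bij_betw (\<lambda>y. y \<circ> \<sigma>) (Cyl x T) (Cyl (x \<circ> \<sigma>) (inv' \<sigma> ` T))"
  proof (rule bij_betw_byWitness[where f' = "\<lambda>y. y \<circ> inv' \<sigma>"])
    show "(\<lambda>y. y \<circ> \<sigma>) ` Cyl x T \<subseteq> Cyl (x \<circ> \<sigma>) (inv' \<sigma> ` T)"
      using s by (auto simp: Cyl_def comp_P P_inv_apply)
    show "(\<lambda>y. y \<circ> inv' \<sigma>) ` Cyl (x \<circ> \<sigma>) (inv' \<sigma> ` T) \<subseteq> Cyl x T"
      using s by (auto simp: Cyl_def comp_P inv_P P_inv_apply)
  qed (use s in \<open>auto simp: inv_cancel\<close>)
  have inj: "inj_on (inv' \<sigma>) T" using inv_P[OF s] by (auto simp: inj_on_def P_inj)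
  have T': "inv' \<sigma> ` T \<subseteq> V" "card (inv' \<sigma> ` T) \<le> d"
    using T inj inv_P[OF s] by (auto simp: card_image intro: P_apply)
  have "(\<Sum>y\<in>Cyl x T. \<chi> y * rt \<sigma> h y) = (\<Sum>y\<in>Cyl x T. \<chi> \<sigma> * (\<chi> (y \<circ> \<sigma>) * h (y \<circ> \<sigma>)))"
  proof (intro sum.cong refl)
    fix y assume "y \<in> Cyl x T"
    then have "y permutes V" by (simp add: Cyl_def P_def)
    moreover have "\<sigma> permutes V" using s by (simp add: P_def)
    ultimately have "\<chi> (y \<circ> \<sigma>) = \<chi> y * \<chi> \<sigma>" "\<chi> \<sigma> * \<chi> \<sigma> = 1" using \<chi> by (auto simp: character_def)
    then have "\<chi> \<sigma> * \<chi> (y \<circ> \<sigma>) = \<chi> y" by (simp add: mult.left_commute)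
    then show "\<chi> y * rt \<sigma> h y = \<chi> \<sigma> * (\<chi> (y \<circ> \<sigma>) * h (y \<circ> \<sigma>))" by (simp add: rt_def mult.assoc[symmetric])
  qed
  also have "\<dots> = \<chi> \<sigma> * (\<Sum>y\<in>Cyl (x \<circ> \<sigma>) (inv' \<sigma> ` T). \<chi> y * h y)"
    unfolding sum_distrib_left[symmetric]
    using sum.reindex_bij_betw[OF b, of "\<lambda>y. \<chi> y * h y"] by simp
  also have "\<dots> = 0" using h T' comp_P[OF x s] by (simp add: perp_Cyls)
  finally show "(\<Sum>y\<in>Cyl x T. \<chi> y * rt \<sigma> h y) = 0" .
qed

definition right_subspace where
  "right_subspace Es \<longleftrightarrow> (\<forall>v\<in>Es. \<forall>w\<in>Es. (\<lambda>x. v x + w x) \<in> Es) \<and> (\<forall>c. \<forall>v\<in>Es. (\<lambda>x. c * v x) \<in> Es)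
     \<and> (\<forall>\<sigma>\<in>P. \<forall>v\<in>Es. rt \<sigma> v \<in> Es)"

lemma right_subspace_add: "right_subspace Es \<Longrightarrow> v \<in> Es \<Longrightarrow> w \<in> Es \<Longrightarrow> (\<lambda>x. v x + w x) \<in> Es" by (simp add: right_subspace_def)
lemma right_subspace_scale: "right_subspace Es \<Longrightarrow> v \<in> Es \<Longrightarrow> (\<lambda>x. c * v x) \<in> Es" by (simp add: right_subspace_def)
lemma right_subspace_rt: "right_subspace Es \<Longrightarrow> v \<in> Es \<Longrightarrow> \<sigma> \<in> P \<Longrightarrow> rt \<sigma> v \<in> Es" by (simp add: right_subspace_def)
lemma right_subspace_diff: "right_subspace Es \<Longrightarrow> v \<in> Es \<Longrightarrow> w \<in> Es \<Longrightarrow> (\<lambda>x. v x - w x) \<in> Es"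
  using right_subspace_add[of Es v "\<lambda>x. (-1) * w x"] right_subspace_scale[of Es w "-1"] by simp
lemma right_subspace_sum: "right_subspace Es \<Longrightarrow> v0 \<in> Es \<Longrightarrow> (\<And>i. i \<in> I \<Longrightarrow> v i \<in> Es) \<Longrightarrow> (\<lambda>x. \<Sum>i\<in>I. v i x) \<in> Es"
proof (induction I rule: infinite_finite_induct)
  case (insert i I) then show ?case using right_subspace_add[of Es "v i" "\<lambda>x. \<Sum>i\<in>I. v i x"] by simp
qed (use right_subspace_scale[of Es v0 0] in simp_all)

definition right_invariant where
  "right_invariant K \<longleftrightarrow> (\<forall>\<sigma>\<in>P. \<forall>x\<in>P. \<forall>y\<in>P. K (x \<circ> \<sigma>) (y \<circ> \<sigma>) = K x y)"

lemma qform_rt: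
  assumes "right_invariant K" "\<sigma> \<in> P"
  shows "qform P K (rt \<sigma> v) (rt \<sigma> w) = qform P K v w"
proof -
  have "qform P K (rt \<sigma> v) (rt \<sigma> w) = (\<Sum>x\<in>P. \<Sum>y\<in>P. K (x \<circ> \<sigma>) (y \<circ> \<sigma>) * v (x \<circ> \<sigma>) * w (y \<circ> \<sigma>))"
    unfolding qform_def rt_def using assms by (intro sum.cong refl) (simp add: right_invariant_def)
  also have "\<dots> = qform P K v w"
    unfolding qform_def using sum_right[OF assms(2), of "\<lambda>y. K _ y * v _ * w y"]
      sum_right[OF assms(2), of "\<lambda>x. \<Sum>y\<in>P. K x y * v x * w y"] by simp
  finally show ?thesis .
qed

text \<open>A right-invariant kernel commutes with right translations, so they preserve the
  eigenspaces of its compression to any right-invariant \<open>perp P A\<close>. Such eigenspaces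
  take the place of isotypic components.\<close>

lemma eigenspace_right_subspace:
  assumes K: "right_invariant K" and A: "\<And>\<sigma> v. \<sigma> \<in> P \<Longrightarrow> v \<in> perp P A \<Longrightarrow> rt \<sigma> v \<in> perp P A"
  shows "right_subspace {v \<in> perp P A. \<forall>w\<in>perp P A. qform P K v w = \<mu> * ip P v w}"
  unfolding right_subspace_def
proof (intro conjI ballI allI)
  fix \<sigma> v assume s: "\<sigma> \<in> P" and v: "v \<in> {v \<in> perp P A. \<forall>w\<in>perp P A. qform P K v w = \<mu> * ip P v w}"
  have "qform P K (rt \<sigma> v) w = \<mu> * ip P (rt \<sigma> v) w" if w: "w \<in> perp P A" for w
  proof -
    have w': "w = rt \<sigma> (rt (inv' \<sigma>) w)" using s by (simp add: rt_rt inv_comp)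
    have "qform P K (rt \<sigma> v) w = qform P K v (rt (inv' \<sigma>) w)"
      by (subst w') (rule qform_rt[OF K s])
    also have "\<dots> = \<mu> * ip P v (rt (inv' \<sigma>) w)" using v A[OF inv_P[OF s] w] by simp
    also have "\<dots> = \<mu> * ip P (rt \<sigma> v) w" using s by (simp add: ip_rt_left)
    finally show ?thesis .
  qed
  then show "rt \<sigma> v \<in> {v \<in> perp P A. \<forall>w\<in>perp P A. qform P K v w = \<mu> * ip P v w}"
    using v A[OF s] by auto
qed (auto simp: perp_add perp_scale qform_add_left qform_scale_left ip_add_left ip_scale_left algebra_simps)

end

section \<open>Almost orthogonal families\<close>

text \<open>Schur's test for the Gram matrix, whose norm is at most its largest absolute row sum.
  With \<open>u\<close> the combination of the \<open>v i\<close> whose coefficients are their inner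
  products with \<open>w\<close>, the left side \<open>S\<close> is \<open>ip X w u\<close>, and
  Cauchy--Schwarz gives \<open>S\<^sup>2 \<le> ip X w w * (B * S)\<close>.\<close>

lemma Bessel_row_sums:
  assumes I: "finite I" and B0: "0 \<le> B" and B: "\<And>i. i \<in> I \<Longrightarrow> (\<Sum>j\<in>I. \<bar>ip X (v i) (v j)\<bar>) \<le> B"
  shows "(\<Sum>i\<in>I. (ip X w (v i))\<^sup>2) \<le> B * ip X w w"
proof -
  let ?s = "\<lambda>i. ip X w (v i)" and ?c = "\<lambda>i j. ip X (v i) (v j)"
  define S where "S = (\<Sum>i\<in>I. (?s i)\<^sup>2)"
  define u where "u = (\<lambda>x. \<Sum>i\<in>I. ?s i * v i x)"
  have S0: "S \<ge> 0" unfolding S_def by (intro sum_nonneg) simp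
  have "ip X w u = (\<Sum>i\<in>I. ?s i * ?s i)" unfolding u_def ip_sum_right ip_scale_right ..
  then have 1: "ip X w u = S" by (simp add: S_def power2_eq_square)
  have "ip X u u = (\<Sum>i\<in>I. \<Sum>j\<in>I. ?s i * (?s j * ?c i j))"
    unfolding u_def ip_sum_right ip_sum_left ip_scale_left ip_scale_right
    by (subst sum.swap) (simp add: algebra_simps)
  also have "\<dots> \<le> (\<Sum>i\<in>I. \<Sum>j\<in>I. (?s i)\<^sup>2 * \<bar>?c i j\<bar> / 2 + (?s j)\<^sup>2 * \<bar>?c j i\<bar> / 2)"
  proof (intro sum_mono)
    fix i j
    have "?s i * (?s j * ?c i j) \<le> \<bar>?s i * ?s j\<bar> * \<bar>?c i j\<bar>" by (metis abs_ge_self abs_mult mult.assoc)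
    also have "\<dots> \<le> ((?s i)\<^sup>2 + (?s j)\<^sup>2) / 2 * \<bar>?c i j\<bar>"
    proof (intro mult_right_mono)
      show "\<bar>?s i * ?s j\<bar> \<le> ((?s i)\<^sup>2 + (?s j)\<^sup>2) / 2"
        using sum_squares_bound[of "\<bar>?s i\<bar>" "\<bar>?s j\<bar>"] by (simp add: abs_mult)
    qed simp
    also have "\<dots> = (?s i)\<^sup>2 * \<bar>?c i j\<bar> / 2 + (?s j)\<^sup>2 * \<bar>?c j i\<bar> / 2"
      using ip_commute[of X "v i" "v j"] by (simp add: algebra_simps add_divide_distrib)
    finally show "?s i * (?s j * ?c i j) \<le> (?s i)\<^sup>2 * \<bar>?c i j\<bar> / 2 + (?s j)\<^sup>2 * \<bar>?c j i\<bar> / 2" .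
  qed
  also have "\<dots> = (\<Sum>i\<in>I. \<Sum>j\<in>I. (?s i)\<^sup>2 * \<bar>?c i j\<bar> / 2) + (\<Sum>i\<in>I. \<Sum>j\<in>I. (?s j)\<^sup>2 * \<bar>?c j i\<bar> / 2)"
    by (simp add: sum.distrib)
  also have "(\<Sum>i\<in>I. \<Sum>j\<in>I. (?s j)\<^sup>2 * \<bar>?c j i\<bar> / 2) = (\<Sum>i\<in>I. \<Sum>j\<in>I. (?s i)\<^sup>2 * \<bar>?c i j\<bar> / 2)"
    by (rule sum.swap)
  also have "(\<Sum>i\<in>I. \<Sum>j\<in>I. (?s i)\<^sup>2 * \<bar>?c i j\<bar> / 2) + (\<Sum>i\<in>I. \<Sum>j\<in>I. (?s i)\<^sup>2 * \<bar>?c i j\<bar> / 2)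
     = (\<Sum>i\<in>I. (?s i)\<^sup>2 * (\<Sum>j\<in>I. \<bar>?c i j\<bar>))"
    by (simp add: sum.distrib[symmetric] sum_distrib_left mult.commute)
  also have "\<dots> \<le> (\<Sum>i\<in>I. (?s i)\<^sup>2 * B)" by (intro sum_mono mult_left_mono B) auto
  also have "\<dots> = B * S" by (simp add: S_def sum_distrib_left algebra_simps)
  finally have 2: "ip X u u \<le> B * S" .
  have "S\<^sup>2 \<le> ip X w w * ip X u u" using ip_Cauchy_Schwarz[of X w u] 1 by simp
  also have "\<dots> \<le> ip X w w * (B * S)" by (intro mult_left_mono 2 ip_nonneg)
  finally have 3: "S * S \<le> (B * ip X w w) * S" by (simp add: power2_eq_square algebra_simps)
  show ?thesis
  proof (cases "S = 0")
    case True
    have "0 \<le> B * ip X w w" using B0 by (simp add: ip_nonneg)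
    then show ?thesis using True by (simp add: S_def)
  next
    case False
    then show ?thesis using 3 S0 by (simp add: S_def)
  qed
qed

section \<open>Translates of a vector invariant under a point stabiliser\<close>

context sym_space
begin

text \<open>For the trivial character these are the functions of the values of the permutation on
  \<open>T\<close>; for the sign, their products with the sign.\<close>

definition semi_inv where
  "semi_inv \<chi> T v \<longleftrightarrow> (\<forall>\<rho>\<in>Stab T. \<forall>x\<in>P. v (x \<circ> \<rho>) = \<chi> \<rho> * v x)"

lemma character_P: assumes "character V \<chi>"
  shows "\<sigma> \<in> P \<Longrightarrow> \<tau> \<in> P \<Longrightarrow> \<chi> (\<sigma> \<circ> \<tau>) = \<chi> \<sigma> * \<chi> \<tau>" "\<sigma> \<in> P \<Longrightarrow> \<chi> \<sigma> * \<chi> \<sigma> = 1"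
  using assms by (auto simp: character_def P_def)

lemma character_id: assumes "character V \<chi>" shows "\<chi> id = 1"
  using character_P(1)[OF assms, of id id] character_P(2)[OF assms, of id] by simp

text \<open>The character is included so that, on \<open>P\<close> and for \<open>v\<close>
  semi-invariant under \<open>Stab T\<close>, the twist depends only on the values of \<sigma> on
  \<open>T\<close>.\<close>

definition twist where "twist \<chi> v \<sigma> = (\<lambda>x. \<chi> \<sigma> * rt \<sigma> v x)"

lemma transpose_P: "a \<in> V \<Longrightarrow> b \<in> V \<Longrightarrow> Transposition.transpose a b \<in> P"
  by (simp add: P_def permutes_swap_id)

lemma transpose_Stab: "a \<in> V - T \<Longrightarrow> b \<in> V - T \<Longrightarrow> Transposition.transpose a b \<in> Stab T"
  by (simp add: Stab_def permutes_swap_id)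

text \<open>The relation \<open>zero\<close> is translated by \<open>\<sigma>\<close>. If \<open>\<sigma> j\<close> is not in \<open>\<sigma>' ` T\<close>, the transposition of \<open>t\<close> and \<open>j\<close>
  does not change the inner product, by invariance of the second vector. The at most \<open>card T\<close> other values of \<open>j\<close>
  bring \<open>\<sigma> ` T\<close> closer to \<open>\<sigma>' ` T\<close>, which gives the induction.\<close>

lemma gram_decay:
  assumes \<chi>: "character V \<chi>" and T: "T \<subseteq> V" and d: "card T = d" "4 * d \<le> m" "d > 0"
    and v: "semi_inv \<chi> T v" "ip P v v = 1"
    and zero: "\<And>t x. t \<in> T \<Longrightarrow> x \<in> P \<Longrightarrow>
        (\<Sum>j\<in>insert t (V - T). \<chi> (Transposition.transpose t j) * v (x \<circ> Transposition.transpose t j)) = 0"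
  shows "\<sigma> \<in> P \<Longrightarrow> \<sigma>' \<in> P \<Longrightarrow> card (\<sigma> ` T - \<sigma>' ` T) = a \<Longrightarrow>
     \<bar>ip P (twist \<chi> v \<sigma>) (twist \<chi> v \<sigma>')\<bar> \<le> (2 * real d / real m) ^ a"
proof (induction a arbitrary: \<sigma>)
  case 0
  have n: "ip P (twist \<chi> v \<sigma>) (twist \<chi> v \<sigma>) = 1" if "\<sigma> \<in> P" for \<sigma>
    unfolding twist_def ip_scale_left ip_scale_right using ip_rt[OF that] v(2) character_P(2)[OF \<chi> that] by simp
  have "(ip P (twist \<chi> v \<sigma>) (twist \<chi> v \<sigma>'))\<^sup>2 \<le> 1"
    using ip_Cauchy_Schwarz[of P "twist \<chi> v \<sigma>" "twist \<chi> v \<sigma>'"] n 0 by simp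
  then show ?case by (simp add: abs_square_le_1)
next
  case (Suc a)
  let ?tr = "Transposition.transpose"
  let ?c = "\<lambda>\<sigma>. ip P (twist \<chi> v \<sigma>) (twist \<chi> v \<sigma>')"
  have finT: "finite T" using T finV finite_subset by auto
  from Suc.prems(3) obtain t where t: "t \<in> T" "\<sigma> t \<notin> \<sigma>' ` T"
    by (metis Diff_eq_empty_iff card.empty image_subsetI nat.distinct(1))
  define J where "J = insert t (V - T)"
  define Gd where "Gd = {j \<in> J. \<sigma> j \<notin> \<sigma>' ` T}"
  define Bd where "Bd = {j \<in> J. \<sigma> j \<in> \<sigma>' ` T}"
  have JV: "J \<subseteq> V" using t T by (auto simp: J_def)
  have finJ: "finite J" using finV by (simp add: J_def)
  have cardJ: "card J = m - d + 1" unfolding J_def using t d finV finT T by (simp add: card_Diff_subset)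
  have rel: "(\<Sum>j\<in>J. ?c (\<sigma> \<circ> ?tr t j)) = 0"
  proof -
    have "(\<Sum>j\<in>J. ?c (\<sigma> \<circ> ?tr t j)) = ip P (\<lambda>x. \<Sum>j\<in>J. twist \<chi> v (\<sigma> \<circ> ?tr t j) x) (twist \<chi> v \<sigma>')"
      by (simp add: ip_sum_left)
    also have "\<dots> = ip P (\<lambda>x. 0) (twist \<chi> v \<sigma>')"
    proof (intro ip_cong refl)
      fix x assume x: "x \<in> P"
      have "(\<Sum>j\<in>J. twist \<chi> v (\<sigma> \<circ> ?tr t j) x) = \<chi> \<sigma> * (\<Sum>j\<in>J. \<chi> (?tr t j) * v ((x \<circ> \<sigma>) \<circ> ?tr t j))"
        unfolding sum_distrib_left twist_def rt_def
      proof (intro sum.cong refl)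
        fix j assume "j \<in> J"
        then have "?tr t j \<in> P" using t T JV by (intro transpose_P) auto
        then show "\<chi> (\<sigma> \<circ> ?tr t j) * v (x \<circ> (\<sigma> \<circ> ?tr t j)) = \<chi> \<sigma> * (\<chi> (?tr t j) * v (x \<circ> \<sigma> \<circ> ?tr t j))"
          using character_P(1)[OF \<chi> Suc.prems(1)] by (simp add: comp_assoc)
      qed
      also have "\<dots> = 0" using zero[OF t(1) comp_P[OF x Suc.prems(1)]] by (simp add: J_def)
      finally show "(\<Sum>j\<in>J. twist \<chi> v (\<sigma> \<circ> ?tr t j) x) = 0" .
    qed
    finally show ?thesis by (simp add: ip_def)
  qed
  have good: "?c (\<sigma> \<circ> ?tr t j) = ?c \<sigma>" if j: "j \<in> Gd" for j
  proof -
    let ?\<tau> = "?tr (\<sigma> t) (\<sigma> j)"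
    have jV: "j \<in> V" "t \<in> V" using j JV t T by (auto simp: Gd_def)
    have \<tau>: "?\<tau> \<in> P" using jV by (intro transpose_P P_apply[OF Suc.prems(1)])
    have e1: "\<sigma> \<circ> ?tr t j = ?\<tau> \<circ> \<sigma>"
      by (rule ext) (simp add: Transposition.transpose_def P_inj[OF Suc.prems(1)])
    define \<rho> where "\<rho> = ?tr (inv' \<sigma>' (\<sigma> t)) (inv' \<sigma>' (\<sigma> j))"
    have e2: "\<sigma>' \<circ> \<rho> = ?\<tau> \<circ> \<sigma>'"
    proof (rule ext)
      fix i
      have "inv' \<sigma>' a = i \<longleftrightarrow> a = \<sigma>' i" for a using P_inv_apply[OF Suc.prems(2)] by metis
      then have "i = inv' \<sigma>' a \<longleftrightarrow> \<sigma>' i = a" for a by metis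
      then show "(\<sigma>' \<circ> \<rho>) i = (?\<tau> \<circ> \<sigma>') i"
        unfolding \<rho>_def by (simp add: Transposition.transpose_def P_inv_apply[OF Suc.prems(2)])
    qed
    have out: "inv' \<sigma>' (\<sigma> i) \<in> V - T" if "i \<in> V" "\<sigma> i \<notin> \<sigma>' ` T" for i
      using that P_apply[OF inv_P[OF Suc.prems(2)]] P_apply[OF Suc.prems(1)] P_inv_apply[OF Suc.prems(2)]
      by (metis Diff_iff image_eqI)
    have \<rho>: "\<rho> \<in> Stab T" unfolding \<rho>_def using out t j jV by (intro transpose_Stab) (auto simp: Gd_def)
    have \<rho>P: "\<rho> \<in> P" using \<rho> Stab_subset by auto
    have e3: "twist \<chi> v (?\<tau> \<circ> \<sigma>') x = twist \<chi> v \<sigma>' x" if x: "x \<in> P" for x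
    proof -
      have "v ((x \<circ> \<sigma>') \<circ> \<rho>) = \<chi> \<rho> * v (x \<circ> \<sigma>')"
        using v(1) \<rho> comp_P[OF x Suc.prems(2)] by (simp add: semi_inv_def)
      moreover have "\<chi> (\<sigma>' \<circ> \<rho>) = \<chi> \<sigma>' * \<chi> \<rho>" "\<chi> \<rho> * \<chi> \<rho> = 1"
        using character_P[OF \<chi>] \<rho>P Suc.prems(2) by auto
      ultimately show ?thesis unfolding e2[symmetric] twist_def rt_def by (simp add: comp_assoc)
    qed
    have "?c \<sigma> = ip P (rt ?\<tau> (twist \<chi> v \<sigma>)) (rt ?\<tau> (twist \<chi> v \<sigma>'))" using ip_rt[OF \<tau>] by simp
    also have "\<dots> = (\<chi> ?\<tau> * \<chi> ?\<tau>) * ip P (rt ?\<tau> (twist \<chi> v \<sigma>)) (rt ?\<tau> (twist \<chi> v \<sigma>'))"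
      using character_P(2)[OF \<chi> \<tau>] by simp
    also have "\<dots> = ip P (\<lambda>x. \<chi> ?\<tau> * rt ?\<tau> (twist \<chi> v \<sigma>) x) (\<lambda>x. \<chi> ?\<tau> * rt ?\<tau> (twist \<chi> v \<sigma>') x)"
      unfolding ip_scale_left ip_scale_right by simp
    also have "\<dots> = ip P (twist \<chi> v (?\<tau> \<circ> \<sigma>)) (twist \<chi> v (?\<tau> \<circ> \<sigma>'))"
      using character_P(1)[OF \<chi> \<tau> Suc.prems(1)] character_P(1)[OF \<chi> \<tau> Suc.prems(2)]
      by (simp add: twist_def rt_def comp_assoc mult.assoc)
    also have "\<dots> = ?c (?\<tau> \<circ> \<sigma>)" by (intro ip_cong refl e3)
    finally show ?thesis using e1 by simp
  qed
  have bad: "\<bar>?c (\<sigma> \<circ> ?tr t j)\<bar> \<le> (2 * real d / real m) ^ a" if j: "j \<in> Bd" for j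
  proof -
    have jV: "j \<in> V" "t \<in> V" "j \<notin> T" using j JV t T by (auto simp: Bd_def J_def)
    have "(\<sigma> \<circ> ?tr t j) ` T = insert (\<sigma> j) (\<sigma> ` T - {\<sigma> t})"
    proof -
      have "?tr t j ` T = insert j (T - {t})"
        using t(1) jV(3) by (auto simp: Transposition.transpose_def image_iff)
      then show ?thesis unfolding image_comp[symmetric] using P_inj[OF Suc.prems(1)] by auto
    qed
    then have "(\<sigma> \<circ> ?tr t j) ` T - \<sigma>' ` T = (\<sigma> ` T - \<sigma>' ` T) - {\<sigma> t}" using j by (auto simp: Bd_def)
    moreover have "\<sigma> t \<in> \<sigma> ` T - \<sigma>' ` T" using t by auto
    ultimately have "card ((\<sigma> \<circ> ?tr t j) ` T - \<sigma>' ` T) = a"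
      using Suc.prems(3) finT by (simp add: card_Diff_singleton)
    then show ?thesis using Suc.IH[OF comp_P[OF Suc.prems(1) transpose_P] Suc.prems(2)] jV by blast
  qed
  have Bdcard: "card Bd \<le> d"
  proof -
    have "\<sigma> ` Bd \<subseteq> \<sigma>' ` T" by (auto simp: Bd_def)
    then have "card (\<sigma> ` Bd) \<le> card (\<sigma>' ` T)" using finT by (intro card_mono) auto
    also have "\<dots> \<le> d" using d card_image_le[OF finT, of \<sigma>'] by simp
    finally show ?thesis using P_inj[OF Suc.prems(1)] by (simp add: card_image inj_on_def)
  qed
  have split: "J = Gd \<union> Bd" "Gd \<inter> Bd = {}" by (auto simp: Gd_def Bd_def)
  have fin: "finite Gd" "finite Bd" using finJ by (auto simp: Gd_def Bd_def)
  have Gdcard: "card Gd \<ge> m - 2 * d"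
    using card_Un_disjoint[OF fin split(2)] split(1) cardJ Bdcard by simp
  have "real (card Gd) * ?c \<sigma> = - (\<Sum>j\<in>Bd. ?c (\<sigma> \<circ> ?tr t j))"
    using rel good unfolding split(1) sum.union_disjoint[OF fin split(2)] by simp
  then have "real (card Gd) * \<bar>?c \<sigma>\<bar> = \<bar>\<Sum>j\<in>Bd. ?c (\<sigma> \<circ> ?tr t j)\<bar>"
    by (metis abs_minus_cancel abs_mult abs_of_nat)
  also have "\<dots> \<le> (\<Sum>j\<in>Bd. \<bar>?c (\<sigma> \<circ> ?tr t j)\<bar>)" by (rule sum_abs)
  also have "\<dots> \<le> real (card Bd) * (2 * real d / real m) ^ a" using bad by (rule sum_bounded_above)
  also have "\<dots> \<le> real d * (2 * real d / real m) ^ a" using Bdcard by (intro mult_right_mono) auto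
  finally have 1: "real (card Gd) * \<bar>?c \<sigma>\<bar> \<le> real d * (2 * real d / real m) ^ a" .
  \<comment> \<open>As \<open>4 * d \<le> m\<close>, at least half of all points are good values of
    \<open>j\<close>. Each good \<open>j\<close> reproduces the inner product itself and at most
    \<open>d\<close> bad ones are smaller by induction, so one step gains
    \<open>2 * d / m\<close>.\<close>
  have "real m / 2 * \<bar>?c \<sigma>\<bar> \<le> real (card Gd) * \<bar>?c \<sigma>\<bar>"
    using Gdcard d by (intro mult_right_mono) linarith+
  with 1 have "real m / 2 * \<bar>?c \<sigma>\<bar> \<le> real d * (2 * real d / real m) ^ a" by linarith
  moreover have "real m > 0" using d by linarith
  ultimately show ?case by (simp add: field_simps)
qed

text \<open>The stabiliser of \<open>T - {t}\<close> is the disjoint union of the cosets of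
  \<open>Stab T\<close> represented by the transpositions of \<open>t\<close> with \<open>j\<close>,
  where \<open>j\<close> is \<open>t\<close> or outside \<open>T\<close>. On each coset the summand
  is constant by semi-invariance.\<close>

lemma semi_inv_sum_zero:
  assumes \<chi>: "character V \<chi>" and T: "T \<subseteq> V" "t \<in> T" and v: "semi_inv \<chi> T v" and x: "x \<in> P"
    and z: "(\<Sum>\<rho>\<in>Stab (T - {t}). \<chi> \<rho> * v (x \<circ> \<rho>)) = 0"
  shows "(\<Sum>j\<in>insert t (V - T). \<chi> (Transposition.transpose t j) * v (x \<circ> Transposition.transpose t j)) = 0"
proof -
  let ?tr = "Transposition.transpose" and ?J = "insert t (V - T)"
  have trP: "?tr t j \<in> P" if "j \<in> ?J" for j using that T by (intro transpose_P) auto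
  have b: "bij_betw (\<lambda>(j, \<rho>). ?tr t j \<circ> \<rho>) (?J \<times> Stab T) (Stab (T - {t}))"
  proof (rule bij_betw_byWitness[where f' = "\<lambda>\<rho>. (\<rho> t, ?tr t (\<rho> t) \<circ> \<rho>)"])
    show "(\<lambda>(j, \<rho>). ?tr t j \<circ> \<rho>) ` (?J \<times> Stab T) \<subseteq> Stab (T - {t})"
    proof (rule image_subsetI)
      fix p assume "p \<in> ?J \<times> Stab T"
      then obtain j \<rho> where p: "p = (j, \<rho>)" and j: "j \<in> ?J" and \<rho>: "\<rho> \<in> Stab T" by auto
      then have "?tr t j \<circ> \<rho> \<in> P" using trP Stab_subset by (intro comp_P) auto
      moreover have "(?tr t j \<circ> \<rho>) s = s" if "s \<in> T - {t}" for s
        using that j Stab_fix[OF \<rho>, of s] by (auto simp: Transposition.transpose_def)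
      ultimately show "(\<lambda>(j, \<rho>). ?tr t j \<circ> \<rho>) p \<in> Stab (T - {t})" by (simp add: Stab_iff p)
    qed
    show "(\<lambda>\<rho>. (\<rho> t, ?tr t (\<rho> t) \<circ> \<rho>)) ` Stab (T - {t}) \<subseteq> ?J \<times> Stab T"
    proof (rule image_subsetI)
      fix \<rho> assume \<rho>: "\<rho> \<in> Stab (T - {t})"
      then have \<rho>P: "\<rho> \<in> P" using Stab_subset by auto
      have fx: "\<rho> s = s" if "s \<in> T - {t}" for s using Stab_fix[OF \<rho> that] .
      have J: "\<rho> t \<in> ?J"
      proof (cases "\<rho> t \<in> T - {t}")
        case True
        then have "\<rho> (\<rho> t) = \<rho> t" by (rule fx)
        then have "\<rho> t = t" using P_inj[OF \<rho>P] by blast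
        then show ?thesis by simp
      qed (use P_apply[OF \<rho>P, of t] T in auto)
      have "?tr t (\<rho> t) \<circ> \<rho> \<in> P" using trP[OF J] \<rho>P by (rule comp_P)
      moreover have "(?tr t (\<rho> t) \<circ> \<rho>) s = s" if "s \<in> T" for s
      proof (cases "s = t")
        case False
        then have "\<rho> s = s" "\<rho> s \<noteq> \<rho> t" using fx[of s] that P_inj[OF \<rho>P] by auto
        then show ?thesis using False by (auto simp: Transposition.transpose_def)
      qed simp
      ultimately show "(\<rho> t, ?tr t (\<rho> t) \<circ> \<rho>) \<in> ?J \<times> Stab T" using J by (simp add: Stab_iff)
    qed
    show "\<forall>a\<in>?J \<times> Stab T. (\<lambda>\<rho>. (\<rho> t, ?tr t (\<rho> t) \<circ> \<rho>)) ((\<lambda>(j, \<rho>). ?tr t j \<circ> \<rho>) a) = a"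
    proof (rule ballI)
      fix p assume "p \<in> ?J \<times> Stab T"
      then obtain j \<rho> where p: "p = (j, \<rho>)" and \<rho>: "\<rho> \<in> Stab T" by auto
      have "\<rho> t = t" using T \<rho> by (intro Stab_fix)
      then show "(\<lambda>\<rho>. (\<rho> t, ?tr t (\<rho> t) \<circ> \<rho>)) ((\<lambda>(j, \<rho>). ?tr t j \<circ> \<rho>) p) = p"
        by (simp add: p fun_eq_iff)
    qed
    show "\<forall>\<rho>\<in>Stab (T - {t}). (\<lambda>(j, \<rho>). ?tr t j \<circ> \<rho>) (\<rho> t, ?tr t (\<rho> t) \<circ> \<rho>) = \<rho>"
      by (simp add: fun_eq_iff)
  qed
  have "0 = (\<Sum>\<rho>\<in>Stab (T - {t}). \<chi> \<rho> * v (x \<circ> \<rho>))" using z by simp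
  also have "\<dots> = (\<Sum>(j,\<rho>)\<in>?J \<times> Stab T. \<chi> (?tr t j \<circ> \<rho>) * v (x \<circ> (?tr t j \<circ> \<rho>)))"
    using sum.reindex_bij_betw[OF b, of "\<lambda>\<rho>. \<chi> \<rho> * v (x \<circ> \<rho>)"] by (simp add: case_prod_unfold)
  also have "\<dots> = (\<Sum>j\<in>?J. \<Sum>\<rho>\<in>Stab T. \<chi> (?tr t j) * v (x \<circ> ?tr t j))"
    unfolding sum.cartesian_product[symmetric]
  proof (intro sum.cong refl)
    fix j \<rho> assume j: "j \<in> ?J" and \<rho>: "\<rho> \<in> Stab T"
    have \<rho>P: "\<rho> \<in> P" using \<rho> Stab_subset by auto
    have "v ((x \<circ> ?tr t j) \<circ> \<rho>) = \<chi> \<rho> * v (x \<circ> ?tr t j)"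
      using v \<rho> comp_P[OF x trP[OF j]] by (simp add: semi_inv_def)
    then show "\<chi> (?tr t j \<circ> \<rho>) * v (x \<circ> (?tr t j \<circ> \<rho>)) = \<chi> (?tr t j) * v (x \<circ> ?tr t j)"
      using character_P[OF \<chi>] trP[OF j] \<rho>P by (simp add: comp_assoc)
  qed
  also have "\<dots> = real (card (Stab T)) * (\<Sum>j\<in>?J. \<chi> (?tr t j) * v (x \<circ> ?tr t j))"
    by (simp add: sum_distrib_left)
  finally show ?thesis using cardStab[OF T(1)] by simp
qed

lemma semi_inv_average:
  assumes \<chi>: "character V \<chi>"
  shows "semi_inv \<chi> T (\<lambda>x. \<Sum>\<rho>\<in>Stab T. \<chi> \<rho> * v (x \<circ> \<rho>))"
  unfolding semi_inv_def
proof (intro ballI)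
  fix \<sigma> x assume s: "\<sigma> \<in> Stab T" and x: "x \<in> P"
  have sP: "\<sigma> \<in> P" using s Stab_subset by auto
  have "(\<Sum>\<rho>\<in>Stab T. \<chi> \<rho> * v (x \<circ> \<sigma> \<circ> \<rho>)) = (\<Sum>\<rho>\<in>Stab T. \<chi> \<sigma> * (\<chi> (\<sigma> \<circ> \<rho>) * v (x \<circ> (\<sigma> \<circ> \<rho>))))"
  proof (intro sum.cong refl)
    fix \<rho> assume "\<rho> \<in> Stab T"
    then have "\<rho> \<in> P" using Stab_subset by auto
    then have "\<chi> (\<sigma> \<circ> \<rho>) = \<chi> \<sigma> * \<chi> \<rho>" "\<chi> \<sigma> * \<chi> \<sigma> = 1" using character_P[OF \<chi>] sP by auto
    then show "\<chi> \<rho> * v (x \<circ> \<sigma> \<circ> \<rho>) = \<chi> \<sigma> * (\<chi> (\<sigma> \<circ> \<rho>) * v (x \<circ> (\<sigma> \<circ> \<rho>)))"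
      by (simp add: comp_assoc mult.assoc[symmetric])
  qed
  also have "\<dots> = \<chi> \<sigma> * (\<Sum>\<rho>\<in>Stab T. \<chi> \<rho> * v (x \<circ> \<rho>))"
    unfolding sum_distrib_left[symmetric] using sum_left_Stab[OF s, of "\<lambda>\<rho>. \<chi> \<rho> * v (x \<circ> \<rho>)"] by simp
  finally show "(\<Sum>\<rho>\<in>Stab T. \<chi> \<rho> * v (x \<circ> \<sigma> \<circ> \<rho>)) = \<chi> \<sigma> * (\<Sum>\<rho>\<in>Stab T. \<chi> \<rho> * v (x \<circ> \<rho>))" .
qed

text \<open>Each \<open>t\<close> in \<open>T\<close> gets its own pool of \<open>b\<close> points,
  the pools being disjoint, and an index is a choice \<open>J\<close> of one point from every pool.
  The images of \<open>T\<close> under \<open>s J\<close> and \<open>s J'\<close> then differ at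
  least where the choices do, so by \<open>gram_decay\<close> a row sum of the Gram matrix is
  bounded by a product over \<open>T\<close>. Each factor is at most \<open>1 + b * q\<close> with
  \<open>b * q \<le> 2\<close>, whence \<open>3 ^ d\<close>.\<close>

lemma gram_spread:
  assumes \<chi>: "character V \<chi>" and T: "T \<subseteq> V" and d: "card T = d" "4 * d \<le> m" "d > 0"
    and v: "semi_inv \<chi> T v" "ip P v v = 1"
    and zero: "\<And>t x. t \<in> T \<Longrightarrow> x \<in> P \<Longrightarrow>
        (\<Sum>j\<in>insert t (V - T). \<chi> (Transposition.transpose t j) * v (x \<circ> Transposition.transpose t j)) = 0"
  shows "\<exists>(I :: ('a \<Rightarrow> nat) set) s. finite I \<and> card I = (m div d) ^ d \<and> (\<forall>i\<in>I. s i \<in> P) \<and>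
     (\<forall>w. (\<Sum>i\<in>I. (ip P w (twist \<chi> v (s i)))\<^sup>2) \<le> 3 ^ d * ip P w w)"
proof -
  define b where "b = m div d"
  define q where "q = 2 * real d / real m"
  have finT: "finite T" using T finV finite_subset by auto
  have m0: "real m > 0" using d by linarith
  have q: "0 \<le> q" "q \<le> 1" using d m0 by (auto simp: q_def divide_simps)
  have "card (T \<times> {..<b}) \<le> card V" using d by (simp add: card_cartesian_product b_def mult.commute)
  then obtain g where g: "inj_on g (T \<times> {..<b})" "g ` (T \<times> {..<b}) \<subseteq> V"
    using card_le_inj[OF _ finV] finT by (metis finite_SigmaI finite_lessThan)
  define I where "I = PiE T (\<lambda>_. {..<b})"
  have finI: "finite I" unfolding I_def using finT by (intro finite_PiE) auto
  have cardI: "card I = b ^ d" unfolding I_def using finT d by (simp add: card_PiE)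
  have "\<exists>\<sigma>\<in>P. \<forall>t\<in>T. \<sigma> t = g (t, J t)" if J: "J \<in> I" for J
  proof (rule extend_injection[OF T])
    have Jt: "(t, J t) \<in> T \<times> {..<b}" if "t \<in> T" for t using J that by (auto simp: I_def)
    show "inj_on (\<lambda>t. g (t, J t)) T"
    proof (rule inj_onI)
      fix t t' assume "t \<in> T" "t' \<in> T" "g (t, J t) = g (t', J t')"
      then show "t = t'" using inj_onD[OF g(1), of "(t, J t)" "(t', J t')"] Jt by blast
    qed
    show "(\<lambda>t. g (t, J t)) ` T \<subseteq> V" using g(2) Jt by blast
  qed
  then obtain s where s: "\<And>J. J \<in> I \<Longrightarrow> s J \<in> P" "\<And>J t. J \<in> I \<Longrightarrow> t \<in> T \<Longrightarrow> s J t = g (t, J t)"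
    by metis
  have row: "(\<Sum>J'\<in>I. \<bar>ip P (twist \<chi> v (s J)) (twist \<chi> v (s J'))\<bar>) \<le> 3 ^ d" if J: "J \<in> I" for J
  proof -
    have "(\<Sum>J'\<in>I. \<bar>ip P (twist \<chi> v (s J)) (twist \<chi> v (s J'))\<bar>)
        \<le> (\<Sum>J'\<in>I. \<Prod>t\<in>T. if J' t = J t then 1 else q)"
    proof (rule sum_mono)
      fix J' assume J': "J' \<in> I"
      let ?D = "{t\<in>T. J' t \<noteq> J t}"
      have "\<bar>ip P (twist \<chi> v (s J)) (twist \<chi> v (s J'))\<bar> \<le> q ^ card (s J ` T - s J' ` T)"
        unfolding q_def using gram_decay[OF \<chi> T d v zero s(1)[OF J] s(1)[OF J']] by blast
      also have "\<dots> \<le> q ^ card ?D"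
      proof (rule power_decreasing[OF _ q])
        have "s J ` ?D \<subseteq> s J ` T - s J' ` T"
        proof
          fix z assume "z \<in> s J ` ?D"
          then obtain t where t: "t \<in> T" "J' t \<noteq> J t" "z = s J t" by auto
          have "s J t \<noteq> s J' t'" if t': "t' \<in> T" for t'
          proof
            assume "s J t = s J' t'"
            then have "g (t, J t) = g (t', J' t')" using s(2) J J' t t' by simp
            then have "(t, J t) = (t', J' t')"
              using J J' t t' by (intro inj_onD[OF g(1)]) (auto simp: I_def)
            then show False using t by auto
          qed
          then show "z \<in> s J ` T - s J' ` T" using t by auto
        qed
        then have "card (s J ` ?D) \<le> card (s J ` T - s J' ` T)" using finT by (intro card_mono) auto
        then show "card ?D \<le> card (s J ` T - s J' ` T)"
          using P_inj[OF s(1)[OF J]] by (simp add: card_image inj_on_def)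
      qed
      also have "q ^ card ?D = (\<Prod>t\<in>T. if J' t = J t then 1 else q)"
        using finT by (simp add: prod.If_cases Int_def)
      finally show "\<bar>ip P (twist \<chi> v (s J)) (twist \<chi> v (s J'))\<bar> \<le> (\<Prod>t\<in>T. if J' t = J t then 1 else q)" .
    qed
    also have "\<dots> = (\<Prod>t\<in>T. \<Sum>j\<in>{..<b}. if j = J t then 1 else q)"
      unfolding I_def using finT by (intro prod_sum_PiE[symmetric]) auto
    also have "\<dots> \<le> (\<Prod>t\<in>T. 3)"
    proof (rule prod_mono, intro conjI)
      fix t assume t: "t \<in> T"
      show "0 \<le> (\<Sum>j\<in>{..<b}. if j = J t then 1 else q)" using q by (intro sum_nonneg) auto
      have "(\<Sum>j\<in>{..<b}. if j = J t then 1 else q) \<le> (\<Sum>j\<in>{..<b}. (if j = J t then 1 else 0) + q)"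
        using q by (intro sum_mono) auto
      also have "\<dots> \<le> 1 + real b * q" by (simp add: sum.distrib)
      also have "real b * q \<le> 2"
      proof -
        have "real b * real d \<le> real m" unfolding b_def of_nat_mult[symmetric] of_nat_le_iff
          by (rule div_times_less_eq_dividend)
        then show ?thesis using m0 by (simp add: q_def divide_simps)
      qed
      finally show "(\<Sum>j\<in>{..<b}. if j = J t then 1 else q) \<le> 3" by simp
    qed
    also have "\<dots> = 3 ^ d" using d by simp
    finally show ?thesis .
  qed
  have "(\<Sum>i\<in>I. (ip P w (twist \<chi> v (s i)))\<^sup>2) \<le> 3 ^ d * ip P w w" for w
    by (rule Bessel_row_sums[OF finI _ row]) auto
  then show ?thesis using finI cardI s(1) unfolding b_def by blast
qed

end

section \<open>Blocks of three points and their sign patterns\<close>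

lemma disjoint_permutes_commute:
  assumes f: "f permutes A" and g: "g permutes B" and disj: "A \<inter> B = {}"
  shows "f \<circ> g = g \<circ> f"
proof
  fix x
  have "f y = y" if "y \<notin> A" for y using f that by (simp add: permutes_not_in)
  moreover have "g y = y" if "y \<notin> B" for y using g that by (simp add: permutes_not_in)
  moreover have "f y \<in> A \<longleftrightarrow> y \<in> A" "g y \<in> B \<longleftrightarrow> y \<in> B" for y
    using f g by (simp_all add: permutes_in_image)
  ultimately show "(f \<circ> g) x = (g \<circ> f) x" using disj by (metis comp_apply disjoint_iff)
qed

fun cyc3 :: "'a \<times> 'a \<times> 'a \<Rightarrow> 'a \<Rightarrow> 'a" where
  "cyc3 (p, q, s) = Transposition.transpose p q \<circ> Transposition.transpose q s"
fun swp3 :: "'a \<times> 'a \<times> 'a \<Rightarrow> 'a \<Rightarrow> 'a" where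
  "swp3 (p, q, s) = Transposition.transpose p q"
fun supp3 :: "'a \<times> 'a \<times> 'a \<Rightarrow> 'a set" where
  "supp3 (p, q, s) = {p, q, s}"

lemma cyc3_permutes: "cyc3 b permutes supp3 b"
  by (cases b) (auto intro!: permutes_compose permutes_swap_id)
lemma swp3_permutes: "swp3 b permutes supp3 b"
  by (cases b) (auto intro!: permutes_swap_id)

text \<open>The relations of the symmetric group on three points; the third is the second for the
  inverse three-cycle.\<close>

lemma cyc3_relations:
  assumes "card (supp3 b) = 3"
  shows "cyc3 b \<circ> cyc3 b \<circ> cyc3 b = id" "swp3 b \<circ> cyc3 b = cyc3 b \<circ> cyc3 b \<circ> swp3 b"
    "swp3 b \<circ> cyc3 b \<circ> cyc3 b = cyc3 b \<circ> swp3 b" "swp3 b \<circ> swp3 b = id"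
proof -
  obtain p q s where b: "b = (p, q, s)" by (cases b)
  have d: "p \<noteq> q" "q \<noteq> s" "p \<noteq> s" using assms unfolding b by (auto simp: card_insert_if split: if_splits)
  show "cyc3 b \<circ> cyc3 b \<circ> cyc3 b = id" "swp3 b \<circ> cyc3 b = cyc3 b \<circ> cyc3 b \<circ> swp3 b"
    "swp3 b \<circ> cyc3 b \<circ> cyc3 b = cyc3 b \<circ> swp3 b" "swp3 b \<circ> swp3 b = id"
    unfolding b using d by (auto simp: fun_eq_iff Transposition.transpose_def)
qed

context sym_space
begin

definition good_blocks where
  "good_blocks B \<longleftrightarrow> (\<forall>b\<in>B. card (supp3 b) = 3 \<and> supp3 b \<subseteq> V) \<and> (\<forall>b\<in>B. \<forall>b'\<in>B. b \<noteq> b' \<longrightarrow> supp3 b \<inter> supp3 b' = {})"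

lemma good_blocksD:
  assumes "good_blocks B" "b \<in> B"
  shows "card (supp3 b) = 3" "supp3 b \<subseteq> V" "b' \<in> B \<Longrightarrow> b \<noteq> b' \<Longrightarrow> supp3 b \<inter> supp3 b' = {}"
  using assms unfolding good_blocks_def by blast+

text \<open>A block is a triple of points. On this space each block has no vector fixed by its three-cycle, so
  the transposition of the block can be given either sign; different sign patterns are orthogonal.\<close>

definition block_space where
  "block_space Es B = {v\<in>Es. \<forall>b\<in>B. \<forall>x\<in>P. v x + v (x \<circ> cyc3 b) + v (x \<circ> cyc3 b \<circ> cyc3 b) = 0}"

lemma block_P: "supp3 b \<subseteq> V \<Longrightarrow> cyc3 b \<in> P" "supp3 b \<subseteq> V \<Longrightarrow> swp3 b \<in> P"
  unfolding P_def by (simp_all add: permutes_subset[OF cyc3_permutes] permutes_subset[OF swp3_permutes])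

lemma good_blocks_subset: "good_blocks B \<Longrightarrow> B \<subseteq> V \<times> V \<times> V"
  by (fastforce simp: good_blocks_def)

lemma block_space_rt_disjoint:
  assumes Es: "right_subspace Es" and v: "v \<in> block_space Es B" and g: "g permutes W" "W \<subseteq> V"
    and disj: "\<And>b. b \<in> B \<Longrightarrow> supp3 b \<inter> W = {}"
  shows "rt g v \<in> block_space Es B"
proof -
  have gP: "g \<in> P" unfolding P_def using permutes_subset[OF g] by simp
  have "rt g v x + rt g v (x \<circ> cyc3 b) + rt g v (x \<circ> cyc3 b \<circ> cyc3 b) = 0" if b: "b \<in> B" and x: "x \<in> P" for b x
  proof -
    have c: "cyc3 b \<circ> g = g \<circ> cyc3 b" by (rule disjoint_permutes_commute[OF cyc3_permutes g(1) disj[OF b]])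
    have "x \<circ> cyc3 b \<circ> g = (x \<circ> g) \<circ> cyc3 b" by (simp add: comp_assoc c)
    moreover have "x \<circ> cyc3 b \<circ> cyc3 b \<circ> g = (x \<circ> g) \<circ> cyc3 b \<circ> cyc3 b"
      by (metis c comp_assoc)
    ultimately show ?thesis using v b comp_P[OF x gP] by (simp add: block_space_def rt_def)
  qed
  then show ?thesis using v right_subspace_rt[OF Es _ gP] by (simp add: block_space_def)
qed

lemma block_space_closed:
  assumes "right_subspace Es" "v \<in> block_space Es B" "w \<in> block_space Es B"
  shows "(\<lambda>x. v x + w x) \<in> block_space Es B" "(\<lambda>x. v x - w x) \<in> block_space Es B" "(\<lambda>x. c * v x) \<in> block_space Es B"
proof -
  have z: "v x + v (x \<circ> cyc3 b) + v (x \<circ> cyc3 b \<circ> cyc3 b) = 0" "w x + w (x \<circ> cyc3 b) + w (x \<circ> cyc3 b \<circ> cyc3 b) = 0"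
    if "b \<in> B" "x \<in> P" for b x using assms(2,3) that unfolding block_space_def by blast+
  have Ev: "v \<in> Es" "w \<in> Es" using assms(2,3) by (simp_all add: block_space_def)
  have "(v x + w x) + (v (x \<circ> cyc3 b) + w (x \<circ> cyc3 b)) + (v (x \<circ> cyc3 b \<circ> cyc3 b) + w (x \<circ> cyc3 b \<circ> cyc3 b)) = 0"
    if "b \<in> B" "x \<in> P" for b x using z[OF that] by linarith
  then show "(\<lambda>x. v x + w x) \<in> block_space Es B"
    using right_subspace_add[OF assms(1) Ev] unfolding block_space_def by blast
  have "(v x - w x) + (v (x \<circ> cyc3 b) - w (x \<circ> cyc3 b)) + (v (x \<circ> cyc3 b \<circ> cyc3 b) - w (x \<circ> cyc3 b \<circ> cyc3 b)) = 0"
    if "b \<in> B" "x \<in> P" for b x using z[OF that] by linarith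
  then show "(\<lambda>x. v x - w x) \<in> block_space Es B"
    using right_subspace_diff[OF assms(1) Ev] unfolding block_space_def by blast
  have "c * v x + c * v (x \<circ> cyc3 b) + c * v (x \<circ> cyc3 b \<circ> cyc3 b) = 0" if "b \<in> B" "x \<in> P" for b x
    using z(1)[OF that] unfolding distrib_left[symmetric] by simp
  then show "(\<lambda>x. c * v x) \<in> block_space Es B"
    using right_subspace_scale[OF assms(1) Ev(1)] unfolding block_space_def by blast
qed

lemma cyc3_cancel: "cyc3 b \<circ> cyc3 b \<circ> cyc3 b = id \<Longrightarrow> x \<circ> cyc3 b \<circ> cyc3 b \<circ> cyc3 b = x"
  by (metis comp_assoc comp_id)

text \<open>The transposition conjugates the three-cycle to its inverse, so the three-term sum is
  merely reordered and evaluated at a translated point.\<close>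

lemma block_space_rt_block:
  assumes Es: "right_subspace Es" and B: "good_blocks B" and b: "b \<in> B" and v: "v \<in> block_space Es B"
  shows "rt (cyc3 b) v \<in> block_space Es B" "rt (swp3 b) v \<in> block_space Es B"
proof -
  note card = good_blocksD(1)[OF B b] and sub = good_blocksD(2)[OF B b]
  note rel = cyc3_relations[OF card]
  have inP: "cyc3 b \<in> P" "swp3 b \<in> P" using block_P[OF sub] .
  have v': "v \<in> block_space Es (B - {b})" using v by (auto simp: block_space_def)
  have disj: "supp3 b' \<inter> supp3 b = {}" if "b' \<in> B - {b}" for b' using B b that by (auto simp: good_blocks_def)
  have 1: "rt (cyc3 b) v \<in> block_space Es (B - {b})" "rt (swp3 b) v \<in> block_space Es (B - {b})"
    by (rule block_space_rt_disjoint[OF Es v' cyc3_permutes sub disj], assumption)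
       (rule block_space_rt_disjoint[OF Es v' swp3_permutes sub disj], assumption)
  have z: "v y + v (y \<circ> cyc3 b) + v (y \<circ> cyc3 b \<circ> cyc3 b) = 0" if "y \<in> P" for y
    using v b that by (auto simp: block_space_def)
  have "rt (cyc3 b) v x + rt (cyc3 b) v (x \<circ> cyc3 b) + rt (cyc3 b) v (x \<circ> cyc3 b \<circ> cyc3 b) = 0" if x: "x \<in> P" for x
    using z[OF comp_P[OF x inP(1)]] by (simp add: rt_def)
  then show "rt (cyc3 b) v \<in> block_space Es B" using 1(1) by (auto simp: block_space_def)
  have "rt (swp3 b) v x + rt (swp3 b) v (x \<circ> cyc3 b) + rt (swp3 b) v (x \<circ> cyc3 b \<circ> cyc3 b) = 0" if x: "x \<in> P" for x
  proof -
    have "x \<circ> cyc3 b \<circ> swp3 b = (x \<circ> swp3 b) \<circ> cyc3 b \<circ> cyc3 b" by (metis rel(3) comp_assoc)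
    moreover have "x \<circ> cyc3 b \<circ> cyc3 b \<circ> swp3 b = (x \<circ> swp3 b) \<circ> cyc3 b" by (metis rel(2) comp_assoc)
    ultimately show ?thesis using z[OF comp_P[OF x inP(2)]] by (simp add: rt_def)
  qed
  then show "rt (swp3 b) v \<in> block_space Es B" using 1(2) by (auto simp: block_space_def)
qed

lemma ip_pos_P: "ip P v v > 0 \<longleftrightarrow> (\<exists>x\<in>P. v x \<noteq> 0)"
  using ip_self_eq_0[OF finP, of v] ip_nonneg[of P v] by (metis less_eq_real_def less_irrefl)

lemma nonzero_sum_or_diff:
  assumes "ip P v v > 0"
  shows "ip P (\<lambda>x. v x + w x) (\<lambda>x. v x + w x) > 0 \<or> ip P (\<lambda>x. v x - w x) (\<lambda>x. v x - w x) > 0"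
proof -
  obtain x where "x \<in> P" "v x \<noteq> 0" using assms ip_pos_P by auto
  then have "v x + w x \<noteq> 0 \<or> v x - w x \<noteq> 0" by linarith
  then show ?thesis unfolding ip_pos_P using \<open>x \<in> P\<close> by blast
qed

lemma swp_commute:
  assumes "good_blocks B" "b \<in> B" "b' \<in> B" "b \<noteq> b'"
  shows "swp3 b \<circ> swp3 b' = swp3 b' \<circ> swp3 b" "swp3 b \<circ> cyc3 b' = cyc3 b' \<circ> swp3 b"
  by (rule disjoint_permutes_commute[OF swp3_permutes swp3_permutes good_blocksD(3)[OF assms(1,2) assms(3,4)]])
     (rule disjoint_permutes_commute[OF swp3_permutes cyc3_permutes good_blocksD(3)[OF assms(1,2) assms(3,4)]])

text \<open>The transpositions of different blocks are commuting involutions that preserve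
  \<open>block_space\<close>. Of \<open>w\<close> plus and minus its translate at least one is
  nonzero, and it keeps the eigenvalues found before.\<close>

lemma joint_eigenvector:
  assumes Es: "right_subspace Es" and B: "good_blocks B" and v: "v \<in> block_space Es B" "ip P v v > 0"
    and C: "finite C" "C \<subseteq> B"
  shows "\<exists>w e. w \<in> block_space Es B \<and> ip P w w > 0 \<and> (\<forall>b\<in>C. e b * e b = (1::real) \<and> (\<forall>x\<in>P. w (x \<circ> swp3 b) = e b * w x))"
  using C
proof (induction C rule: finite_induct)
  case empty
  then show ?case using v by auto
next
  case (insert b C)
  have "C \<subseteq> B" using insert.prems by simp
  from insert.IH[OF this] obtain w e where w: "w \<in> block_space Es B" "ip P w w > 0"
     and H: "\<forall>b\<in>C. e b * e b = (1::real) \<and> (\<forall>x\<in>P. w (x \<circ> swp3 b) = e b * w x)"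
    by (elim exE conjE)
  have e: "e b' * e b' = 1" "\<And>x. x \<in> P \<Longrightarrow> w (x \<circ> swp3 b') = e b' * w x" if "b' \<in> C" for b'
    using bspec[OF H that] by blast+
  have b: "b \<in> B" and CB: "C \<subseteq> B" using insert.prems by auto
  note card = good_blocksD(1)[OF B b] and sub = good_blocksD(2)[OF B b]
  have aP: "swp3 b \<in> P" by (rule block_P(2)[OF sub])
  have aa: "x \<circ> swp3 b \<circ> swp3 b = x" for x using cyc3_relations(4)[OF card] by (metis comp_assoc comp_id)
  let ?a = "rt (swp3 b) w"
  have a: "?a \<in> block_space Es B" by (rule block_space_rt_block(2)[OF Es B b w(1)])
  have ae: "?a (x \<circ> swp3 b') = e b' * ?a x" if "b' \<in> C" "x \<in> P" for b' x
  proof -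
    have "b' \<noteq> b" "b' \<in> B" using insert.hyps that CB by auto
    then have "x \<circ> swp3 b' \<circ> swp3 b = x \<circ> swp3 b \<circ> swp3 b'"
      using swp_commute(1)[OF B b, of b'] by (metis comp_assoc)
    then show ?thesis using e(2)[OF that(1) comp_P[OF that(2) aP]] by (simp add: rt_def)
  qed
  have *: ?case if c: "c = 1 \<or> c = - 1" and pos: "ip P (\<lambda>x. w x + c * ?a x) (\<lambda>x. w x + c * ?a x) > 0" for c
  proof -
    let ?w = "\<lambda>x. w x + c * ?a x"
    have 1: "?w \<in> block_space Es B"
      by (intro block_space_closed(1)[OF Es w(1)] block_space_closed(3)[OF Es a a])
    have 2: "?w (x \<circ> swp3 b') = (e(b := c)) b' * ?w x \<and> (e(b := c)) b' * (e(b := c)) b' = 1"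
      if "b' \<in> insert b C" "x \<in> P" for b' x
    proof (cases "b' = b")
      case True
      then show ?thesis using c aa[of x] by (auto simp: rt_def)
    next
      case False
      then have "b' \<in> C" using that by simp
      then show ?thesis using False e(2)[of b' x] ae[of b' x] e(1)[of b'] that(2) by (simp add: algebra_simps)
    qed
    show ?thesis using 1 2 pos id_P by (intro exI[of _ ?w] exI[of _ "e(b := c)"]) blast
  qed
  show ?case using nonzero_sum_or_diff[OF w(2), of ?a] *[of 1] *[of "-1"] by auto
qed

text \<open>The difference of the translates by the three-cycle and by its inverse anticommutes with
  the block's transposition, so it reverses the sign at \<open>b\<close> and leaves the other signs
  alone. It does not kill \<open>w\<close>: applied twice it gives \<open>- 3 * w\<close>, because
  the three translates of \<open>w\<close> sum to zero.\<close>

lemma flipped_eigenvector: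
  assumes Es: "right_subspace Es" and B: "good_blocks B" and v: "v \<in> block_space Es B" "ip P v v > 0"
    and e: "\<And>b x. b \<in> B \<Longrightarrow> x \<in> P \<Longrightarrow> v (x \<circ> swp3 b) = e b * v x"
    and \<eta>: "finite \<eta>" "\<eta> \<subseteq> B"
  shows "\<exists>w. w \<in> block_space Es B \<and> ip P w w > 0 \<and>
     (\<forall>b\<in>B. \<forall>x\<in>P. w (x \<circ> swp3 b) = (if b \<in> \<eta> then - e b else e b) * w x)"
  using \<eta>
proof (induction \<eta> rule: finite_induct)
  case empty
  show ?case using v by (intro exI[of _ v] conjI ballI) (simp_all only: e empty_iff if_False)
next
  case (insert b \<eta>)
  have "\<eta> \<subseteq> B" using insert.prems by simp
  from insert.IH[OF this] obtain w where w: "w \<in> block_space Es B" "ip P w w > 0"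
     and H: "\<forall>b\<in>B. \<forall>x\<in>P. w (x \<circ> swp3 b) = (if b \<in> \<eta> then - e b else e b) * w x"
    by (elim exE conjE)
  have we: "w (x \<circ> swp3 b) = (if b \<in> \<eta> then - e b else e b) * w x" if "b \<in> B" "x \<in> P" for b x
    using H that by blast
  have b: "b \<in> B" using insert.prems by auto
  note card = good_blocksD(1)[OF B b] and sub = good_blocksD(2)[OF B b]
  let ?c = "cyc3 b"
  note rel = cyc3_relations[OF card]
  have cP: "?c \<in> P" by (rule block_P(1)[OF sub])
  have aP: "swp3 b \<in> P" by (rule block_P(2)[OF sub])
  define u where "u = (\<lambda>x. rt ?c w x - rt ?c (rt ?c w) x)"
  have u_eq: "u x = w (x \<circ> ?c) - w (x \<circ> ?c \<circ> ?c)" for x by (simp add: u_def rt_def)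
  have u: "u \<in> block_space Es B" unfolding u_def
    by (intro block_space_closed(2)[OF Es] block_space_rt_block(1)[OF Es B b] w)
  have z: "w x + w (x \<circ> ?c) + w (x \<circ> ?c \<circ> ?c) = 0" if "x \<in> P" for x
    using w(1) b that by (auto simp: block_space_def)
  have "ip P u u > 0"
  proof -
    obtain x where x: "x \<in> P" "w x \<noteq> 0" using w(2) ip_pos_P by auto
    have "u (x \<circ> ?c) - u (x \<circ> ?c \<circ> ?c) = - 3 * w x"
      using z[OF x(1)] by (simp add: u_eq cyc3_cancel[OF rel(1)])
    then have "u (x \<circ> ?c) \<noteq> 0 \<or> u (x \<circ> ?c \<circ> ?c) \<noteq> 0" using x(2) by auto
    then show ?thesis unfolding ip_pos_P using comp_P[OF x(1) cP] comp_P[OF comp_P[OF x(1) cP] cP] by blast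
  qed
  moreover have "u (x \<circ> swp3 b') = (if b' \<in> insert b \<eta> then - e b' else e b') * u x" if b': "b' \<in> B" and x: "x \<in> P" for b' x
  proof (cases "b' = b")
    case True
    have "x \<circ> swp3 b \<circ> ?c = x \<circ> ?c \<circ> ?c \<circ> swp3 b" by (metis rel(2) comp_assoc)
    moreover have "x \<circ> swp3 b \<circ> ?c \<circ> ?c = x \<circ> ?c \<circ> swp3 b" by (metis rel(3) comp_assoc)
    moreover have "w (x \<circ> ?c \<circ> ?c \<circ> swp3 b) = e b * w (x \<circ> ?c \<circ> ?c)" "w (x \<circ> ?c \<circ> swp3 b) = e b * w (x \<circ> ?c)"
      using we[OF b comp_P[OF comp_P[OF x cP] cP]] we[OF b comp_P[OF x cP]] insert.hyps by auto
    ultimately show ?thesis using True by (simp add: u_eq algebra_simps)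
  next
    case False
    have c: "swp3 b' \<circ> ?c = ?c \<circ> swp3 b'" using swp_commute(2)[OF B b' b False] .
    have "x \<circ> swp3 b' \<circ> ?c = x \<circ> ?c \<circ> swp3 b'" by (metis c comp_assoc)
    moreover have "x \<circ> swp3 b' \<circ> ?c \<circ> ?c = x \<circ> ?c \<circ> ?c \<circ> swp3 b'" by (metis c comp_assoc)
    ultimately show ?thesis
      using we[OF b' comp_P[OF x cP]] we[OF b' comp_P[OF comp_P[OF x cP] cP]] False
      by (simp add: u_eq algebra_simps)
  qed
  ultimately show ?case using u by blast
qed

text \<open>Every subset of \<open>B\<close> can be the set of flipped signs. Vectors with different
  signs at a block are orthogonal, since its transposition acts as an isometry that negates their
  inner product; so the Bessel constant is 1.\<close>

lemma coarse_spread: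
  assumes Es: "right_subspace Es" and B: "good_blocks B" and v: "v \<in> block_space Es B" "ip P v v > 0"
  shows "\<exists>(I :: ('a \<times> 'a \<times> 'a) set set) u. finite I \<and> card I = 2 ^ card B \<and>
      (\<forall>i\<in>I. u i \<in> Es \<and> ip P (u i) (u i) = 1) \<and> (\<forall>w. (\<Sum>i\<in>I. (ip P w (u i))\<^sup>2) \<le> ip P w w)"
proof -
  have finB: "finite B" using good_blocks_subset[OF B] finV by (meson finite_SigmaI finite_subset)
  obtain w e where w: "w \<in> block_space Es B" "ip P w w > 0"
     and e: "\<And>b. b \<in> B \<Longrightarrow> e b * e b = (1::real)" "\<And>b x. b \<in> B \<Longrightarrow> x \<in> P \<Longrightarrow> w (x \<circ> swp3 b) = e b * w x"
    using joint_eigenvector[OF Es B v finB order.refl] by blast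
  have "\<exists>u. u \<in> block_space Es B \<and> ip P u u > 0 \<and>
     (\<forall>b\<in>B. \<forall>x\<in>P. u (x \<circ> swp3 b) = (if b \<in> \<eta> then - e b else e b) * u x)" if "\<eta> \<in> Pow B" for \<eta>
    using flipped_eigenvector[OF Es B w e(2)] that finite_subset[OF _ finB] by blast
  then obtain u where u: "\<And>\<eta>. \<eta> \<in> Pow B \<Longrightarrow> u \<eta> \<in> block_space Es B" "\<And>\<eta>. \<eta> \<in> Pow B \<Longrightarrow> ip P (u \<eta>) (u \<eta>) > 0"
    "\<And>\<eta> b x. \<eta> \<in> Pow B \<Longrightarrow> b \<in> B \<Longrightarrow> x \<in> P \<Longrightarrow> u \<eta> (x \<circ> swp3 b) = (if b \<in> \<eta> then - e b else e b) * u \<eta> x"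
    by metis
  have orth: "ip P (u \<eta>) (u \<eta>') = 0" if \<eta>: "\<eta> \<in> Pow B" "\<eta>' \<in> Pow B" "\<eta> \<noteq> \<eta>'" for \<eta> \<eta>'
  proof -
    obtain b where b: "b \<in> B" "b \<in> \<eta> \<longleftrightarrow> b \<notin> \<eta>'" using \<eta> by blast
    have aP: "swp3 b \<in> P" using B b by (intro block_P(2)) (auto simp: good_blocks_def)
    have "ip P (u \<eta>) (u \<eta>') = ip P (rt (swp3 b) (u \<eta>)) (rt (swp3 b) (u \<eta>'))" using ip_rt[OF aP] by simp
    also have "\<dots> = ip P (\<lambda>x. (if b \<in> \<eta> then - e b else e b) * u \<eta> x) (\<lambda>x. (if b \<in> \<eta>' then - e b else e b) * u \<eta>' x)"
      by (intro ip_cong) (simp_all only: rt_def u(3)[OF \<eta>(1) b(1)] u(3)[OF \<eta>(2) b(1)])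
    also have "\<dots> = - (e b * e b) * ip P (u \<eta>) (u \<eta>')"
      unfolding ip_scale_left ip_scale_right using b(2) by auto
    finally show ?thesis using e(1)[OF b(1)] by simp
  qed
  define n where "n \<eta> = (\<lambda>x. (1 / sqrt (ip P (u \<eta>) (u \<eta>))) * u \<eta> x)" for \<eta>
  have n1: "ip P (n \<eta>) (n \<eta>) = 1" if "\<eta> \<in> Pow B" for \<eta>
  proof -
    have "1 / sqrt s * (1 / sqrt s * s) = 1" if "s > 0" for s :: real
      using that real_sqrt_mult_self[of s] by (simp add: field_simps)
    then show ?thesis using u(2)[OF that] unfolding n_def by (simp only: ip_scale_left ip_scale_right)
  qed
  have n0: "ip P (n \<eta>) (n \<eta>') = 0" if "\<eta> \<in> Pow B" "\<eta>' \<in> Pow B" "\<eta> \<noteq> \<eta>'" for \<eta> \<eta>'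
    unfolding n_def ip_scale_left ip_scale_right using orth[OF that] by simp
  have nE: "n \<eta> \<in> Es" if "\<eta> \<in> Pow B" for \<eta>
    unfolding n_def using u(1)[OF that] by (intro right_subspace_scale[OF Es]) (simp add: block_space_def)
  have "(\<Sum>i\<in>Pow B. (ip P w (n i))\<^sup>2) \<le> 1 * ip P w w" for w
  proof (rule Bessel_row_sums)
    fix \<eta> assume \<eta>: "\<eta> \<in> Pow B"
    have "(\<Sum>j\<in>Pow B. \<bar>ip P (n \<eta>) (n j)\<bar>) = (\<Sum>j\<in>Pow B. if j = \<eta> then 1 else 0)"
      using n1 n0 \<eta> by (intro sum.cong refl) auto
    then show "(\<Sum>j\<in>Pow B. \<bar>ip P (n \<eta>) (n j)\<bar>) \<le> 1" using \<eta> finB by simp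
  qed (use finB in auto)
  then show ?thesis using finB n1 nE by (intro exI[of _ "Pow B"] exI[of _ n]) (auto simp: card_Pow)
qed

definition sign_chars where "sign_chars = {(\<lambda>_. 1), (\<lambda>\<sigma>. real_of_int (sign \<sigma>)) :: ('a \<Rightarrow> 'a) \<Rightarrow> real}"

lemma sign_chars_character: "\<chi> \<in> sign_chars \<Longrightarrow> character V \<chi>"
  using character_one character_sign[OF finV] by (auto simp: sign_chars_def)

lemma maximal_blocks:
  assumes Es: "right_subspace Es" and v0: "v0 \<in> Es" "ip P v0 v0 > 0"
  shows "\<exists>B. good_blocks B \<and> (\<exists>v\<in>block_space Es B. ip P v v > 0) \<and>
    (\<forall>b. good_blocks (insert b B) \<longrightarrow> b \<notin> B \<longrightarrow> (\<forall>v\<in>block_space Es (insert b B). \<not> ip P v v > 0))"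
proof -
  define Bs where "Bs = {B. good_blocks B \<and> (\<exists>v\<in>block_space Es B. ip P v v > 0)}"
  have sub: "B \<subseteq> V \<times> V \<times> V" if "B \<in> Bs" for B using that good_blocks_subset by (auto simp: Bs_def)
  have fin: "finite (V \<times> V \<times> V)" using finV by auto
  have "{} \<in> Bs" using v0 by (auto simp: Bs_def good_blocks_def block_space_def)
  moreover have bd: "card B \<le> card (V \<times> V \<times> V)" if "B \<in> Bs" for B by (rule card_mono[OF fin sub[OF that]])
  ultimately have "\<exists>B. B \<in> Bs \<and> (\<forall>B'. B' \<in> Bs \<longrightarrow> card B' \<le> card B)"
    by (intro ex_has_greatest_nat[of "\<lambda>B. B \<in> Bs" "{}" card "Suc (card (V \<times> V \<times> V))"]) (auto simp: less_Suc_eq_le le_Suc_eq)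
  then obtain B where B: "B \<in> Bs" "\<And>B'. B' \<in> Bs \<Longrightarrow> card B' \<le> card B" by blast
  have finB: "finite B" using sub[OF B(1)] fin finite_subset by blast
  have "insert b B \<notin> Bs" if "b \<notin> B" for b using B(2)[of "insert b B"] that finB by auto
  then show ?thesis using B(1) unfolding Bs_def by blast
qed

text \<open>Removing from \<open>v\<close> its average over the powers of the three-cycle gives
  \<open>u\<close>, which belongs to the space of the enlarged block system and hence vanishes by
  maximality. Comparing \<open>u\<close> at \<open>x\<close> and at \<open>x \<circ> cyc3 b\<close>
  gives the claim.\<close>

lemma three_cycle_invariant:
  assumes Es: "right_subspace Es" and B: "good_blocks B"
    and mx: "\<forall>b. good_blocks (insert b B) \<longrightarrow> b \<notin> B \<longrightarrow> (\<forall>v\<in>block_space Es (insert b B). \<not> ip P v v > 0)"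
    and v: "v \<in> block_space Es B"
    and b: "supp3 b \<subseteq> V - \<Union> (supp3 ` B)" "card (supp3 b) = 3" and x: "x \<in> P"
  shows "v (x \<circ> cyc3 b) = v x"
proof -
  have bV: "supp3 b \<subseteq> V" using b by auto
  have disj: "supp3 b' \<inter> supp3 b = {}" if "b' \<in> B" for b' using b that by blast
  have gb: "good_blocks (insert b B)" unfolding good_blocks_def
  proof (intro conjI ballI impI)
    fix b' assume "b' \<in> insert b B"
    then show "card (supp3 b') = 3" "supp3 b' \<subseteq> V" using b(2) bV good_blocksD[OF B] by blast+
  next
    fix b1 b2 assume "b1 \<in> insert b B" "b2 \<in> insert b B" "b1 \<noteq> b2"
    then show "supp3 b1 \<inter> supp3 b2 = {}" using disj good_blocksD(3)[OF B, of b1 b2] by blast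
  qed
  have bB: "b \<notin> B" using disj[of b] b(2) by auto
  have cP: "cyc3 b \<in> P" by (rule block_P(1)[OF bV])
  note rel = cyc3_relations(1)[OF b(2)]
  let ?c = "cyc3 b"
  define u where "u = (\<lambda>x. ((2/3) * v x - (1/3) * rt ?c v x) - (1/3) * rt ?c (rt ?c v) x)"
  have rtc: "rt ?c w \<in> block_space Es B" if "w \<in> block_space Es B" for w
    by (rule block_space_rt_disjoint[OF Es that cyc3_permutes bV disj])
  have u1: "u \<in> block_space Es B" unfolding u_def
    by (intro block_space_closed(2)[OF Es] block_space_closed(3)[OF Es _ v] rtc v)
  have ueq: "u y = (2/3) * v y - (1/3) * v (y \<circ> ?c) - (1/3) * v (y \<circ> ?c \<circ> ?c)" for y by (simp add: u_def rt_def)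
  have "u y + u (y \<circ> ?c) + u (y \<circ> ?c \<circ> ?c) = 0" for y
    by (simp add: ueq cyc3_cancel[OF rel])
  then have "u \<in> block_space Es (insert b B)" using u1 unfolding block_space_def by blast
  then have "\<not> ip P u u > 0" using mx gb bB by blast
  then have "u y = 0" if "y \<in> P" for y using ip_pos_P that by blast
  then have "u x = 0" "u (x \<circ> ?c) = 0" using x comp_P[OF x cP] by auto
  then show ?thesis by (simp add: ueq cyc3_cancel[OF rel])
qed

text \<open>Outside the union \<open>T\<close> of the blocks all three-cycles fix \<open>v\<close>,
  so all transpositions there send it to one and the same \<open>u\<close> and exchange
  \<open>v\<close> with \<open>u\<close>. Hence \<open>v + u\<close> is invariant and
  \<open>v - u\<close> takes the sign, and they cannot both vanish. With fewer than two points
  outside \<open>T\<close> the stabiliser is trivial and \<open>v\<close> itself serves.\<close>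

lemma maximal_blocks_semi_inv:
  assumes Es: "right_subspace Es" and B: "good_blocks B"
    and mx: "\<forall>b. good_blocks (insert b B) \<longrightarrow> b \<notin> B \<longrightarrow> (\<forall>v\<in>block_space Es (insert b B). \<not> ip P v v > 0)"
    and v: "v \<in> block_space Es B" "ip P v v > 0"
  shows "\<exists>\<chi>\<in>sign_chars. \<exists>T w. T \<subseteq> V \<and> card T \<le> 3 * card B \<and> w \<in> Es \<and> ip P w w > 0 \<and> semi_inv \<chi> T w"
proof -
  let ?tr = "Transposition.transpose"
  define T where "T = \<Union> (supp3 ` B)"
  define U where "U = V - T"
  have finB: "finite B" using good_blocks_subset[OF B] finV by (meson finite_SigmaI finite_subset)
  have TV: "T \<subseteq> V" using good_blocksD(2)[OF B] by (auto simp: T_def)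
  have cardT: "card T \<le> 3 * card B"
  proof -
    have "card T \<le> (\<Sum>b\<in>B. card (supp3 b))" unfolding T_def using finB by (rule card_UN_le)
    also have "\<dots> = 3 * card B" using good_blocksD(1)[OF B] by simp
    finally show ?thesis .
  qed
  have StU: "Stab T = {\<sigma>. \<sigma> permutes U}" by (simp add: Stab_def U_def)
  have vE: "v \<in> Es" using v by (simp add: block_space_def)
  have finU: "finite U" using finV by (simp add: U_def)
  have trP: "?tr a b \<in> P" if "a \<in> U" "b \<in> U" for a b using that by (intro transpose_P) (auto simp: U_def)
  have cyc: "v (x \<circ> ?tr p q \<circ> ?tr q s) = v x" if "p \<in> U" "q \<in> U" "s \<in> U" "p \<noteq> q" "q \<noteq> s" "p \<noteq> s" "x \<in> P" for p q s x
    using three_cycle_invariant[OF Es B mx v(1), of "(p,q,s)" x] that by (simp add: U_def T_def comp_assoc card_insert_if)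
  have share: "v (x \<circ> ?tr p q) = v (x \<circ> ?tr q s)" if "p \<in> U" "q \<in> U" "s \<in> U" "p \<noteq> q" "q \<noteq> s" "x \<in> P" for p q s x
  proof (cases "p = s")
    case False
    have "v ((x \<circ> ?tr p q) \<circ> ?tr p q \<circ> ?tr q s) = v (x \<circ> ?tr p q)"
      by (rule cyc) (use that False trP comp_P in auto)
    then show ?thesis by (simp add: comp_assoc)
  qed (simp add: transpose_commute)
  have all: "v (x \<circ> ?tr a b) = v (x \<circ> ?tr p q)" if "a \<in> U" "b \<in> U" "p \<in> U" "q \<in> U" "a \<noteq> b" "p \<noteq> q" "x \<in> P" for a b p q x
  proof (cases "b = p")
    case True
    then show ?thesis using share[of a b q x] that by simp
  next
    case False
    have "v (x \<circ> ?tr a b) = v (x \<circ> ?tr b p)" using share[of a b p x] that False by simp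
    also have "\<dots> = v (x \<circ> ?tr p q)" using share[of b p q x] that False by simp
    finally show ?thesis .
  qed
  show ?thesis
  proof (cases "\<exists>p\<in>U. \<exists>q\<in>U. p \<noteq> q")
    case False
    have idSt: "\<sigma> = id" if "\<sigma> \<in> Stab T" for \<sigma>
    proof
      fix x
      have "\<sigma> permutes U" using that StU by simp
      then show "\<sigma> x = id x" using False by (metis permutes_in_image permutes_not_in id_apply)
    qed
    have "semi_inv (\<lambda>_. 1) T v"
      unfolding semi_inv_def
    proof (intro ballI)
      fix \<rho> x assume "\<rho> \<in> Stab T"
      then have "\<rho> = id" by (rule idSt)
      then show "v (x \<circ> \<rho>) = 1 * v x" by simp
    qed
    then show ?thesis
      by (intro bexI[of _ "\<lambda>_. 1"] exI[of _ T] exI[of _ v] conjI TV cardT vE v(2)) (auto simp: sign_chars_def)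
  next
    case True
    then obtain p q where pq: "p \<in> U" "q \<in> U" "p \<noteq> q" by auto
    have pqP: "?tr p q \<in> P" using trP pq by simp
    define u where "u = rt (?tr p q) v"
    have uE: "u \<in> Es" unfolding u_def by (rule right_subspace_rt[OF Es vE pqP])
    have ut: "v (x \<circ> ?tr a b) = u x" "u (x \<circ> ?tr a b) = v x" if "a \<in> U" "b \<in> U" "a \<noteq> b" "x \<in> P" for a b x
    proof -
      show "v (x \<circ> ?tr a b) = u x" unfolding u_def rt_def using all[of a b p q x] that pq by simp
      have "u (x \<circ> ?tr a b) = v ((x \<circ> ?tr a b) \<circ> ?tr a b)"
        unfolding u_def rt_def using all[of a b p q "x \<circ> ?tr a b"] that pq trP comp_P by simp
      then show "u (x \<circ> ?tr a b) = v x" by (simp add: comp_assoc)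
    qed
    have gen: "semi_inv \<chi> T w"
      if c: "\<chi> \<in> sign_chars" and w: "\<And>x a b. x \<in> P \<Longrightarrow> a \<in> U \<Longrightarrow> b \<in> U \<Longrightarrow> a \<noteq> b \<Longrightarrow> w (x \<circ> ?tr a b) = \<chi> (?tr a b) * w x" for \<chi> w
      unfolding semi_inv_def StU
    proof (intro ballI)
      fix \<rho> x assume \<rho>: "\<rho> \<in> {\<sigma>. \<sigma> permutes U}" and x: "x \<in> P"
      have ch: "character V \<chi>" by (rule sign_chars_character[OF c])
      from \<rho> have "\<rho> permutes U" by simp
      then show "w (x \<circ> \<rho>) = \<chi> \<rho> * w x" using finU x
      proof (induction arbitrary: x rule: permutes_induct)
        case id
        show ?case using character_id[OF ch] by (simp only: comp_id mult_1)
      next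
        case (swap a b p)
        have "p \<in> Stab T" using swap.hyps StU by simp
        then have P: "?tr a b \<in> P" "p \<in> P" using trP swap.hyps Stab_subset by blast+
        have "w (x \<circ> (?tr a b \<circ> p)) = w ((x \<circ> ?tr a b) \<circ> p)" by (simp only: comp_assoc)
        also have "\<dots> = \<chi> p * w (x \<circ> ?tr a b)" by (rule swap.IH[OF comp_P[OF swap.prems P(1)]])
        also have "w (x \<circ> ?tr a b) = \<chi> (?tr a b) * w x" by (rule w[OF swap.prems swap.hyps(1-3)])
        finally show ?case by (simp only: character_P(1)[OF ch P] mult.assoc mult.left_commute mult.commute)
      qed
    qed
    have chis: "(\<lambda>_. 1) \<in> sign_chars" "(\<lambda>\<sigma>. real_of_int (sign \<sigma>)) \<in> sign_chars" by (simp_all add: sign_chars_def)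
    have "semi_inv (\<lambda>_. 1) T (\<lambda>x. v x + u x)"
    proof (rule gen[OF chis(1)])
      fix x a b assume x: "x \<in> P" and H: "a \<in> U" "b \<in> U" "a \<noteq> b"
      show "v (x \<circ> ?tr a b) + u (x \<circ> ?tr a b) = 1 * (v x + u x)" unfolding ut[OF H x] by simp
    qed
    moreover have "semi_inv (\<lambda>\<sigma>. real_of_int (sign \<sigma>)) T (\<lambda>x. v x - u x)"
    proof (rule gen[OF chis(2)])
      fix x a b assume x: "x \<in> P" and H: "a \<in> U" "b \<in> U" "a \<noteq> b"
      show "v (x \<circ> ?tr a b) - u (x \<circ> ?tr a b) = real_of_int (sign (?tr a b)) * (v x - u x)"
        unfolding ut[OF H x] using H(3) by (simp add: sign_swap_id)
    qed
    ultimately show ?thesis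
      using nonzero_sum_or_diff[OF v(2), of u] right_subspace_add[OF Es vE uE] right_subspace_diff[OF Es vE uE] TV cardT chis
      by meson
  qed
qed

text \<open>Passing from \<open>x\<close> to \<open>x + 1\<close> multiplies the power by
  \<open>(1 + 1/x) ^ x\<close>, at most 3, times \<open>6 * (x + 1) / n\<close>, at most 1/3. This
  is the origin of the factor 18.\<close>

lemma power_ratio_decreasing:
  assumes "1 \<le> x" "18 * (x + 1) \<le> n"
  shows "(6 * real (x + 1) / real n) ^ (x + 1) \<le> (6 * real x / real n) ^ x"
proof -
  have n0: "real n > 0" using assms by simp
  have "(1 + 1 / real x) ^ x \<le> exp (1 / real x) ^ x" by (intro power_mono) (auto simp: exp_ge_add_one_self)
  also have "\<dots> = exp 1" using assms by (simp add: exp_of_nat_mult[symmetric])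
  also have "\<dots> \<le> 3" by (rule exp_le)
  finally have e: "(1 + 1 / real x) ^ x \<le> 3" .
  have eq: "6 * real (x + 1) / real n = (6 * real x / real n) * (1 + 1 / real x)" using assms by (simp add: field_simps)
  have "(6 * real (x + 1) / real n) ^ (x + 1) = (6 * real x / real n) ^ x * ((1 + 1 / real x) ^ x * (6 * real (x + 1) / real n))"
  proof -
    have "(6 * real (x + 1) / real n) ^ x = (6 * real x / real n) ^ x * (1 + 1 / real x) ^ x"
      unfolding eq power_mult_distrib ..
    then show ?thesis by (simp only: power_add power_one_right mult.assoc)
  qed
  also have "\<dots> \<le> (6 * real x / real n) ^ x * (3 * (1/3))"
  proof (intro mult_left_mono mult_mono e)
    show "6 * real (x + 1) / real n \<le> 1 / 3" using assms n0 by (simp add: divide_simps)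
  qed auto
  finally show ?thesis by simp
qed

lemma power_ratio_mono:
  assumes "1 \<le> x" "x \<le> y" "18 * y \<le> n"
  shows "(6 * real y / real n) ^ y \<le> (6 * real x / real n) ^ x"
  using assms(2,3)
proof (induction y rule: dec_induct)
  case (step y)
  have "(6 * real (y + 1) / real n) ^ (y + 1) \<le> (6 * real y / real n) ^ y"
    by (rule power_ratio_decreasing) (use step assms in auto)
  also have "\<dots> \<le> (6 * real x / real n) ^ x" using step by simp
  finally show ?case by simp
qed simp

text \<open>Let \<open>e\<close> be the least number of points whose pointwise stabiliser has a (sign-)invariant vector in \<open>Es\<close>.
  If \<open>18 * e \<le> m\<close>, translates of such a vector are almost orthogonal. Otherwise a maximal system
  of blocks is large, since outside of it all three-cycles act trivially, and its sign patterns are used.\<close>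

lemma spread_family:
  assumes Es: "right_subspace Es" and v0: "v0 \<in> Es" "ip P v0 v0 > 0"
    and no: "\<And>\<chi> T w. \<chi> \<in> sign_chars \<Longrightarrow> T \<subseteq> V \<Longrightarrow> card T \<le> d \<Longrightarrow> w \<in> Es \<Longrightarrow> semi_inv \<chi> T w \<Longrightarrow> \<not> ip P w w > 0"
    and d: "18 * (d + 1) \<le> m" and q: "(1/2) ^ (m div 54) \<le> q" "(6 * real (d + 1) / real m) ^ (d + 1) \<le> q"
  shows "\<exists>n C (u :: nat \<Rightarrow> ('a \<Rightarrow> 'a) \<Rightarrow> real). n > 0 \<and> (\<forall>i<n. u i \<in> Es \<and> ip P (u i) (u i) = 1) \<and> C \<le> q * real n \<and>
     (\<forall>w. (\<Sum>i<n. (ip P w (u i))\<^sup>2) \<le> C * ip P w w)"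
proof -
  define Q where "Q n \<longleftrightarrow> (\<exists>\<chi>\<in>sign_chars. \<exists>T w. T \<subseteq> V \<and> card T = n \<and> w \<in> Es \<and> ip P w w > 0 \<and> semi_inv \<chi> T w)" for n
  obtain B where B: "good_blocks B" "\<exists>v\<in>block_space Es B. ip P v v > 0"
    "\<forall>b. good_blocks (insert b B) \<longrightarrow> b \<notin> B \<longrightarrow> (\<forall>v\<in>block_space Es (insert b B). \<not> ip P v v > 0)"
    using maximal_blocks[OF Es v0] by blast
  then obtain v where v: "v \<in> block_space Es B" "ip P v v > 0" by auto
  obtain \<chi>1 T1 w1 where 1: "\<chi>1 \<in> sign_chars" "T1 \<subseteq> V" "card T1 \<le> 3 * card B" "w1 \<in> Es" "ip P w1 w1 > 0" "semi_inv \<chi>1 T1 w1"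
    using maximal_blocks_semi_inv[OF Es B(1) B(3) v] by blast
  have Q1: "Q (card T1)" using 1 unfolding Q_def by blast
  define e where "e = (LEAST n. Q n)"
  have Qe: "Q e" unfolding e_def by (rule LeastI[of Q, OF Q1])
  have e_min: "\<not> Q n" if "n < e" for n using that unfolding e_def by (rule not_less_Least)
  have eB: "e \<le> 3 * card B" using Least_le[of Q, OF Q1] 1(3) unfolding e_def by simp
  obtain \<chi> T w where w: "\<chi> \<in> sign_chars" "T \<subseteq> V" "card T = e" "w \<in> Es" "ip P w w > 0" "semi_inv \<chi> T w"
    using Qe unfolding Q_def by blast
  have ed: "e \<ge> d + 1" using no[OF w(1,2) _ w(4,6)] w(3,5) by linarith
  have reindex: ?thesis if fam: "finite I" "I \<noteq> {}" "\<forall>i\<in>I. u i \<in> Es \<and> ip P (u i) (u i) = 1" "C \<le> q * real (card I)"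
      "\<forall>w. (\<Sum>i\<in>I. (ip P w (u i))\<^sup>2) \<le> C * ip P w w" for I :: "'i set" and u C
  proof -
    obtain h where h: "bij_betw h {..<card I} I"
      using ex_bij_betw_nat_finite[OF fam(1)] by (auto simp: atLeast0LessThan)
    have hI: "h i \<in> I" if "i < card I" for i using h that by (auto simp: bij_betw_def)
    have "(\<Sum>i<card I. (ip P w (u (h i)))\<^sup>2) \<le> C * ip P w w" for w
      using fam(5) sum.reindex_bij_betw[OF h, of "\<lambda>i. (ip P w (u i))\<^sup>2"] by simp
    then show ?thesis using fam hI
      by (intro exI[of _ "card I"] exI[of _ C] exI[of _ "\<lambda>i. u (h i)"]) (auto simp: card_gt_0_iff)
  qed
  show ?thesis
  proof (cases "18 * e \<le> m")
    case True
    define c where "c = 1 / sqrt (ip P w w)"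
    define w' where "w' = (\<lambda>x. c * w x)"
    have w'E: "w' \<in> Es" unfolding w'_def by (rule right_subspace_scale[OF Es w(4)])
    have w'1: "ip P w' w' = 1"
    proof -
      have "1 / sqrt s * (1 / sqrt s * s) = 1" if "s > 0" for s :: real
        using that real_sqrt_mult_self[of s] by (simp add: field_simps)
      then show ?thesis using w(5) unfolding w'_def c_def by (simp only: ip_scale_left ip_scale_right)
    qed
    have w's: "semi_inv \<chi> T w'" using w(6) unfolding semi_inv_def w'_def by simp
    have ch: "character V \<chi>" by (rule sign_chars_character[OF w(1)])
    have finT: "finite T" using w(2) finV finite_subset by auto
    \<comment> \<open>Averaging \<open>w'\<close> over the stabiliser of \<open>T - {t}\<close>
      gives a vector of \<open>Es\<close> that is semi-invariant for fewer points, hence zero by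
      minimality of \<open>e\<close>. This supplies the relation on which \<open>gram_decay\<close>
      rests.\<close>
    have zero: "(\<Sum>j\<in>insert t (V - T). \<chi> (Transposition.transpose t j) * w' (x \<circ> Transposition.transpose t j)) = 0"
      if t: "t \<in> T" and x: "x \<in> P" for t x
    proof (rule semi_inv_sum_zero[OF ch w(2) t w's x])
      let ?a = "\<lambda>x. \<Sum>\<rho>\<in>Stab (T - {t}). \<chi> \<rho> * w' (x \<circ> \<rho>)"
      have "(\<lambda>x. \<Sum>\<rho>\<in>Stab (T - {t}). \<chi> \<rho> * rt \<rho> w' x) \<in> Es"
        by (intro right_subspace_sum[OF Es w'E] right_subspace_scale[OF Es] right_subspace_rt[OF Es w'E]) (use Stab_subset in auto)
      then have aE: "?a \<in> Es" by (simp add: rt_def)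
      have "\<not> Q (card (T - {t}))" using w(3) t finT by (intro e_min) (metis card_Diff1_less)
      then have "\<not> ip P ?a ?a > 0"
        using w(1,2) aE semi_inv_average[OF ch, of "T - {t}" w'] unfolding Q_def by blast
      then show "?a x = 0" using ip_pos_P[of ?a] x by blast
    qed
    have e4: "4 * e \<le> m" "e > 0" using True ed by auto
    obtain I :: "('a \<Rightarrow> nat) set" and s where I: "finite I" "card I = (m div e) ^ e" "\<forall>i\<in>I. s i \<in> P"
      "\<forall>z. (\<Sum>i\<in>I. (ip P z (twist \<chi> w' (s i)))\<^sup>2) \<le> 3 ^ e * ip P z z"
      using gram_spread[OF ch w(2,3) e4 w's w'1 zero] by blast
    have m0: "real m > 0" using e4 by linarith
    have div: "real m / (2 * real e) \<le> real (m div e)"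
    proof -
      have "m div e \<ge> 1" using e4 by (simp add: Suc_le_eq div_greater_zero_iff)
      moreover have "m < (m div e + 1) * e" using e4(2) by (metis Suc_eq_plus1 dividend_less_times_div mult.commute mult_Suc_right)
      ultimately have "m \<le> (2 * (m div e)) * e" by (smt (verit) add_mono_thms_linordered_semiring(1) le_trans less_imp_le mult_2 mult_le_mono1 order.refl)
      then have "real m \<le> real (2 * (m div e) * e)" by (simp only: of_nat_le_iff)
      then show ?thesis using e4 by (simp add: divide_simps mult.commute mult.left_commute)
    qed
    have Ine: "card I > 0" using I(2) e4 by (simp add: div_greater_zero_iff)
    have bound: "3 ^ e \<le> q * real (card I)"
    proof -
      \<comment> \<open>The Bessel constant is \<open>3 ^ e\<close>, and there are at least
        \<open>(m / (2 * e)) ^ e\<close> vectors; the quotient is the power in the hypothesis on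
        \<open>q\<close>, with \<open>e\<close> in place of \<open>d + 1\<close>.\<close>
      have "(3::real) = (6 * real e / real m) * (real m / (2 * real e))" using e4 m0 by simp
      then have "(3::real) ^ e = (6 * real e / real m) ^ e * (real m / (2 * real e)) ^ e"
        by (metis power_mult_distrib)
      also have "\<dots> \<le> q * real (m div e) ^ e"
      proof (intro mult_mono power_mono div)
        have "(6 * real e / real m) ^ e \<le> (6 * real (d + 1) / real m) ^ (d + 1)"
          by (rule power_ratio_mono) (use ed True in auto)
        then show "(6 * real e / real m) ^ e \<le> q" using q(2) by linarith
        show "0 \<le> q" using q(1) zero_le_power[of "1/2::real"] by (meson order.trans zero_le_divide_1_iff zero_le_numeral)
      qed auto
      finally show ?thesis using I(2) by simp
    qed
    show ?thesis
    proof (rule reindex[OF I(1) _ _ bound])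
      show "I \<noteq> {}" using Ine by auto
      show "\<forall>i\<in>I. twist \<chi> w' (s i) \<in> Es \<and> ip P (twist \<chi> w' (s i)) (twist \<chi> w' (s i)) = 1"
      proof
        fix i assume i: "i \<in> I"
        have "twist \<chi> w' (s i) \<in> Es" unfolding twist_def using I(3) i by (intro right_subspace_scale[OF Es] right_subspace_rt[OF Es w'E]) auto
        moreover have "ip P (twist \<chi> w' (s i)) (twist \<chi> w' (s i)) = 1"
          unfolding twist_def ip_scale_left ip_scale_right using ip_rt[of "s i" w' w'] w'1 character_P(2)[OF ch, of "s i"] I(3) i by simp
        ultimately show "twist \<chi> w' (s i) \<in> Es \<and> ip P (twist \<chi> w' (s i)) (twist \<chi> w' (s i)) = 1" ..
      qed
      show "\<forall>z. (\<Sum>i\<in>I. (ip P z (twist \<chi> w' (s i)))\<^sup>2) \<le> 3 ^ e * ip P z z" by (rule I(4))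
    qed
  next
    case False
    \<comment> \<open>Here \<open>m < 18 * e\<close> and \<open>e \<le> 3 * card B\<close>, whence
      54.\<close>
    then have mB: "m div 54 \<le> card B" using eB by linarith
    obtain I :: "('a \<times> 'a \<times> 'a) set set" and u where I: "finite I" "card I = 2 ^ card B"
      "\<forall>i\<in>I. u i \<in> Es \<and> ip P (u i) (u i) = 1" "\<forall>w. (\<Sum>i\<in>I. (ip P w (u i))\<^sup>2) \<le> ip P w w"
      using coarse_spread[OF Es B(1) v] by blast
    have bound: "1 \<le> q * real (card I)"
    proof -
      have "(1::real) = (1/2) ^ card B * 2 ^ card B" by (simp add: power_mult_distrib[symmetric])
      also have "\<dots> \<le> (1/2) ^ (m div 54) * 2 ^ card B" by (intro mult_right_mono power_decreasing mB) auto
      also have "\<dots> \<le> q * 2 ^ card B" by (intro mult_right_mono q) auto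
      finally show ?thesis using I(2) by simp
    qed
    show ?thesis
      by (rule reindex[OF I(1) _ I(3) bound]) (use I in auto)
  qed
qed

end

section \<open>Left convolution on high-degree functions\<close>

context sym_space
begin

text \<open>The indicator of the translate \<open>F \<circ> x\<close>: row \<open>x\<close> of the
  matrix of \<open>left_sum F\<close>. Accordingly \<open>left_kernel F\<close> below is the matrix
  of the adjoint of this operator times the operator.\<close>

definition left_ind where "left_ind F x y = (if y \<circ> inv' x \<in> F then 1 else 0 :: real)"

definition left_sum where "left_sum F v x = (\<Sum>a\<in>F. v (a \<circ> x))" for F :: "('a \<Rightarrow> 'a) set" and v :: "('a \<Rightarrow> 'a) \<Rightarrow> real"

definition left_kernel where "left_kernel F y z = (\<Sum>x\<in>P. left_ind F x y * left_ind F x z)"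

lemma finite_F: "F \<subseteq> P \<Longrightarrow> finite F" using finP finite_subset by auto

lemma left_sum_ip: assumes F: "F \<subseteq> P" and x: "x \<in> P" shows "left_sum F v x = ip P (left_ind F x) v"
proof -
  have b: "bij_betw (\<lambda>a. a \<circ> x) F {y \<in> P. y \<circ> inv' x \<in> F}"
    by (rule bij_betw_byWitness[where f' = "\<lambda>y. y \<circ> inv' x"])
       (use F x in \<open>auto simp: inv_cancel comp_P subset_iff\<close>)
  have "left_sum F v x = (\<Sum>y\<in>{y \<in> P. y \<circ> inv' x \<in> F}. v y)"
    unfolding left_sum_def using sum.reindex_bij_betw[OF b] by simp
  also have "\<dots> = ip P (left_ind F x) v"
    unfolding ip_def left_ind_def using finP by (intro sum.mono_neutral_cong_left) auto
  finally show ?thesis .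
qed

lemma ip_left_ind: assumes F: "F \<subseteq> P" and x: "x \<in> P" shows "ip P (left_ind F x) (left_ind F x) = real (card F)"
proof -
  have "ip P (left_ind F x) (left_ind F x) = ip P (left_ind F x) (\<lambda>_. 1)" unfolding ip_def left_ind_def by (intro sum.cong) auto
  also have "\<dots> = left_sum F (\<lambda>_. 1) x" using left_sum_ip[OF F x] by simp
  finally show ?thesis by (simp add: left_sum_def)
qed

lemma qform_left_kernel: assumes F: "F \<subseteq> P" shows "qform P (left_kernel F) v w = ip P (left_sum F v) (left_sum F w)"
proof -
  have "qform P (left_kernel F) v w = (\<Sum>y\<in>P. \<Sum>z\<in>P. \<Sum>x\<in>P. (left_ind F x y * v y) * (left_ind F x z * w z))"
    unfolding qform_def left_kernel_def by (simp add: sum_distrib_right sum_distrib_left algebra_simps)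
  also have "\<dots> = (\<Sum>y\<in>P. \<Sum>x\<in>P. \<Sum>z\<in>P. (left_ind F x y * v y) * (left_ind F x z * w z))"
    by (rule sum.cong[OF refl sum.swap])
  also have "\<dots> = (\<Sum>x\<in>P. \<Sum>y\<in>P. \<Sum>z\<in>P. (left_ind F x y * v y) * (left_ind F x z * w z))"
    by (rule sum.swap)
  also have "\<dots> = (\<Sum>x\<in>P. ip P (left_ind F x) v * ip P (left_ind F x) w)"
    unfolding ip_def by (simp add: sum_product)
  also have "\<dots> = ip P (left_sum F v) (left_sum F w)" unfolding ip_def[of P "left_sum F v"] using left_sum_ip[OF F] by simp
  finally show ?thesis .
qed

lemma left_kernel_sym: "left_kernel F y z = left_kernel F z y" by (simp add: left_kernel_def mult.commute)

lemma inv_comp_P: "x \<in> P \<Longrightarrow> y \<in> P \<Longrightarrow> inv' (x \<circ> y) = inv' y \<circ> inv' x"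
  unfolding P_def by (simp add: o_inv_distrib permutes_bij)

lemma left_kernel_right_invariant: "right_invariant (left_kernel F)"
  unfolding right_invariant_def
proof (intro ballI)
  fix \<sigma> y z assume s: "\<sigma> \<in> P" and "y \<in> P" "z \<in> P"
  have i: "left_ind F (x \<circ> \<sigma>) (y \<circ> \<sigma>) = left_ind F x y" if "x \<in> P" for x y
    unfolding left_ind_def inv_comp_P[OF that s] by (simp add: comp_assoc[symmetric]) (simp add: comp_assoc inv_comp s)
  have "left_kernel F (y \<circ> \<sigma>) (z \<circ> \<sigma>) = (\<Sum>x\<in>P. left_ind F (x \<circ> \<sigma>) (y \<circ> \<sigma>) * left_ind F (x \<circ> \<sigma>) (z \<circ> \<sigma>))"
    unfolding left_kernel_def using sum_right[OF s, of "\<lambda>x. left_ind F x (y \<circ> \<sigma>) * left_ind F x (z \<circ> \<sigma>)"] by simp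
  also have "\<dots> = left_kernel F y z" unfolding left_kernel_def by (intro sum.cong) (simp_all add: i)
  finally show "left_kernel F (y \<circ> \<sigma>) (z \<circ> \<sigma>) = left_kernel F y z" .
qed

definition High where "High d = perp P (\<Union>\<chi>\<in>sign_chars. Cyls \<chi> d)"

lemma High_iff: "h \<in> High d \<longleftrightarrow> (\<forall>\<chi>\<in>sign_chars. h \<in> perp P (Cyls \<chi> d))"
  by (auto simp: High_def perp_def)

lemma High_rt: "h \<in> High d \<Longrightarrow> \<sigma> \<in> P \<Longrightarrow> rt \<sigma> h \<in> High d"
  unfolding High_iff using rt_perp_Cyls sign_chars_character by blast

text \<open>Let \<mu> be the largest eigenvalue of the form on \<open>High d\<close>. Its eigenspace
  is right invariant and contains the \<open>n\<close> unit vectors of \<open>spread_family\<close>.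
  Summing the form over them gives \<open>n * \<mu>\<close>; summing by rows of the matrix first,
  the Bessel inequality bounds it by \<open>C\<close> times the Hilbert--Schmidt norm squared,
  \<open>card F * fact m\<close>. As \<open>C \<le> q * n\<close>, the bound on \<mu>
  follows.\<close>

theorem high_part_bound:
  assumes F: "F \<subseteq> P" and d: "18 * (d + 1) \<le> m"
    and q: "(1/2) ^ (m div 54) \<le> q" "(6 * real (d + 1) / real m) ^ (d + 1) \<le> q"
    and h: "h \<in> High d"
  shows "ip P (left_sum F h) (left_sum F h) \<le> q * real (card F) * fact m * ip P h h"
proof (cases "\<exists>v0\<in>High d. ip P v0 v0 > 0")
  case False
  then have "ip P h h = 0" using h ip_nonneg[of P h] by force
  then have "h x = 0" if "x \<in> P" for x using ip_self_eq_0[OF finP] that by auto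
  then have "left_sum F h x = 0" if "x \<in> P" for x using F that comp_P unfolding left_sum_def by (intro sum.neutral) blast
  then show ?thesis using \<open>ip P h h = 0\<close> by (simp add: ip_def)
next
  case True
  then obtain v0 where v0: "v0 \<in> High d" "ip P v0 v0 > 0" by auto
  obtain v \<mu> where v: "v \<in> High d" "ip P v v = 1" "\<forall>w\<in>High d. qform P (left_kernel F) v w = \<mu> * ip P v w"
    and top: "\<forall>w\<in>High d. qform P (left_kernel F) w w \<le> \<mu> * ip P w w"
    using top_eigenvector[OF finP, of "left_kernel F" v0 "\<Union>\<chi>\<in>sign_chars. Cyls \<chi> d"] left_kernel_sym v0 unfolding High_def by blast
  define Es where "Es = {v \<in> High d. \<forall>w\<in>High d. qform P (left_kernel F) v w = \<mu> * ip P v w}"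
  have rs: "right_subspace Es" unfolding Es_def High_def
    by (rule eigenspace_right_subspace[OF left_kernel_right_invariant]) (use High_rt in \<open>simp add: High_def\<close>)
  have vE: "v \<in> Es" using v by (simp add: Es_def)
  \<comment> \<open>A semi-invariant \<open>w\<close> makes the twisted sum over a coset of
    \<open>Stab T\<close> a multiple of the single value \<open>w x\<close>, while membership in
    \<open>High d\<close> makes that sum zero.\<close>
  have no: "\<not> ip P w w > 0" if "\<chi> \<in> sign_chars" "T \<subseteq> V" "card T \<le> d" "w \<in> Es" "semi_inv \<chi> T w" for \<chi> T w
  proof -
    have wp: "w \<in> perp P (Cyls \<chi> d)" using that by (simp add: Es_def High_iff)
    have ch: "character V \<chi>" by (rule sign_chars_character[OF that(1)])
    have "w x = 0" if x: "x \<in> P" for x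
    proof -
      have "0 = (\<Sum>y\<in>Cyl x T. \<chi> y * w y)" using wp x \<open>T \<subseteq> V\<close> \<open>card T \<le> d\<close> unfolding perp_Cyls by auto
      also have "\<dots> = (\<Sum>\<rho>\<in>Stab T. \<chi> (x \<circ> \<rho>) * w (x \<circ> \<rho>))" by (rule sum_Cyl[OF x])
      also have "\<dots> = (\<Sum>\<rho>\<in>Stab T. \<chi> x * w x)"
      proof (intro sum.cong refl)
        fix \<rho> assume \<rho>: "\<rho> \<in> Stab T"
        then have \<rho>P: "\<rho> \<in> P" using Stab_subset by auto
        have "w (x \<circ> \<rho>) = \<chi> \<rho> * w x" using \<open>semi_inv \<chi> T w\<close> \<rho> x by (simp add: semi_inv_def)
        then show "\<chi> (x \<circ> \<rho>) * w (x \<circ> \<rho>) = \<chi> x * w x"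
          using character_P[OF ch] x \<rho>P by simp
      qed
      finally have "\<chi> x * w x = 0" using cardStab[OF \<open>T \<subseteq> V\<close>] by simp
      then show ?thesis using character_P(2)[OF ch x] by auto
    qed
    then show ?thesis by (simp add: ip_def)
  qed
  have "ip P v v > 0" using v(2) by simp
  have "\<exists>n C (u :: nat \<Rightarrow> ('a \<Rightarrow> 'a) \<Rightarrow> real). n > 0 \<and> (\<forall>i<n. u i \<in> Es \<and> ip P (u i) (u i) = 1) \<and> C \<le> q * real n \<and>
     (\<forall>w. (\<Sum>i<n. (ip P w (u i))\<^sup>2) \<le> C * ip P w w)"
    by (rule spread_family[OF rs vE \<open>ip P v v > 0\<close> _ d q]) (rule no)
  then obtain n C and u :: "nat \<Rightarrow> ('a \<Rightarrow> 'a) \<Rightarrow> real" where n: "n > 0" "\<forall>i<n. u i \<in> Es \<and> ip P (u i) (u i) = 1"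
    "C \<le> q * real n" "\<forall>w. (\<Sum>i<n. (ip P w (u i))\<^sup>2) \<le> C * ip P w w"
    by (elim exE conjE)
  have "real n * \<mu> = (\<Sum>i<n. qform P (left_kernel F) (u i) (u i))"
    using n(2) by (simp add: Es_def)
  also have "\<dots> = (\<Sum>i<n. \<Sum>x\<in>P. (ip P (left_ind F x) (u i))\<^sup>2)"
    unfolding qform_left_kernel[OF F] unfolding ip_def[of P "left_sum F (u _)"] using left_sum_ip[OF F]
    by (simp add: power2_eq_square)
  also have "\<dots> = (\<Sum>x\<in>P. \<Sum>i<n. (ip P (left_ind F x) (u i))\<^sup>2)" by (rule sum.swap)
  also have "\<dots> \<le> (\<Sum>x\<in>P. C * real (card F))"
    using n(4) ip_left_ind[OF F] by (intro sum_mono) metis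
  also have "\<dots> = C * real (card F) * fact m" by (simp add: cardP)
  also have "\<dots> \<le> (q * real n) * real (card F) * fact m" by (intro mult_right_mono n(3)) auto
  finally have "\<mu> * real n \<le> (q * real (card F) * fact m) * real n" by (simp add: algebra_simps)
  then have \<mu>: "\<mu> \<le> q * real (card F) * fact m" using n(1) by simp
  have "ip P (left_sum F h) (left_sum F h) \<le> \<mu> * ip P h h" using top h qform_left_kernel[OF F] by metis
  also have "\<dots> \<le> q * real (card F) * fact m * ip P h h" by (intro mult_right_mono \<mu> ip_nonneg)
  finally show ?thesis .
qed

end

section \<open>Lifting to a product space\<close>

locale sym_lift = sym_space +
  assumes V_ne: "V \<noteq> {}"
begin

sublocale ps: prod_space V V by standard (use finV V_ne in auto)

text \<open>The positions at which \<open>y\<close> takes a value of \<open>V\<close> that it takes nowhere else carry a partial injection, and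
  \<open>lift f y\<close> averages \<open>f\<close> over the permutations that extend it. This transfers functions on the
  symmetric group to a product space, commuting with both translations.\<close>

definition uniq where "uniq y = {i \<in> V. y i \<in> V \<and> (\<forall>j\<in>V. j \<noteq> i \<longrightarrow> y j \<noteq> y i)}"
definition Ext where "Ext y = {x \<in> P. \<forall>i\<in>uniq y. x i = y i}"
definition lift where "lift f y = (\<Sum>x\<in>Ext y. f x) / real (card (Ext y))" for f :: "('a \<Rightarrow> 'a) \<Rightarrow> real"

lemma uniq_cong: "(\<And>i. i \<in> V \<Longrightarrow> y i = y' i) \<Longrightarrow> uniq y = uniq y'" by (auto simp: uniq_def)
lemma Ext_cong: "(\<And>i. i \<in> V \<Longrightarrow> y i = y' i) \<Longrightarrow> Ext y = Ext y'"
  unfolding Ext_def using uniq_cong[of y y'] by (auto simp: uniq_def)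
lemma lift_cong: "(\<And>i. i \<in> V \<Longrightarrow> y i = y' i) \<Longrightarrow> lift f y = lift f y'"
  unfolding lift_def using Ext_cong[of y y'] by simp
lemma uniq_V: "uniq y \<subseteq> V" by (auto simp: uniq_def)
lemma uniq_inj: "inj_on y (uniq y)" by (auto simp: uniq_def inj_on_def)
lemma uniq_image: "y ` uniq y \<subseteq> V" by (auto simp: uniq_def)
lemma Ext_P: "Ext y \<subseteq> P" by (auto simp: Ext_def)
lemma finExt: "finite (Ext y)" using Ext_P finP finite_subset by blast

lemma Ext_ne: "Ext y \<noteq> {}"
  using extend_injection[OF uniq_V uniq_inj uniq_image, of y] by (auto simp: Ext_def)

lemma cardExt: "real (card (Ext y)) > 0" using Ext_ne finExt by (simp add: card_gt_0_iff)

lemma lift_const: "lift (\<lambda>_. c) y = c" unfolding lift_def using cardExt by simp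
lemma lift_scale: "lift (\<lambda>x. c * f x) y = c * lift f y"
  by (simp add: lift_def sum_distrib_left)
lemma lift_sum: "lift (\<lambda>x. \<Sum>i\<in>I. f i x) y = (\<Sum>i\<in>I. lift (f i) y)"
  unfolding lift_def by (subst sum.swap) (simp add: sum_divide_distrib)
lemma lift_cong_P: "(\<And>x. x \<in> P \<Longrightarrow> f x = g x) \<Longrightarrow> lift f y = lift g y"
  unfolding lift_def using Ext_P by (intro arg_cong2[where f="(/)"] sum.cong) auto
lemma lift_mono: "(\<And>x. x \<in> P \<Longrightarrow> f x \<le> g x) \<Longrightarrow> lift f y \<le> lift g y"
  unfolding lift_def using Ext_P by (intro divide_right_mono sum_mono) auto
lemma lift_abs: "\<bar>lift f y\<bar> \<le> lift (\<lambda>x. \<bar>f x\<bar>) y"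
  unfolding lift_def abs_divide by (auto intro!: divide_right_mono sum_abs)

lemma uniq_left: "g \<in> P \<Longrightarrow> uniq (g \<circ> y) = uniq y"
proof -
  assume g: "g \<in> P"
  have "g z \<in> V \<longleftrightarrow> z \<in> V" for z using g by (simp add: P_def permutes_in_image)
  then show ?thesis unfolding uniq_def using P_inj[OF g] by simp
qed

lemma Ext_left: assumes g: "g \<in> P" shows "bij_betw (\<lambda>x. g \<circ> x) (Ext y) (Ext (g \<circ> y))"
  by (rule bij_betw_byWitness[where f' = "\<lambda>x. inv' g \<circ> x"])
     (use g in \<open>auto simp: Ext_def uniq_left inv_cancel comp_P inv_P P_inv_apply\<close>)

lemma lift_left: assumes g: "g \<in> P" shows "lift f (g \<circ> y) = lift (\<lambda>x. f (g \<circ> x)) y"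
  unfolding lift_def using sum.reindex_bij_betw[OF Ext_left[OF g], of f y] bij_betw_same_card[OF Ext_left[OF g, of y]] by simp

lemma uniq_right: assumes s: "\<sigma> \<in> P" shows "i \<in> uniq (y \<circ> \<sigma>) \<longleftrightarrow> \<sigma> i \<in> uniq y"
proof -
  have V: "\<sigma> j \<in> V \<longleftrightarrow> j \<in> V" for j using s by (simp add: P_def permutes_in_image)
  have "(\<forall>j\<in>V. j \<noteq> i \<longrightarrow> y (\<sigma> j) \<noteq> y (\<sigma> i)) \<longleftrightarrow> (\<forall>j\<in>V. j \<noteq> \<sigma> i \<longrightarrow> y j \<noteq> y (\<sigma> i))"
  proof safe
    fix j assume a: "\<forall>j\<in>V. j \<noteq> i \<longrightarrow> y (\<sigma> j) \<noteq> y (\<sigma> i)" and j: "j \<in> V" "j \<noteq> \<sigma> i" "y j = y (\<sigma> i)"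
    have e: "\<sigma> (inv' \<sigma> j) = j" using s by (simp add: P_inv_apply)
    have "inv' \<sigma> j \<in> V" using j(1) V[of "inv' \<sigma> j"] e by simp
    moreover have "inv' \<sigma> j \<noteq> i" using e j(2) by auto
    ultimately have "y (\<sigma> (inv' \<sigma> j)) \<noteq> y (\<sigma> i)" using a by blast
    then show False using e j(3) by simp
  next
    fix j assume a: "\<forall>j\<in>V. j \<noteq> \<sigma> i \<longrightarrow> y j \<noteq> y (\<sigma> i)" and j: "j \<in> V" "j \<noteq> i" "y (\<sigma> j) = y (\<sigma> i)"
    then show False using V[of j] P_inj[OF s, of j i] by blast
  qed
  then show ?thesis unfolding uniq_def using V by simp
qed

lemma Ext_right: assumes s: "\<sigma> \<in> P" shows "bij_betw (\<lambda>x. x \<circ> \<sigma>) (Ext y) (Ext (y \<circ> \<sigma>))"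
proof (rule bij_betw_byWitness[where f' = "\<lambda>x. x \<circ> inv' \<sigma>"])
  show "(\<lambda>x. x \<circ> \<sigma>) ` Ext y \<subseteq> Ext (y \<circ> \<sigma>)"
    using s by (auto simp: Ext_def uniq_right comp_P)
  show "(\<lambda>x. x \<circ> inv' \<sigma>) ` Ext (y \<circ> \<sigma>) \<subseteq> Ext y"
  proof (rule image_subsetI)
    fix x assume x: "x \<in> Ext (y \<circ> \<sigma>)"
    have "(x \<circ> inv' \<sigma>) i = y i" if "i \<in> uniq y" for i
    proof -
      have "inv' \<sigma> i \<in> uniq (y \<circ> \<sigma>)" using that s by (simp add: uniq_right P_inv_apply)
      then show ?thesis using x s by (auto simp: Ext_def P_inv_apply)
    qed
    then show "x \<circ> inv' \<sigma> \<in> Ext y" using x s by (auto simp: Ext_def comp_P inv_P)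
  qed
qed (use s in \<open>auto simp: inv_cancel\<close>)

lemma lift_right: assumes s: "\<sigma> \<in> P" shows "lift (rt \<sigma> f) y = lift f (y \<circ> \<sigma>)"
  unfolding lift_def rt_def using sum.reindex_bij_betw[OF Ext_right[OF s], of f y] bij_betw_same_card[OF Ext_right[OF s, of y]] by simp

definition is_global where
  "is_global F r \<phi> \<longleftrightarrow> (\<forall>x\<in>P. \<forall>T. T \<subseteq> V \<longrightarrow> real (card (F \<inter> Cyl x T)) \<le> r ^ card T * \<phi> * fact (m - card T))"

text \<open>The average is invariant under left multiplication by the stabiliser of the values prescribed on \<open>R\<close>;
  averaging over that stabiliser turns it into densities of \<open>F\<close> on cosets.\<close>

lemma lift_global:
  assumes F: "F \<subseteq> P" "is_global F r \<phi>" and r: "r \<ge> 1" and phi: "\<phi> \<ge> 0" and R: "R \<subseteq> V"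
  shows "ps.EE (V - R) (lift (\<lambda>x. if x \<in> F then 1 else 0)) y \<le> r ^ card R * \<phi>"
proof -
  let ?f = "\<lambda>x. if x \<in> F then 1 else (0::real)"
  let ?Z = "PiE (V - R) (\<lambda>_. V)"
  let ?mg = "\<lambda>z i. if i \<in> V - R then z i else y i"
  \<comment> \<open>The point \<open>y\<close> is an arbitrary function and may take values outside
    \<open>V\<close>; permutations of \<open>V\<close> fix those anyway, so only the values in
    \<open>V\<close> have to be stabilised.\<close>
  define A where "A = y ` R \<inter> V"
  have finR: "finite R" using R finV finite_subset by auto
  have AV: "A \<subseteq> V" by (simp add: A_def)
  have cardA: "card A \<le> card R"
  proof -
    have "card A \<le> card (y ` R)" unfolding A_def using finR by (intro card_mono) auto
    also have "\<dots> \<le> card R" using finR by (rule card_image_le)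
    finally show ?thesis .
  qed
  have finZ: "finite ?Z" using finV by (intro finite_PiE) auto
  have cardZ: "real (card ?Z) = real m ^ card (V - R)" using finV by (simp add: card_PiE)
  have gfix: "g (y i) = y i" if "g \<in> Stab A" "i \<in> R" for g i
  proof (cases "y i \<in> V")
    case True
    then show ?thesis using that Stab_fix[of g A "y i"] by (auto simp: A_def)
  next
    case False
    have "g \<in> P" using that Stab_subset by auto
    then show ?thesis using False by (simp add: P_def permutes_not_in)
  qed
  have shift: "(\<Sum>z\<in>?Z. lift ?f (?mg z)) = (\<Sum>z\<in>?Z. lift (\<lambda>x. ?f (g \<circ> x)) (?mg z))" if g: "g \<in> Stab A" for g
  proof -
    have gP: "g \<in> P" using g Stab_subset by auto
    let ?a = "\<lambda>g z. restrict (g \<circ> z) (V - R)"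
    have ig: "inv' g \<in> P" using inv_P[OF gP] .
    have b: "bij_betw (?a g) ?Z ?Z"
    proof (rule bij_betw_byWitness[where f' = "?a (inv' g)"])
      show "\<forall>z\<in>?Z. ?a (inv' g) (?a g z) = z"
        using P_inv_apply[OF gP] by (auto simp: fun_eq_iff restrict_def PiE_def extensional_def)
      show "\<forall>z\<in>?Z. ?a g (?a (inv' g) z) = z"
        using P_inv_apply[OF gP] by (auto simp: fun_eq_iff restrict_def PiE_def extensional_def)
      show "?a g ` ?Z \<subseteq> ?Z" using P_apply[OF gP] by (auto simp: PiE_def Pi_def)
      show "?a (inv' g) ` ?Z \<subseteq> ?Z" using P_apply[OF ig] by (auto simp: PiE_def Pi_def)
    qed
    have "(\<Sum>z\<in>?Z. lift ?f (?mg z)) = (\<Sum>z\<in>?Z. lift ?f (?mg (?a g z)))"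
      using sum.reindex_bij_betw[OF b, of "\<lambda>z. lift ?f (?mg z)"] by simp
    also have "\<dots> = (\<Sum>z\<in>?Z. lift ?f (g \<circ> ?mg z))"
      by (intro sum.cong refl lift_cong) (use gfix[OF g] in auto)
    also have "\<dots> = (\<Sum>z\<in>?Z. lift (\<lambda>x. ?f (g \<circ> x)) (?mg z))" by (simp only: lift_left[OF gP])
    finally show ?thesis .
  qed
  have avg: "(\<Sum>g\<in>Stab A. ?f (g \<circ> x)) \<le> fact (m - card A) * (r ^ card R * \<phi>)" if x: "x \<in> P" for x
  proof -
    have ix: "inv' x \<in> P" by (rule inv_P[OF x])
    have T: "inv' x ` A \<subseteq> V" "card (inv' x ` A) = card A"
      using AV P_apply[OF ix] P_inj[OF ix] by (auto simp: card_image inj_on_def)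
    have "(\<Sum>g\<in>Stab A. ?f (g \<circ> x)) = real (card {g \<in> Stab A. g \<circ> x \<in> F})"
      using finStab by (simp add: sum.If_cases Int_def)
    also have "\<dots> \<le> real (card (F \<inter> Cyl x (inv' x ` A)))"
    proof -
      have "inj_on (\<lambda>g. g \<circ> x) {g \<in> Stab A. g \<circ> x \<in> F}"
        by (rule inj_onI) (metis inv_cancel(3) x)
      moreover have "(\<lambda>g. g \<circ> x) ` {g \<in> Stab A. g \<circ> x \<in> F} \<subseteq> F \<inter> Cyl x (inv' x ` A)"
        using F(1) P_inv_apply[OF x] Stab_fix by (auto simp: Cyl_def)
      moreover have "finite (F \<inter> Cyl x (inv' x ` A))" using finite_F[OF F(1)] by simp
      ultimately have "card {g \<in> Stab A. g \<circ> x \<in> F} \<le> card (F \<inter> Cyl x (inv' x ` A))" by (rule card_inj_on_le)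
      then show ?thesis by simp
    qed
    also have "\<dots> \<le> r ^ card A * \<phi> * fact (m - card A)" using F(2)[unfolded is_global_def, rule_format, OF x T(1)] T(2) by simp
    also have "\<dots> \<le> fact (m - card A) * (r ^ card R * \<phi>)"
    proof -
      have "r ^ card A \<le> r ^ card R" using cardA r by (intro power_increasing)
      then have "r ^ card A * \<phi> \<le> r ^ card R * \<phi>" using phi by (intro mult_right_mono)
      then show ?thesis by (simp add: mult.commute)
    qed
    finally show ?thesis .
  qed
  have cardSA: "real (card (Stab A)) = fact (m - card A)" using cardStab[OF AV] by simp
  have "fact (m - card A) * (\<Sum>z\<in>?Z. lift ?f (?mg z)) = (\<Sum>g\<in>Stab A. \<Sum>z\<in>?Z. lift ?f (?mg z))"
    using cardSA by simp
  also have "\<dots> = (\<Sum>g\<in>Stab A. \<Sum>z\<in>?Z. lift (\<lambda>x. ?f (g \<circ> x)) (?mg z))" by (intro sum.cong refl shift)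
  also have "\<dots> = (\<Sum>z\<in>?Z. lift (\<lambda>x. \<Sum>g\<in>Stab A. ?f (g \<circ> x)) (?mg z))"
    by (subst sum.swap) (simp only: lift_sum)
  also have "\<dots> \<le> (\<Sum>z\<in>?Z. lift (\<lambda>x. fact (m - card A) * (r ^ card R * \<phi>)) (?mg z))"
    by (intro sum_mono lift_mono avg)
  also have "\<dots> = fact (m - card A) * (real m ^ card (V - R) * (r ^ card R * \<phi>))"
    using cardZ by (simp only: lift_const sum_constant) simp
  finally have "(\<Sum>z\<in>?Z. lift ?f (?mg z)) \<le> real m ^ card (V - R) * (r ^ card R * \<phi>)" by simp
  moreover have "real m > 0" using finV V_ne by (simp add: card_gt_0_iff)
  ultimately show ?thesis
    using finV by (subst ps.EE_explicit) (auto simp: divide_le_eq mult.commute)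
qed

section \<open>Lifted functions against functions of few coordinates\<close>

abbreviation X where "X \<equiv> PiE V (\<lambda>_. V)"

lemma finX: "finite X" using finV by (intro finite_PiE) auto

lemma m_pos: "real m > 0" using finV V_ne by (simp add: card_gt_0_iff)

lemma ex_sum_X: "ps.ex f = (\<Sum>y\<in>X. f y) / real m ^ m"
  unfolding ps.ex_def ps.EE_explicit[OF finV]
  by (intro arg_cong2[where f="(/)"] refl sum.cong arg_cong[where f=f]) (auto simp: PiE_def extensional_def)

definition agrees where "agrees T y \<longleftrightarrow> (\<exists>x\<in>P. \<forall>t\<in>T. x t = y t)"

text \<open>For \<open>w\<close> invariant under \<open>Stab T\<close> on the right, the choice of
  the permutation is immaterial (\<open>junta_eq\<close>). The default 0 covers the \<open>y\<close>
  that are not injections of \<open>T\<close> into \<open>V\<close>.\<close>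

definition junta where
  "junta w T y = (if agrees T y then w (SOME x. x \<in> P \<and> (\<forall>t\<in>T. x t = y t)) else (0::real))"

lemma junta_eq:
  assumes w: "semi_inv (\<lambda>_. 1) T w" and x: "x \<in> P" "\<And>t. t \<in> T \<Longrightarrow> x t = y t"
  shows "junta w T y = w x"
proof -
  let ?x = "SOME x. x \<in> P \<and> (\<forall>t\<in>T. x t = y t)"
  have s: "?x \<in> P \<and> (\<forall>t\<in>T. ?x t = y t)" by (rule someI[of _ x]) (use x in auto)
  then have "?x \<in> Cyl x T" using x by (simp add: Cyl_def)
  then obtain \<rho> where \<rho>: "\<rho> \<in> Stab T" "?x = x \<circ> \<rho>" using Cyl_bij[OF x(1), of T] by (auto simp: bij_betw_def)
  then have "w ?x = w x" using w x(1) by (simp add: semi_inv_def)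
  then show ?thesis using x by (auto simp: junta_def agrees_def)
qed

lemma junta_0: "\<not> agrees T y \<Longrightarrow> junta w T y = 0" by (simp add: junta_def)

lemma agrees_cong: "(\<And>t. t \<in> T \<Longrightarrow> y t = y' t) \<Longrightarrow> agrees T y \<longleftrightarrow> agrees T y'"
  by (auto simp: agrees_def)

lemma junta_cong: "(\<And>t. t \<in> T \<Longrightarrow> y t = y' t) \<Longrightarrow> junta w T y = junta w T y'"
  using agrees_cong[of T y y'] by (simp add: junta_def)

lemma agrees_iff: "T \<subseteq> V \<Longrightarrow> agrees T y \<longleftrightarrow> inj_on y T \<and> y ` T \<subseteq> V"
proof
  assume T: "T \<subseteq> V"
  show "inj_on y T \<and> y ` T \<subseteq> V" if ag: "agrees T y"
  proof -
    obtain x where x: "x \<in> P" "\<forall>t\<in>T. x t = y t" using ag by (auto simp: agrees_def)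
    have "inj_on y T"
    proof (rule inj_onI)
      fix s t assume "s \<in> T" "t \<in> T" "y s = y t"
      then have "x s = x t" using x(2) by simp
      then show "s = t" using P_inj[OF x(1)] by simp
    qed
    moreover have "y t \<in> V" if "t \<in> T" for t
      using x that T P_apply[OF x(1), of t] by auto
    ultimately show ?thesis by auto
  qed
  show "inj_on y T \<and> y ` T \<subseteq> V \<Longrightarrow> agrees T y"
    unfolding agrees_def using extend_injection[OF T] by blast
qed

lemma lift_eq_junta:
  assumes w: "semi_inv (\<lambda>_. 1) T w" and T: "T \<subseteq> uniq y"
  shows "lift w y = junta w T y"
proof -
  have "w x = junta w T y" if "x \<in> Ext y" for x
    by (rule junta_eq[OF w, symmetric]) (use that T in \<open>auto simp: Ext_def\<close>)
  then have "lift w y = lift (\<lambda>_. junta w T y) y" unfolding lift_def by simp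
  then show ?thesis by (simp only: lift_const)
qed

definition act where "act g y = restrict (g \<circ> y) V" for g y :: "'a \<Rightarrow> 'a"

lemma act_X: "g \<in> P \<Longrightarrow> y \<in> X \<Longrightarrow> act g y \<in> X"
  using P_apply by (auto simp: act_def PiE_def Pi_def)

lemma act_inv: "g \<in> P \<Longrightarrow> y \<in> X \<Longrightarrow> act (inv' g) (act g y) = y" "g \<in> P \<Longrightarrow> y \<in> X \<Longrightarrow> act g (act (inv' g) y) = y"
  using P_inv_apply by (auto simp: act_def PiE_def extensional_def fun_eq_iff)

lemma uniq_act: assumes "g \<in> P" shows "uniq (act g y) = uniq y"
proof -
  have "uniq (act g y) = uniq (g \<circ> y)" by (rule uniq_cong) (simp add: act_def)
  then show ?thesis using uniq_left[OF assms] by simp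
qed

text \<open>The left multipliers that keep \<open>Ext y\<close>, and with it the lift, unchanged;
  they act simply transitively on \<open>Ext y\<close> (\<open>Ext_align\<close>).\<close>

definition align where "align y = Stab (y ` uniq y)"

lemma align_act: assumes g: "g \<in> align y" shows "align (act g y) = align y" "Ext (act g y) = Ext y" "lift w (act g y) = lift w y"
proof -
  have gP: "g \<in> P" using g Stab_subset by (auto simp: align_def)
  have e: "act g y i = y i" if "i \<in> uniq y" for i
    using g that uniq_V Stab_fix[of g "y ` uniq y" "y i"] by (auto simp: act_def align_def)
  have "act g y ` uniq y = y ` uniq y" using e by (intro image_cong) auto
  then show "align (act g y) = align y" by (simp add: align_def uniq_act[OF gP])
  show E: "Ext (act g y) = Ext y" using e by (auto simp: Ext_def uniq_act[OF gP])
  show "lift w (act g y) = lift w y" by (simp add: lift_def E)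
qed

text \<open>The map sending \<open>(y, g)\<close> to \<open>(act g y, inv' g)\<close> is an
  involution of the set of all pairs with \<open>g\<close> in \<open>align y\<close>, and it
  preserves the size of \<open>align y\<close>.\<close>

lemma sum_align_average:
  "(\<Sum>y\<in>X. h y) = (\<Sum>y\<in>X. (\<Sum>g\<in>align y. h (act g y)) / real (card (align y)))"
proof -
  let ?Z = "Sigma X align"
  have finf: "finite (align y)" for y unfolding align_def by (rule finStab)
  have cf: "real (card (align y)) > 0" for y
  proof -
    have "id \<in> align y" by (simp add: align_def)
    then show ?thesis using finf[of y] by (auto simp: card_gt_0_iff simp del: id_apply)
  qed
  have fP: "g \<in> P" if "g \<in> align y" for g y using that Stab_subset by (auto simp: align_def)
  have fi: "inv' g \<in> align y" if "g \<in> align y" for g y using that inv_Stab by (auto simp: align_def)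
  have b: "bij_betw (\<lambda>(y, g). (act g y, inv' g)) ?Z ?Z"
  proof (rule bij_betw_byWitness[where f' = "\<lambda>(y, g). (act g y, inv' g)"])
    have inv': "(\<lambda>(y, g). (act g y, inv' g)) ((\<lambda>(y, g). (act g y, inv' g)) p) = p" if "p \<in> ?Z" for p
      using that act_inv fP by (auto simp: inv_inv_P)
    have into: "(\<lambda>(y, g). (act g y, inv' g)) p \<in> ?Z" if pZ: "p \<in> ?Z" for p
    proof -
      obtain y g where p: "p = (y, g)" "y \<in> X" "g \<in> align y" using pZ by auto
      then show ?thesis using act_X[OF fP[OF p(3)] p(2)] align_act(1)[OF p(3)] fi[OF p(3)] by simp
    qed
    show "\<forall>p\<in>?Z. (\<lambda>(y, g). (act g y, inv' g)) ((\<lambda>(y, g). (act g y, inv' g)) p) = p"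
      "\<forall>p\<in>?Z. (\<lambda>(y, g). (act g y, inv' g)) ((\<lambda>(y, g). (act g y, inv' g)) p) = p" using inv' by blast+
    show "(\<lambda>(y, g). (act g y, inv' g)) ` ?Z \<subseteq> ?Z" "(\<lambda>(y, g). (act g y, inv' g)) ` ?Z \<subseteq> ?Z" using into by blast+
  qed
  have "(\<Sum>y\<in>X. h y) = (\<Sum>y\<in>X. \<Sum>g\<in>align y. h y / real (card (align y)))"
    using cf by (simp add: less_imp_neq[THEN not_sym])
  also have "\<dots> = (\<Sum>(y,g)\<in>?Z. h y / real (card (align y)))"
    by (rule sum.Sigma) (use finX finf in auto)
  also have "\<dots> = (\<Sum>(y,g)\<in>?Z. h (act g y) / real (card (align (act g y))))"
    using sum.reindex_bij_betw[OF b, of "\<lambda>(y,g). h y / real (card (align y))"] by (simp add: case_prod_unfold)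
  also have "\<dots> = (\<Sum>(y,g)\<in>?Z. h (act g y) / real (card (align y)))"
    using align_act(1) by (intro sum.cong) auto
  also have "\<dots> = (\<Sum>y\<in>X. \<Sum>g\<in>align y. h (act g y) / real (card (align y)))"
    by (rule sum.Sigma[symmetric]) (use finX finf in auto)
  finally show ?thesis by (simp add: sum_divide_distrib)
qed

lemma Ext_align: assumes x: "x \<in> Ext y" shows "bij_betw (\<lambda>g. g \<circ> x) (align y) (Ext y)"
proof (rule bij_betw_byWitness[where f' = "\<lambda>x'. x' \<circ> inv' x"])
  have xP: "x \<in> P" using x Ext_P by auto
  have e: "x i = y i" if "i \<in> uniq y" for i using x that by (simp add: Ext_def)
  show "(\<lambda>g. g \<circ> x) ` align y \<subseteq> Ext y"
    using xP e by (auto simp: align_def Ext_def Stab_iff comp_P)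
  show "(\<lambda>x'. x' \<circ> inv' x) ` Ext y \<subseteq> align y"
  proof (rule image_subsetI)
    fix x' assume x': "x' \<in> Ext y"
    have "(x' \<circ> inv' x) (y i) = y i" if i: "i \<in> uniq y" for i
    proof -
      have "inv' x (y i) = i" using e[OF i] P_inv_apply(1)[OF xP, of i] by simp
      then show ?thesis using x' i by (simp add: Ext_def)
    qed
    then show "x' \<circ> inv' x \<in> align y"
      using comp_P[OF subsetD[OF Ext_P x'] inv_P[OF xP]] by (auto simp: align_def Stab_iff)
  qed
  show "\<forall>g\<in>align y. g \<circ> x \<circ> inv' x = g" "\<forall>x'\<in>Ext y. x' \<circ> inv' x \<circ> x = x'"
    using xP by (auto simp: inv_cancel)
qed

text \<open>Average over \<open>align y\<close>. The lift does not change, and where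
  \<open>y\<close> agrees with a permutation on \<open>T\<close> the junta averages to the lift
  itself, because the translates of one extension run through all of \<open>Ext y\<close>. Elsewhere
  the junta vanishes on the whole orbit.\<close>

lemma lift_junta_correlation:
  assumes w: "semi_inv (\<lambda>_. 1) T w" and T: "T \<subseteq> V"
  shows "(\<Sum>y\<in>X. lift w y * junta w T y) = (\<Sum>y\<in>X. if agrees T y then (lift w y)\<^sup>2 else 0)"
proof -
  have "(\<Sum>g\<in>align y. lift w (act g y) * junta w T (act g y)) / real (card (align y))
     = (if agrees T y then (lift w y)\<^sup>2 else 0)" if y: "y \<in> X" for y
  proof -
    have fP: "g \<in> P" if "g \<in> align y" for g using that Stab_subset by (auto simp: align_def)
    have 1: "(\<Sum>g\<in>align y. lift w (act g y) * junta w T (act g y)) = lift w y * (\<Sum>g\<in>align y. junta w T (act g y))"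
      by (simp add: sum_distrib_left align_act(3))
    show ?thesis
    proof (cases "agrees T y")
      case False
      have "\<not> agrees T (act g y)" if "g \<in> align y" for g
      proof
        assume "agrees T (act g y)"
        then obtain x where x: "x \<in> P" "\<forall>t\<in>T. x t = act g y t" by (auto simp: agrees_def)
        have "(inv' g \<circ> x) t = y t" if "t \<in> T" for t
          using x(2) that T P_inv_apply[OF fP[OF \<open>g \<in> align y\<close>]] by (auto simp: act_def)
        then have "agrees T y" unfolding agrees_def using x(1) inv_P[OF fP[OF \<open>g \<in> align y\<close>]] comp_P by blast
        then show False using False by simp
      qed
      then show ?thesis using False 1 by (simp add: junta_0)
    next
      case True
      then have inj: "inj_on y T" "y ` T \<subseteq> V" using agrees_iff[OF T] by auto
      \<comment> \<open>A value taken at a point of \<open>uniq y\<close> is taken nowhere else in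
        \<open>V\<close>, so injectivity on \<open>T\<close> extends to the union and some member of
        \<open>Ext y\<close> agrees with \<open>y\<close> on \<open>T\<close> too.\<close>
      have "inj_on y (T \<union> uniq y)"
        using inj(1) T by (auto simp: inj_on_def uniq_def) (metis subsetD)+
      moreover have "y ` (T \<union> uniq y) \<subseteq> V" using inj(2) uniq_image by blast
      ultimately obtain x where x: "x \<in> P" "\<forall>t\<in>T \<union> uniq y. x t = y t"
        using extend_injection[of "T \<union> uniq y" y] T uniq_V by blast
      then have xE: "x \<in> Ext y" by (simp add: Ext_def)
      have "junta w T (act g y) = w (g \<circ> x)" if g: "g \<in> align y" for g
        by (rule junta_eq[OF w]) (use x fP[OF g] T comp_P in \<open>auto simp: act_def\<close>)
      then have "(\<Sum>g\<in>align y. junta w T (act g y)) = (\<Sum>g\<in>align y. w (g \<circ> x))" by simp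
      also have "\<dots> = (\<Sum>x\<in>Ext y. w x)" by (rule sum.reindex_bij_betw[OF Ext_align[OF xE]])
      finally have 2: "(\<Sum>g\<in>align y. junta w T (act g y)) = (\<Sum>x\<in>Ext y. w x)" .
      have 3: "card (align y) = card (Ext y)" by (rule bij_betw_same_card[OF Ext_align[OF xE]])
      show ?thesis unfolding 1 2 3 using True by (simp add: lift_def power2_eq_square)
    qed
  qed
  then show ?thesis
    by (subst sum_align_average[of "\<lambda>y. lift w y * junta w T y"]) (intro sum.cong refl, simp)
qed

lemma EE_junta_indep:
  assumes f: "\<And>y y'. (\<And>t. t \<in> T \<Longrightarrow> y t = y' t) \<Longrightarrow> f y = f y'" and R: "finite R" "R \<inter> T = {}"
  shows "ps.EE R f = f"
proof
  fix y
  have "f (\<lambda>i. if i \<in> R then z i else y i) = f y" for z by (rule f) (use R in auto)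
  moreover have "real (card (R \<rightarrow>\<^sub>E V)) = real m ^ card R" using R by (simp add: card_PiE)
  ultimately show "ps.EE R f y = f y" using m_pos by (simp add: ps.EE_explicit[OF R(1)])
qed

lemma lowdeg_junta:
  assumes f: "\<And>y y'. (\<And>t. t \<in> T \<Longrightarrow> y t = y' t) \<Longrightarrow> f y = f y'" and T: "T \<subseteq> V" "card T \<le> d"
  shows "ps.lowdeg d f = f"
proof -
  have finT: "finite T" using T finV finite_subset by auto
  have z: "ps.es_part R f = (\<lambda>_. 0)" if R: "R \<subseteq> V" "\<not> R \<subseteq> T" for R
  proof -
    obtain i where i: "i \<in> R" "i \<notin> T" using R by auto
    have finR: "finite R" using R finV finite_subset by auto
    have "ps.EE {i} f = f" by (rule EE_junta_indep[OF f]) (use i in auto)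
    then have "ps.D i f = (\<lambda>_. 0)" using ps.EE_insert[of "{}" i f] by (simp add: ps.D_def)
    moreover have "ps.DD R f = ps.DD R (ps.D i f)" using ps.DD_insert2[OF finR, of i f] i by (simp add: insert_absorb)
    ultimately have "ps.DD R f = (\<lambda>_. 0)" by (simp add: linop_zero[OF ps.linop_DD[OF finR]])
    then show ?thesis unfolding ps.es_part_def using finV by (simp add: linop_zero[OF ps.linop_EE])
  qed
  have "ps.lowdeg d f = (\<lambda>y. \<Sum>R\<in>Pow V. ps.es_part R f y)"
    unfolding ps.lowdeg_def
  proof (intro ext sum.mono_neutral_left)
    fix y
    show "\<forall>R\<in>Pow V - {R \<in> Pow V. card R \<le> d}. ps.es_part R f y = 0"
    proof
      fix R assume R: "R \<in> Pow V - {R \<in> Pow V. card R \<le> d}"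
      have "\<not> R \<subseteq> T" using R card_mono[OF finT, of R] T(2) by auto
      then show "ps.es_part R f y = 0" using z[of R] R by auto
    qed
  qed (use finV in auto)
  then show ?thesis using ps.Efron_Stein_sum[of f] by simp
qed

end

lemma fact_lower: "real n ^ t * fact n \<le> fact (n + t)"
proof (induction t)
  case (Suc t)
  have "real n ^ Suc t * fact n = real n * (real n ^ t * fact n)" by simp
  also have "\<dots> \<le> real (n + t + 1) * fact (n + t)" using Suc by (intro mult_mono) auto
  finally show ?case by simp
qed simp

lemma ratio_power_lower:
  assumes "2 * t \<le> n" "n > 0"
  shows "(1/9) ^ t \<le> (real (n - t) / real n) ^ n"
proof -
  have nt: "real (n - t) > 0" "real (n - t) = real n - real t" "real n \<le> 2 * real (n - t)" using assms by auto
  have "(real n / real (n - t)) ^ n = (1 + real t / real (n - t)) ^ n"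
    using nt by (simp add: field_simps)
  also have "\<dots> \<le> exp (real t / real (n - t)) ^ n"
    by (intro power_mono) (auto simp: exp_ge_add_one_self)
  also have "\<dots> = exp (real t * (real n / real (n - t)))" by (simp add: exp_of_nat_mult[symmetric] mult.commute)
  also have "\<dots> \<le> exp (real t * 2)"
  proof -
    have "real n / real (n - t) \<le> 2" using nt by (simp only: divide_le_eq) simp
    then show ?thesis using mult_left_mono[of "real n / real (n - t)" 2 "real t"] by simp
  qed
  also have "\<dots> = (exp 1 ^ 2) ^ t" by (simp add: exp_of_nat_mult[symmetric] power_mult[symmetric] mult.commute)
  also have "\<dots> \<le> (3 ^ 2) ^ t" by (intro power_mono exp_le) auto
  finally have "(real n / real (n - t)) ^ n \<le> 9 ^ t" by simp
  then have "1 / 9 ^ t \<le> 1 / (real n / real (n - t)) ^ n" using nt assms by (intro divide_left_mono) auto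
  then show ?thesis by (simp add: power_divide)
qed

context sym_lift
begin

text \<open>Given the values on \<open>T\<close>, which must form an injection into
  \<open>V\<close>, they are all unique exactly when the other \<open>m - card T\<close> coordinates
  avoid \<open>card T\<close> values.\<close>

lemma EE_kept:
  assumes T: "T \<subseteq> V"
  shows "ps.EE (V - T) (\<lambda>y. if T \<subseteq> uniq y then (junta w T y)\<^sup>2 else 0) y
     = (real (m - card T) / real m) ^ (m - card T) * (junta w T y)\<^sup>2"
proof -
  let ?k = "\<lambda>y. if T \<subseteq> uniq y then (junta w T y)\<^sup>2 else 0"
  let ?mg = "\<lambda>z i. if i \<in> V - T then z i else y i"
  have finT: "finite T" using T finV finite_subset by auto
  have cVT: "card (V - T) = m - card T" using T finT by (simp add: card_Diff_subset)
  have j: "junta w T (?mg z) = junta w T y" for z by (rule junta_cong) auto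
  have kT: "T \<subseteq> uniq (?mg z) \<longleftrightarrow> agrees T y \<and> z \<in> PiE (V - T) (\<lambda>_. V - y ` T)" if z: "z \<in> PiE (V - T) (\<lambda>_. V)" for z
  proof
    assume a: "T \<subseteq> uniq (?mg z)"
    have "inj_on (?mg z) T" using uniq_inj a inj_on_subset by blast
    then have "inj_on y T" by (simp add: inj_on_def)
    moreover have "y ` T \<subseteq> V" using a by (force simp: uniq_def)
    moreover have "z i \<notin> y ` T" if i: "i \<in> V - T" for i
    proof
      assume "z i \<in> y ` T"
      then obtain t where t: "t \<in> T" "z i = y t" by auto
      then have "t \<in> uniq (?mg z)" using a by auto
      then have "?mg z i \<noteq> ?mg z t" using i t unfolding uniq_def by auto
      then show False using i t by simp
    qed
    ultimately show "agrees T y \<and> z \<in> PiE (V - T) (\<lambda>_. V - y ` T)"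
      using z agrees_iff[OF T] by (auto simp: PiE_def Pi_def)
  next
    assume a: "agrees T y \<and> z \<in> PiE (V - T) (\<lambda>_. V - y ` T)"
    then have y: "inj_on y T" "y ` T \<subseteq> V" using agrees_iff[OF T] by auto
    show "T \<subseteq> uniq (?mg z)"
    proof
      fix t assume t: "t \<in> T"
      have "?mg z s \<noteq> ?mg z t" if "s \<in> V" "s \<noteq> t" for s
      proof (cases "s \<in> T")
        case True
        then show ?thesis using t that y(1) by (auto simp: inj_on_def)
      next
        case False
        then have "z s \<in> V - y ` T" using a that by (auto simp: PiE_def Pi_def)
        then show ?thesis using False t that by auto
      qed
      then show "t \<in> uniq (?mg z)" using t T y(2) by (auto simp: uniq_def)
    qed
  qed
  have "(\<Sum>z\<in>PiE (V - T) (\<lambda>_. V). ?k (?mg z)) = real (m - card T) ^ (m - card T) * (junta w T y)\<^sup>2"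
  proof (cases "agrees T y")
    case False
    then show ?thesis using kT by (simp add: junta_0)
  next
    case True
    then have y: "inj_on y T" "y ` T \<subseteq> V" using agrees_iff[OF T] by auto
    have "(\<Sum>z\<in>PiE (V - T) (\<lambda>_. V). ?k (?mg z)) = (\<Sum>z\<in>PiE (V - T) (\<lambda>_. V). if z \<in> PiE (V - T) (\<lambda>_. V - y ` T) then (junta w T y)\<^sup>2 else 0)"
    proof (intro sum.cong refl)
      fix z assume z: "z \<in> PiE (V - T) (\<lambda>_. V)"
      show "?k (?mg z) = (if z \<in> PiE (V - T) (\<lambda>_. V - y ` T) then (junta w T y)\<^sup>2 else 0)"
        unfolding j kT[OF z] using True by simp
    qed
    also have "\<dots> = (\<Sum>z\<in>PiE (V - T) (\<lambda>_. V - y ` T). (junta w T y)\<^sup>2)"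
      using finV by (intro sum.mono_neutral_cong_right finite_PiE) (auto simp: PiE_def Pi_def)
    also have "\<dots> = real (card (PiE (V - T) (\<lambda>_. V - y ` T))) * (junta w T y)\<^sup>2" by simp
    also have "card (PiE (V - T) (\<lambda>_. V - y ` T)) = (m - card T) ^ (m - card T)"
      using finV finT y by (simp add: card_PiE cVT card_Diff_subset card_image)
    finally show ?thesis by simp
  qed
  then show ?thesis using finV by (subst ps.EE_explicit) (simp_all add: cVT power_divide)
qed

lemma ex_junta:
  assumes T: "T \<subseteq> V" and w: "semi_inv (\<lambda>_. 1) T w"
  shows "ps.ex (\<lambda>y. (junta w T y)\<^sup>2) = ip P w w / (fact (m - card T) * real m ^ card T)"
proof -
  let ?f = "\<lambda>y. (junta w T y)\<^sup>2"
  have finT: "finite T" using T finV finite_subset by auto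
  have f: "?f y = ?f y'" if "\<And>t. t \<in> T \<Longrightarrow> y t = y' t" for y y' using junta_cong[of T y y' w] that by simp
  have "ps.ex ?f = ps.EE T (ps.EE (V - T) ?f) (\<lambda>_. undefined)"
    unfolding ps.ex_def using T finT finV by (simp add: ps.EE_Un Un_absorb1 Un_Diff_cancel)
  also have "ps.EE (V - T) ?f = ?f" by (rule EE_junta_indep[OF f]) (use finV in auto)
  also have "ps.EE T ?f (\<lambda>_. undefined) = (\<Sum>a\<in>PiE T (\<lambda>_. V). ?f a) / real m ^ card T"
    unfolding ps.EE_explicit[OF finT] by (intro arg_cong2[where f="(/)"] refl sum.cong f) auto
  also have "(\<Sum>a\<in>PiE T (\<lambda>_. V). ?f a) = ip P w w / fact (m - card T)"
  proof -
    have "ip P w w = (\<Sum>x\<in>P. (w x)\<^sup>2)" by (simp add: ip_def power2_eq_square)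
    also have "\<dots> = (\<Sum>a\<in>PiE T (\<lambda>_. V). \<Sum>x\<in>{x \<in> P. restrict x T = a}. (w x)\<^sup>2)"
      using finT finV T P_apply by (intro sum.group[symmetric] finP finite_PiE) (auto simp: PiE_def Pi_def)
    also have "\<dots> = (\<Sum>a\<in>PiE T (\<lambda>_. V). fact (m - card T) * ?f a)"
    proof (intro sum.cong refl)
      fix a assume a: "a \<in> PiE T (\<lambda>_. V)"
      have S: "{x \<in> P. restrict x T = a} = {x \<in> P. \<forall>t\<in>T. x t = a t}"
        using a by (auto simp: PiE_def extensional_def fun_eq_iff restrict_def)
      show "(\<Sum>x\<in>{x \<in> P. restrict x T = a}. (w x)\<^sup>2) = fact (m - card T) * ?f a"
      proof (cases "agrees T a")
        case True
        then obtain x where x: "x \<in> P" "\<forall>t\<in>T. x t = a t" by (auto simp: agrees_def)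
        then have "{x \<in> P. \<forall>t\<in>T. x t = a t} = Cyl x T" by (auto simp: Cyl_def)
        moreover have "card (Cyl x T) = fact (m - card T)"
          using bij_betw_same_card[OF Cyl_bij[OF x(1), of T]] cardStab[OF T] by simp
        moreover have "(\<Sum>x\<in>{x \<in> P. \<forall>t\<in>T. x t = a t}. (w x)\<^sup>2) = (\<Sum>x\<in>{x \<in> P. \<forall>t\<in>T. x t = a t}. ?f a)"
          using junta_eq[OF w] by (intro sum.cong refl) auto
        ultimately show ?thesis unfolding S by simp
      next
        case False
        then have e: "{x \<in> P. \<forall>t\<in>T. x t = a t} = {}" by (auto simp: agrees_def)
        show ?thesis unfolding S e by (simp add: junta_0[OF False])
      qed
    qed
    finally show ?thesis by (simp add: sum_distrib_left[symmetric])
  qed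
  finally show ?thesis by simp
qed

text \<open>Test the lift against the junta \<open>?g\<close>, which has degree at most
  \<open>d\<close>, so that only the low-degree part of the lift is seen. By
  \<open>lift_junta_correlation\<close> the correlation is the mean of the squared lift where
  \<open>y\<close> agrees on \<open>T\<close>, which is at least \<theta> times the squared norm of
  \<open>?g\<close>, since the lift equals \<open>?g\<close> where all values on \<open>T\<close>
  are unique. Cauchy--Schwarz turns this into a lower bound for the truncated lift.\<close>

lemma junta_low_degree:
  assumes T: "T \<subseteq> V" "card T \<le> d" "2 * d \<le> m" and w: "semi_inv (\<lambda>_. 1) T w"
  shows "ip P w w / (81 ^ d * fact m) \<le> ps.ex (\<lambda>y. (ps.lowdeg d (lift w) y)\<^sup>2)"
proof -
  let ?g = "junta w T" and ?t = "card T"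
  define \<theta> where "\<theta> = (real (m - ?t) / real m) ^ (m - ?t)"
  have th0: "\<theta> \<ge> 0" by (simp add: \<theta>_def)
  have finT: "finite T" using T finV finite_subset by auto
  have kept: "ps.ex (\<lambda>y. if T \<subseteq> uniq y then (?g y)\<^sup>2 else 0) = \<theta> * ps.ex (\<lambda>y. (?g y)\<^sup>2)"
  proof -
    have "ps.ex (\<lambda>y. if T \<subseteq> uniq y then (?g y)\<^sup>2 else 0) = ps.ex (ps.EE (V - T) (\<lambda>y. if T \<subseteq> uniq y then (?g y)\<^sup>2 else 0))"
      by (rule ps.ex_EE[symmetric]) auto
    also have "ps.EE (V - T) (\<lambda>y. if T \<subseteq> uniq y then (?g y)\<^sup>2 else 0) = (\<lambda>y. \<theta> * (?g y)\<^sup>2)"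
      unfolding \<theta>_def by (rule ext) (rule EE_kept[OF T(1)])
    finally show ?thesis by (simp add: ps.ex_scale)
  qed
  have "\<theta> * ps.ex (\<lambda>y. (?g y)\<^sup>2) \<le> ps.ex (\<lambda>y. lift w y * ?g y)"
  proof -
    have "(\<Sum>y\<in>X. if T \<subseteq> uniq y then (?g y)\<^sup>2 else 0) \<le> (\<Sum>y\<in>X. if agrees T y then (lift w y)\<^sup>2 else 0)"
    proof (intro sum_mono)
      fix y
      have "agrees T y" if "T \<subseteq> uniq y"
        using that uniq_inj[of y] uniq_image[of y] by (auto simp: agrees_iff[OF T(1)] intro: inj_on_subset)
      then show "(if T \<subseteq> uniq y then (?g y)\<^sup>2 else 0) \<le> (if agrees T y then (lift w y)\<^sup>2 else 0)"
        using lift_eq_junta[OF w] by auto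
    qed
    also have "\<dots> = (\<Sum>y\<in>X. lift w y * ?g y)" by (rule lift_junta_correlation[OF w T(1), symmetric])
    finally show ?thesis unfolding kept[symmetric] unfolding ex_sum_X by (simp add: divide_right_mono)
  qed
  also have "\<dots> = ps.ex (\<lambda>y. ps.lowdeg d (lift w) y * ?g y)"
  proof -
    have "ps.lowdeg d ?g = ?g" by (rule lowdeg_junta[OF junta_cong T(1,2)])
    then show ?thesis using ps.ex_lowdeg[of d "lift w" ?g] by simp
  qed
  finally have 1: "\<theta> * ps.ex (\<lambda>y. (?g y)\<^sup>2) \<le> ps.ex (\<lambda>y. ps.lowdeg d (lift w) y * ?g y)" .
  let ?W = "ps.ex (\<lambda>y. (ps.lowdeg d (lift w) y)\<^sup>2)" and ?G = "ps.ex (\<lambda>y. (?g y)\<^sup>2)"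
  have G0: "?G \<ge> 0" by (rule ps.ex_nonneg) simp
  have W0: "?W \<ge> 0" by (rule ps.ex_nonneg) simp
  have "(\<theta> * ?G)\<^sup>2 \<le> (ps.ex (\<lambda>y. ps.lowdeg d (lift w) y * ?g y))\<^sup>2" using th0 G0 1 by (intro power_mono) auto
  also have "\<dots> \<le> ?W * ?G" by (rule ps.ex_Cauchy_Schwarz)
  finally have "(\<theta>\<^sup>2 * ?G) * ?G \<le> ?W * ?G" by (simp add: power2_eq_square algebra_simps)
  then have 2: "\<theta>\<^sup>2 * ?G \<le> ?W" using G0 W0 by (cases "?G = 0") auto
  have "ip P w w / (81 ^ d * fact m) \<le> \<theta>\<^sup>2 * ?G"
  proof -
    have t2: "2 * ?t \<le> m" using T by linarith
    let ?q = "real (m - ?t) / real m"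
    have q: "0 \<le> ?q" "?q \<le> 1" using m_pos by auto
    \<comment> \<open>The constant is \<open>9\<^sup>2\<close>, because \<theta> enters squared; the
      exponent \<open>2 * m\<close> leaves room for the further factor \<open>?q ^ ?t\<close>, which
      compares the normalisations of the two spaces.\<close>
    have "(1/81::real) ^ d \<le> (1/81) ^ ?t" using T by (intro power_decreasing) auto
    also have "\<dots> = ((1/9) ^ ?t)\<^sup>2" by (simp add: power_divide power2_eq_square power_mult_distrib[symmetric])
    also have "\<dots> \<le> (?q ^ m)\<^sup>2" using ratio_power_lower[OF t2] m_pos by (intro power_mono) auto
    also have "\<dots> = ?q ^ (2 * m)" by (simp add: power_mult[symmetric] mult.commute)
    also have "\<dots> \<le> ?q ^ (2 * (m - ?t) + ?t)" using q t2 by (intro power_decreasing) auto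
    also have "\<dots> = \<theta>\<^sup>2 * ?q ^ ?t" unfolding \<theta>_def power_add power_mult[symmetric] by (simp add: mult.commute)
    finally have 3: "(1/81) ^ d \<le> \<theta>\<^sup>2 * ?q ^ ?t" .
    have "real (m - ?t) ^ ?t * fact (m - ?t) \<le> fact m" using fact_lower[of "m - ?t" ?t] t2 by simp
    then have "?q ^ ?t \<le> fact m / (fact (m - ?t) * real m ^ ?t)"
      using m_pos by (simp add: power_divide divide_simps mult.commute)
    then have "\<theta>\<^sup>2 * ?q ^ ?t \<le> \<theta>\<^sup>2 * (fact m / (fact (m - ?t) * real m ^ ?t))" by (intro mult_left_mono) auto
    with 3 have "(1/81) ^ d \<le> \<theta>\<^sup>2 * (fact m / (fact (m - ?t) * real m ^ ?t))" by linarith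
    then have "(1/81) ^ d * (ip P w w / fact m) \<le> \<theta>\<^sup>2 * (fact m / (fact (m - ?t) * real m ^ ?t)) * (ip P w w / fact m)"
      by (intro mult_right_mono) (auto simp: ip_nonneg)
    also have "\<dots> = \<theta>\<^sup>2 * ?G" unfolding ex_junta[OF T(1) w] by simp
    finally show ?thesis by (simp add: power_divide)
  qed
  with 2 show ?thesis by linarith
qed

section \<open>Equivariance of the truncation under permuting coordinates\<close>

lemma undefined_comp: "(\<lambda>_. undefined) \<circ> \<sigma> = (\<lambda>_. undefined)" by (simp add: fun_eq_iff)

lemma E_right: assumes s: "\<sigma> \<in> P" shows "ps.E i (\<lambda>y. h (y \<circ> \<sigma>)) = (\<lambda>y. ps.E (inv' \<sigma> i) h (y \<circ> \<sigma>))"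
proof -
  have *: "(y(i := z)) \<circ> \<sigma> = (y \<circ> \<sigma>)(inv' \<sigma> i := z)" for y z
  proof
    fix j
    have "\<sigma> j = i \<longleftrightarrow> j = inv' \<sigma> i" using P_inv_apply[OF s] by metis
    then show "((y(i := z)) \<circ> \<sigma>) j = ((y \<circ> \<sigma>)(inv' \<sigma> i := z)) j" by simp
  qed
  show ?thesis unfolding ps.E_def * ..
qed

lemma EE_right: assumes s: "\<sigma> \<in> P" and "finite S"
  shows "ps.EE S (\<lambda>y. h (y \<circ> \<sigma>)) = (\<lambda>y. ps.EE (inv' \<sigma> ` S) h (y \<circ> \<sigma>))"
  using assms(2)
proof (induction S rule: finite_induct)
  case (insert x F)
  have "ps.EE (insert x F) (\<lambda>y. h (y \<circ> \<sigma>)) = ps.E x (\<lambda>y. ps.EE (inv' \<sigma> ` F) h (y \<circ> \<sigma>))"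
    unfolding ps.EE_insert[OF insert(1)] insert.IH ..
  also have "\<dots> = (\<lambda>y. ps.E (inv' \<sigma> x) (ps.EE (inv' \<sigma> ` F) h) (y \<circ> \<sigma>))" by (rule E_right[OF s])
  finally show ?case unfolding image_insert ps.EE_insert[OF finite_imageI[OF insert(1)]] .
qed simp

lemma D_right: assumes s: "\<sigma> \<in> P" shows "ps.D i (\<lambda>y. h (y \<circ> \<sigma>)) = (\<lambda>y. ps.D (inv' \<sigma> i) h (y \<circ> \<sigma>))"
  unfolding ps.D_def E_right[OF s] ..

lemma DD_right: assumes s: "\<sigma> \<in> P" and "finite S"
  shows "ps.DD S (\<lambda>y. h (y \<circ> \<sigma>)) = (\<lambda>y. ps.DD (inv' \<sigma> ` S) h (y \<circ> \<sigma>))"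
  using assms(2)
proof (induction S rule: finite_induct)
  case (insert x F)
  have "ps.DD (insert x F) (\<lambda>y. h (y \<circ> \<sigma>)) = ps.D x (\<lambda>y. ps.DD (inv' \<sigma> ` F) h (y \<circ> \<sigma>))"
    unfolding ps.DD_insert[OF insert(1)] insert.IH ..
  also have "\<dots> = (\<lambda>y. ps.D (inv' \<sigma> x) (ps.DD (inv' \<sigma> ` F) h) (y \<circ> \<sigma>))" by (rule D_right[OF s])
  finally show ?case unfolding image_insert ps.DD_insert[OF finite_imageI[OF insert(1)]] .
qed simp

lemma lowdeg_right: assumes s: "\<sigma> \<in> P"
  shows "ps.lowdeg d (\<lambda>y. h (y \<circ> \<sigma>)) = (\<lambda>y. ps.lowdeg d h (y \<circ> \<sigma>))"
proof
  fix y
  have isP: "inv' \<sigma> \<in> P" using inv_P[OF s] .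
  have imV: "inv' \<sigma> ` V = V" using isP unfolding P_def by (simp add: permutes_image)
  have inj: "inj_on (inv' \<sigma>) S" for S using P_inj[OF isP] by (simp add: inj_on_def)
  have part: "ps.es_part R (\<lambda>y. h (y \<circ> \<sigma>)) y = ps.es_part (inv' \<sigma> ` R) h (y \<circ> \<sigma>)" if "R \<subseteq> V" for R
  proof -
    have fin: "finite R" "finite (V - R)" using that finV finite_subset by auto
    have "inv' \<sigma> ` (V - R) = V - inv' \<sigma> ` R" using imV inj[of UNIV] by (simp add: image_set_diff)
    then show ?thesis unfolding ps.es_part_def
      by (simp add: DD_right[OF s fin(1)] EE_right[OF s fin(2), of "ps.DD (inv' \<sigma> ` R) h"])
  qed
  have b: "bij_betw (\<lambda>R. inv' \<sigma> ` R) {R \<in> Pow V. card R \<le> d} {R \<in> Pow V. card R \<le> d}"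
  proof (rule bij_betw_byWitness[where f' = "\<lambda>R. \<sigma> ` R"])
    have sV: "\<sigma> ` V = V" using s unfolding P_def by (simp add: permutes_image)
    have inj': "inj_on \<sigma> S" for S using P_inj[OF s] by (simp add: inj_on_def)
    show "\<forall>R\<in>{R \<in> Pow V. card R \<le> d}. \<sigma> ` inv' \<sigma> ` R = R" "\<forall>R\<in>{R \<in> Pow V. card R \<le> d}. inv' \<sigma> ` \<sigma> ` R = R"
      using P_inv_apply[OF s] by (auto simp: image_image)
    show "(\<lambda>R. inv' \<sigma> ` R) ` {R \<in> Pow V. card R \<le> d} \<subseteq> {R \<in> Pow V. card R \<le> d}"
      using imV inj by (auto simp: card_image)
    show "(\<lambda>R. \<sigma> ` R) ` {R \<in> Pow V. card R \<le> d} \<subseteq> {R \<in> Pow V. card R \<le> d}"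
      using sV inj' by (auto simp: card_image)
  qed
  have "ps.lowdeg d (\<lambda>y. h (y \<circ> \<sigma>)) y = (\<Sum>R\<in>{R \<in> Pow V. card R \<le> d}. ps.es_part (inv' \<sigma> ` R) h (y \<circ> \<sigma>))"
    unfolding ps.lowdeg_def by (intro sum.cong refl part) auto
  also have "\<dots> = ps.lowdeg d h (y \<circ> \<sigma>)"
    unfolding ps.lowdeg_def by (rule sum.reindex_bij_betw[OF b])
  finally show "ps.lowdeg d (\<lambda>y. h (y \<circ> \<sigma>)) y = ps.lowdeg d h (y \<circ> \<sigma>)" .
qed

lemma ex_right: assumes s: "\<sigma> \<in> P" shows "ps.ex (\<lambda>y. h (y \<circ> \<sigma>)) = ps.ex h"
proof -
  have "inv' \<sigma> ` V = V" using inv_P[OF s] unfolding P_def by (simp add: permutes_image)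
  then show ?thesis unfolding ps.ex_def EE_right[OF s finV] by (simp add: undefined_comp)
qed

end

section \<open>The low-degree part\<close>

context sym_space
begin

definition High1 where "High1 d = perp P (Cyls (\<lambda>_. 1) d)"
definition Low where "Low d = perp P (High1 d)"

lemma High1_iff: "h \<in> High1 d \<longleftrightarrow>
   (\<forall>x T. x \<in> P \<longrightarrow> T \<subseteq> V \<longrightarrow> card T \<le> d \<longrightarrow> (\<Sum>\<rho>\<in>Stab T. h (x \<circ> \<rho>)) = 0)"
  unfolding High1_def perp_Cyls using sum_Cyl[of _ h] by auto

lemma rt_High1: "\<sigma> \<in> P \<Longrightarrow> h \<in> High1 d \<Longrightarrow> rt \<sigma> h \<in> High1 d"
  unfolding High1_def by (rule rt_perp_Cyls[OF character_one])

lemma rt_Low: "\<sigma> \<in> P \<Longrightarrow> p \<in> Low d \<Longrightarrow> rt \<sigma> p \<in> Low d"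
  unfolding Low_def perp_def
  using rt_High1[of "inv' \<sigma>" _ d] by (auto simp: ip_commute[of P _ "rt \<sigma> p"] ip_rt_left inv_P ip_commute[of P p])

lemma Low_High1: "p \<in> Low d \<Longrightarrow> h \<in> High1 d \<Longrightarrow> ip P p h = 0"
  by (simp add: Low_def perp_def ip_commute)

lemma Low_decomposition: "\<exists>p h. f = (\<lambda>x. p x + h x) \<and> p \<in> Low d \<and> h \<in> High1 d"
  unfolding Low_def High1_def by (rule orthogonal_decomposition[OF finP finite_Cyls])

text \<open>A right-invariant kernel commutes with averaging over right translations by
  \<open>Stab T\<close>, so it maps \<open>High1 d\<close> to itself.\<close>

lemma invariant_form_cross:
  assumes K: "right_invariant K" and p: "p \<in> Low d" and h: "h \<in> High1 d"
  shows "qform P K p h = 0"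
proof -
  have "(\<lambda>x. \<Sum>y\<in>P. K x y * h y) \<in> High1 d"
    unfolding High1_iff
  proof (intro allI impI)
    fix x T assume x: "x \<in> P" and T: "T \<subseteq> V" "card T \<le> d"
    have "(\<Sum>\<rho>\<in>Stab T. \<Sum>y\<in>P. K (x \<circ> \<rho>) y * h y) = (\<Sum>\<rho>\<in>Stab T. \<Sum>y\<in>P. K x y * h (y \<circ> \<rho>))"
    proof (rule sum.cong[OF refl])
      fix \<rho> assume "\<rho> \<in> Stab T"
      then have r: "\<rho> \<in> P" using Stab_subset by auto
      have "(\<Sum>y\<in>P. K (x \<circ> \<rho>) y * h y) = (\<Sum>y\<in>P. K (x \<circ> \<rho>) (y \<circ> \<rho>) * h (y \<circ> \<rho>))"
        using sum_right[OF r, of "\<lambda>y. K (x \<circ> \<rho>) y * h y"] by (rule sym)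
      also have "\<dots> = (\<Sum>y\<in>P. K x y * h (y \<circ> \<rho>))"
        using K r x by (intro sum.cong refl) (simp add: right_invariant_def)
      finally show "(\<Sum>y\<in>P. K (x \<circ> \<rho>) y * h y) = (\<Sum>y\<in>P. K x y * h (y \<circ> \<rho>))" .
    qed
    also have "\<dots> = (\<Sum>y\<in>P. K x y * (\<Sum>\<rho>\<in>Stab T. h (y \<circ> \<rho>)))"
      by (subst sum.swap) (simp add: sum_distrib_left)
    also have "\<dots> = 0" using h T by (intro sum.neutral) (simp add: High1_iff)
    finally show "(\<Sum>\<rho>\<in>Stab T. \<Sum>y\<in>P. K (x \<circ> \<rho>) y * h y) = 0" .
  qed
  then show ?thesis unfolding qform_ip by (rule Low_High1[OF p])
qed

lemma Low_0_norm:
  assumes f: "f = (\<lambda>x. p x + h x)" "p \<in> Low 0" "h \<in> High1 0"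
  shows "ip P p p = (\<Sum>x\<in>P. f x)\<^sup>2 / fact m"
proof -
  have StE: "Stab {} = P" by (auto simp: Stab_iff)
  have h0: "(\<Sum>x\<in>P. h x) = 0"
  proof -
    have "(\<Sum>\<rho>\<in>Stab {}. h (id \<circ> \<rho>)) = 0" using f(3)[unfolded High1_iff, rule_format, of id "{}"] by simp
    then show ?thesis unfolding StE by simp
  qed
  define c where "c = (\<Sum>x\<in>P. p x) / fact m"
  have "(\<lambda>x. p x - c) \<in> High1 0"
    unfolding High1_iff
  proof (intro allI impI)
    fix x T assume x: "x \<in> P" and T: "T \<subseteq> V" "card T \<le> 0"
    have "T = {}" using T finV finite_subset[of T V] by auto
    then have "(\<Sum>\<rho>\<in>Stab T. p (x \<circ> \<rho>) - c) = (\<Sum>\<rho>\<in>P. p \<rho>) - fact m * c"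
      using sum_left[OF x, of p] by (simp add: StE sum_subtractf cardP)
    then show "(\<Sum>\<rho>\<in>Stab T. p (x \<circ> \<rho>) - c) = 0" by (simp add: c_def)
  qed
  then have "ip P p (\<lambda>x. p x - c) = 0" by (rule Low_High1[OF f(2)])
  then have "ip P p p = c * (\<Sum>x\<in>P. p x)"
    unfolding ip_diff_right by (simp add: ip_def sum_distrib_left mult.commute)
  moreover have "(\<Sum>x\<in>P. f x) = (\<Sum>x\<in>P. p x)" by (simp add: f(1) sum.distrib h0)
  ultimately show ?thesis by (simp add: c_def power2_eq_square)
qed

end

section \<open>The quadratic form of the truncated lift\<close>

context sym_lift
begin

definition delta :: "('a \<Rightarrow> 'a) \<Rightarrow> ('a \<Rightarrow> 'a) \<Rightarrow> real" where "delta x = (\<lambda>z. if z = x then 1 else 0)"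
definition lift_form where "lift_form d v w = ps.ex (\<lambda>y. ps.lowdeg d (lift v) y * ps.lowdeg d (lift w) y)"
text \<open>The matrix of \<open>lift_form d\<close> in the basis of point masses, which makes
  \<open>top_eigenvector\<close> applicable.\<close>

definition lift_kernel where "lift_kernel d x x' = lift_form d (delta x) (delta x')"

lemma lift_form_nonneg: "lift_form d v v \<ge> 0" unfolding lift_form_def by (rule ps.ex_nonneg) simp

lemma linop_lowdeg: "linop (ps.lowdeg d)"
  unfolding linop_def ps.lowdeg_def
  using linop_add[OF ps.linop_es_part] linop_scale[OF ps.linop_es_part]
  by (auto simp: fun_eq_iff sum.distrib sum_distrib_left intro!: sum.cong)

lemma lowdeg_lift_sum: "ps.lowdeg d (lift v) = (\<lambda>y. \<Sum>x\<in>P. v x * ps.lowdeg d (lift (delta x)) y)"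
proof -
  have "lift v = (\<lambda>y. \<Sum>x\<in>P. v x * lift (delta x) y)"
  proof
    fix y
    have "lift v y = lift (\<lambda>z. \<Sum>x\<in>P. v x * delta x z) y"
      using finP by (intro lift_cong_P) (simp add: delta_def if_distrib[where f = "\<lambda>t. v _ * t"] cong: if_cong)
    then show "lift v y = (\<Sum>x\<in>P. v x * lift (delta x) y)" by (simp only: lift_sum lift_scale)
  qed
  then show ?thesis by (simp only: linop_sum[OF linop_lowdeg] linop_scale[OF linop_lowdeg])
qed

lemma lift_form_qform: "lift_form d v w = qform P (lift_kernel d) v w"
proof -
  let ?a = "\<lambda>x. ps.lowdeg d (lift (delta x))"
  have "lift_form d v w = ps.ex (\<lambda>y. \<Sum>x\<in>P. \<Sum>x'\<in>P. (v x * w x') * (?a x y * ?a x' y))"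
    unfolding lift_form_def lowdeg_lift_sum[of d v] lowdeg_lift_sum[of d w]
    by (simp only: sum_product mult.assoc mult.left_commute)
  also have "\<dots> = (\<Sum>x\<in>P. \<Sum>x'\<in>P. (v x * w x') * lift_form d (delta x) (delta x'))"
    unfolding lift_form_def by (simp only: ps.ex_sum ps.ex_scale)
  finally show ?thesis unfolding qform_def lift_kernel_def by (simp add: mult_ac)
qed

lemma lift_form_rt: assumes s: "\<sigma> \<in> P" shows "lift_form d (rt \<sigma> v) (rt \<sigma> w) = lift_form d v w"
proof -
  have l: "lift (rt \<sigma> u) = (\<lambda>y. lift u (y \<circ> \<sigma>))" for u by (rule ext) (rule lift_right[OF s])
  show ?thesis unfolding lift_form_def l lowdeg_right[OF s]
    by (rule ex_right[OF s, of "\<lambda>y. ps.lowdeg d (lift v) y * ps.lowdeg d (lift w) y"])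
qed

lemma lift_kernel_right_invariant: "right_invariant (lift_kernel d)"
  unfolding right_invariant_def
proof (intro ballI)
  fix \<sigma> x y assume s: "\<sigma> \<in> P"
  have e: "delta (x \<circ> \<sigma>) = rt (inv' \<sigma>) (delta x)" for x
  proof
    fix z
    have "z = x \<circ> \<sigma> \<longleftrightarrow> z \<circ> inv' \<sigma> = x" using inv_cancel(3,4)[OF s] by metis
    then show "delta (x \<circ> \<sigma>) z = rt (inv' \<sigma>) (delta x) z" unfolding delta_def rt_def by simp
  qed
  show "lift_kernel d (x \<circ> \<sigma>) (y \<circ> \<sigma>) = lift_kernel d x y" unfolding lift_kernel_def e by (rule lift_form_rt[OF inv_P[OF s]])
qed

lemma lift_kernel_sym: "lift_kernel d x y = lift_kernel d y x" unfolding lift_kernel_def lift_form_def by (simp only: mult.commute)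

text \<open>An eigenvector for the least eigenvalue can be averaged to one that depends on at most \<open>d\<close> values of the
  permutation, and for such a vector the bound is \<open>junta_low_degree\<close>.\<close>

lemma Low_form_bound:
  assumes d: "2 * d \<le> m" and p: "p \<in> Low d"
  shows "ip P p p / (81 ^ d * fact m) \<le> lift_form d p p"
proof (cases "ip P p p = 0")
  case True
  then show ?thesis using lift_form_nonneg by simp
next
  case False
  \<comment> \<open>The sign is reversed because \<open>top_eigenvector\<close> maximises, whereas
    the least value of the form is wanted.\<close>
  define K where "K = (\<lambda>x y. - lift_kernel d x y)"
  have K: "qform P K v w = - lift_form d v w" for v w
    unfolding lift_form_qform by (simp add: K_def qform_def sum_negf)
  have K_inv: "right_invariant K" using lift_kernel_right_invariant[of d] by (simp add: K_def right_invariant_def)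
  have K_sym: "K x y = K y x" for x y using lift_kernel_sym by (simp add: K_def)
  have pp: "ip P p p > 0" using False ip_nonneg[of P p] by linarith
  obtain v \<mu> where v: "v \<in> Low d" "ip P v v = 1"
    and ev: "\<forall>w\<in>Low d. qform P K v w = \<mu> * ip P v w"
    and top: "\<forall>w\<in>Low d. qform P K w w \<le> \<mu> * ip P w w"
    using top_eigenvector[of P K, OF finP K_sym p[unfolded Low_def] pp] unfolding Low_def[symmetric] by blast
  define Es where "Es = {v \<in> Low d. \<forall>w\<in>Low d. qform P K v w = \<mu> * ip P v w}"
  have Es: "right_subspace Es"
    unfolding Es_def Low_def by (rule eigenspace_right_subspace[OF K_inv]) (rule rt_Low[unfolded Low_def])
  have vE: "v \<in> Es" using v ev by (simp add: Es_def)
  \<comment> \<open>A unit vector of \<open>Low d\<close> is not orthogonal to itself, so some coset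
    sum of \<open>v\<close> is nonzero; averaging over that stabiliser then gives a nonzero vector
    of the same eigenspace.\<close>
  have "v \<notin> High1 d" using Low_High1[OF v(1), of v] v(2) by auto
  then obtain x T where x: "x \<in> P" and T: "T \<subseteq> V" "card T \<le> d" and ne: "(\<Sum>\<rho>\<in>Stab T. v (x \<circ> \<rho>)) \<noteq> 0"
    unfolding High1_iff by blast
  define w where "w = (\<lambda>x. \<Sum>\<rho>\<in>Stab T. 1 * v (x \<circ> \<rho>))"
  have w_inv: "semi_inv (\<lambda>_. 1) T w" unfolding w_def by (rule semi_inv_average[OF character_one])
  have wE: "w \<in> Es"
  proof -
    have "(\<lambda>x. \<Sum>\<rho>\<in>Stab T. rt \<rho> v x) \<in> Es"
      using Stab_subset by (intro right_subspace_sum[OF Es vE] right_subspace_rt[OF Es vE]) auto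
    then show ?thesis by (simp add: w_def rt_def)
  qed
  have "ip P w w \<noteq> 0" unfolding ip_self_eq_0[OF finP] using x ne by (auto simp: w_def)
  then have ww: "ip P w w > 0" using ip_nonneg[of P w] by linarith
  have "- lift_form d w w = \<mu> * ip P w w" using wE by (simp add: Es_def K)
  moreover have "ip P w w / (81 ^ d * fact m) \<le> lift_form d w w"
    using junta_low_degree[OF T d w_inv] by (simp add: lift_form_def power2_eq_square)
  ultimately have "1 / (81 ^ d * fact m) * ip P w w \<le> (- \<mu>) * ip P w w" by simp
  then have mu: "1 / (81 ^ d * fact m) \<le> - \<mu>" by (rule mult_right_le_imp_le[OF _ ww])
  have "ip P p p / (81 ^ d * fact m) \<le> (- \<mu>) * ip P p p"
    using mult_right_mono[OF mu, of "ip P p p"] pp by simp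
  also have "\<dots> \<le> lift_form d p p" using top[rule_format, OF p] by (simp add: K)
  finally show ?thesis .
qed

text \<open>The form has no cross term between \<open>p\<close> and \<open>h\<close>, so its value
  at \<open>p\<close> is at most its value at \<open>f\<close>, which
  \<open>level_inequality\<close> bounds. The loss \<open>81 ^ d\<close> from
  \<open>Low_form_bound\<close> is cubed.\<close>

theorem low_part_bound:
  assumes F: "F \<subseteq> P" "is_global F r \<phi>" and r: "r \<ge> 1" and phi: "\<phi> \<ge> 0" and d: "2 * d \<le> m"
    and f: "f = (\<lambda>x. p x + h x)" "p \<in> Low d" "h \<in> High1 d"
    and fF: "\<And>x. x \<in> P \<Longrightarrow> \<bar>f x\<bar> \<le> (if x \<in> F then 1 else 0)"
  shows "(ip P p p / fact m) ^ 3 \<le> \<phi> ^ 4 * (81 ^ 3 * 80 * r) ^ d"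
proof -
  have "lift_form d p p \<le> lift_form d f f"
  proof -
    have "lift_form d p h = 0" unfolding lift_form_qform by (rule invariant_form_cross[OF lift_kernel_right_invariant f(2,3)])
    then have "lift_form d f f = lift_form d p p + lift_form d h h"
      unfolding f(1) lift_form_qform qform_add_left qform_add_right using qform_sym[of P "lift_kernel d" h p, OF lift_kernel_sym] by simp
    then show ?thesis using lift_form_nonneg by simp
  qed
  then have "ip P p p / (81 ^ d * fact m) \<le> lift_form d f f"
    using Low_form_bound[OF d f(2)] by (rule order_trans[rotated])
  then have 1: "ip P p p / fact m \<le> 81 ^ d * lift_form d f f"
    by (simp add: divide_simps mult_ac)
  have 2: "(lift_form d f f) ^ 3 \<le> \<phi> ^ 4 * (80 * r) ^ d"
    unfolding lift_form_def power2_eq_square[symmetric]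
  proof (rule ps.level_inequality[where F = "lift (\<lambda>x. if x \<in> F then 1 else 0)"])
    fix y
    show "\<bar>lift f y\<bar> \<le> lift (\<lambda>x. if x \<in> F then 1 else 0) y"
      by (rule order_trans[OF lift_abs lift_mono[OF fF]])
    have "lift (\<lambda>x. if x \<in> F then 1 else 0) y \<le> lift (\<lambda>_. 1) y" by (rule lift_mono) simp
    then show "lift (\<lambda>x. if x \<in> F then 1 else 0) y \<le> 1" by (simp only: lift_const)
  next
    fix R y assume "R \<subseteq> V"
    then show "ps.EE (V - R) (lift (\<lambda>x. if x \<in> F then 1 else 0)) y \<le> r ^ card R * \<phi>"
      by (rule lift_global[OF F r phi])
  qed (use r phi in auto)
  have "(ip P p p / fact m) ^ 3 \<le> (81 ^ d * lift_form d f f) ^ 3"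
    using 1 ip_nonneg[of P p] by (intro power_mono) auto
  also have "\<dots> = (81 ^ 3) ^ d * (lift_form d f f) ^ 3"
    by (simp only: power_mult_distrib power_mult[symmetric] mult.commute)
  also have "\<dots> \<le> (81 ^ 3) ^ d * (\<phi> ^ 4 * (80 * r) ^ d)" using 2 by (intro mult_left_mono) auto
  also have "\<dots> = \<phi> ^ 4 * (81 ^ 3 * 80 * r) ^ d" by (simp only: power_mult_distrib mult_ac)
  finally show ?thesis .
qed

end

section \<open>Growth of global sets\<close>

context sym_space
begin

abbreviation sg :: "('a \<Rightarrow> 'a) \<Rightarrow> real" where "sg x \<equiv> real_of_int (sign x)"

lemma sg_square: "sg x * (sg x * c) = c" by (simp add: sign_def)

text \<open>A transposition of two points outside \<open>T \<union> T'\<close> flips the sign and fixes both cylinders.\<close>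

lemma sign_cylfun_High1:
  assumes T: "T \<subseteq> V" "card T \<le> d" and d: "2 * d + 2 \<le> m" and z: "z \<in> P"
  shows "(\<lambda>y. sg y * cylfun (\<lambda>_. 1) z T y) \<in> High1 d"
  unfolding High1_iff
proof (intro allI impI)
  fix x T' assume x: "x \<in> P" and T': "T' \<subseteq> V" "card T' \<le> d"
  let ?U = "V - (T \<union> T')"
  have "card (T \<union> T') \<le> 2 * d" using card_Un_le[of T T'] T T' by linarith
  moreover have "card ?U = m - card (T \<union> T')" using T T' finV by (intro card_Diff_subset) (auto intro: finite_subset)
  ultimately have "2 \<le> card ?U" using d by linarith
  then obtain B where "B \<subseteq> ?U" "card B = 2" using finV by (metis obtain_subset_with_card_n)
  then obtain i j where ij: "i \<noteq> j" "i \<in> ?U" "j \<in> ?U" unfolding card_2_iff by blast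
  define \<tau> where "\<tau> = Transposition.transpose i j"
  have tS: "\<tau> \<in> Stab T'" using ij unfolding \<tau>_def Stab_def by (auto intro: permutes_swap_id)
  have tP: "\<tau> \<in> P" using tS Stab_subset by auto
  have tfix: "\<tau> t = t" if "t \<in> T" for t
    unfolding \<tau>_def by (rule transpose_apply_other) (use ij that in auto)
  let ?f = "\<lambda>y. sg y * cylfun (\<lambda>_. 1) z T y"
  have flip: "?f (y \<circ> \<tau>) = - ?f y" if y: "y \<in> P" for y
  proof -
    have "y permutes V" "\<tau> permutes V" using y tP by (auto simp: P_def)
    then have "sign (y \<circ> \<tau>) = sign y * sign \<tau>"
      using finV by (intro sign_compose) (auto simp: permutes_imp_permutation)
    also have "sign \<tau> = -1" unfolding \<tau>_def using ij(1) by (simp add: sign_swap_id)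
    finally have "sign (y \<circ> \<tau>) = - sign y" by (simp only: mult_minus1_right)
    then have s: "sg (y \<circ> \<tau>) = - sg y" by (simp only: of_int_minus)
    have "y \<circ> \<tau> \<in> Cyl z T \<longleftrightarrow> y \<in> Cyl z T"
      using y comp_P[OF y tP] tfix by (simp add: Cyl_def)
    then show ?thesis unfolding cylfun_def s by simp
  qed
  have "(\<Sum>\<rho>\<in>Stab T'. ?f (x \<circ> \<rho>)) = (\<Sum>\<rho>\<in>Stab T'. ?f (x \<circ> (\<rho> \<circ> \<tau>)))"
    using sum_right_Stab[OF tS, of "\<lambda>\<rho>. ?f (x \<circ> \<rho>)"] by (rule sym)
  also have "\<dots> = (\<Sum>\<rho>\<in>Stab T'. - ?f (x \<circ> \<rho>))"
  proof (rule sum.cong[OF refl])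
    fix \<rho> assume "\<rho> \<in> Stab T'"
    then have "x \<circ> \<rho> \<in> P" using x Stab_subset comp_P by blast
    from flip[OF this] show "?f (x \<circ> (\<rho> \<circ> \<tau>)) = - ?f (x \<circ> \<rho>)" by (simp only: comp_assoc)
  qed
  also have "\<dots> = - (\<Sum>\<rho>\<in>Stab T'. ?f (x \<circ> \<rho>))" by (rule sum_negf)
  finally show "(\<Sum>\<rho>\<in>Stab T'. ?f (x \<circ> \<rho>)) = 0" by linarith
qed

lemma sign_Low_High1:
  assumes d: "2 * d + 2 \<le> m" and p: "p \<in> Low d"
  shows "(\<lambda>y. sg y * p y) \<in> High1 d"
  unfolding High1_def perp_Cyls
proof (intro allI impI)
  fix x T assume x: "x \<in> P" and T: "T \<subseteq> V" "card T \<le> d"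
  have "(\<Sum>y\<in>Cyl x T. 1 * (sg y * p y)) = ip P (cylfun (\<lambda>_. 1) x T) (\<lambda>y. sg y * p y)"
    by (rule ip_cylfun[symmetric])
  also have "\<dots> = ip P p (\<lambda>y. sg y * cylfun (\<lambda>_. 1) x T y)" by (simp add: ip_def mult_ac)
  also have "\<dots> = 0" by (rule Low_High1[OF p sign_cylfun_High1[OF T d x]])
  finally show "(\<Sum>y\<in>Cyl x T. 1 * (sg y * p y)) = 0" .
qed

text \<open>\<open>Low d\<close> and its product with the sign are orthogonal, so projecting to
  their sum amounts to adding the two projections: \<open>p\<close>, and the sign times the low part
  \<open>p'\<close> of the sign-twisted \<open>g\<close>.\<close>

lemma low_high_decomposition:
  assumes d: "2 * d + 2 \<le> m"
    and g: "g = (\<lambda>x. p x + h x)" "p \<in> Low d" "h \<in> High1 d"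
    and g': "(\<lambda>x. sg x * g x) = (\<lambda>x. p' x + h' x)" "p' \<in> Low d" "h' \<in> High1 d"
    and u_def: "u = (\<lambda>x. p x + sg x * p' x)" and w_def: "w = (\<lambda>x. h x - sg x * p' x)"
  shows "g = (\<lambda>x. u x + w x)" "w \<in> High d" "ip P u u = ip P p p + ip P p' p'" "ip P w w \<le> ip P g g"
proof -
  show gu: "g = (\<lambda>x. u x + w x)" unfolding g(1) u_def w_def by simp
  have w1: "w \<in> High1 d" unfolding w_def using g(3) sign_Low_High1[OF d g'(2)]
    unfolding High1_def by (rule perp_diff)
  have sw: "(\<lambda>x. sg x * w x) = (\<lambda>x. h' x - sg x * p x)"
  proof
    fix x
    have "sg x * p x + sg x * h x = p' x + h' x" using fun_cong[OF g'(1), of x] by (simp add: g(1) algebra_simps)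
    then show "sg x * w x = h' x - sg x * p x"
      unfolding w_def right_diff_distrib sg_square by linarith
  qed
  have w2: "(\<lambda>x. sg x * w x) \<in> High1 d" unfolding sw using g'(3) sign_Low_High1[OF d g(2)]
    unfolding High1_def by (rule perp_diff)
  show wHi: "w \<in> High d"
  proof -
    have "w \<in> perp P (Cyls (\<lambda>_. 1) d)" using w1 by (simp add: High1_def)
    moreover have "w \<in> perp P (Cyls sg d)" using w2 unfolding High1_def perp_Cyls by simp
    ultimately show ?thesis by (auto simp: High_iff sign_chars_def)
  qed
  have "ip P p (\<lambda>x. sg x * p' x) = 0" by (rule Low_High1[OF g(2) sign_Low_High1[OF d g'(2)]])
  moreover have "ip P (\<lambda>x. sg x * p' x) (\<lambda>x. sg x * p' x) = ip P p' p'"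
    unfolding ip_def by (intro sum.cong refl) (simp add: sign_def)
  ultimately show "ip P u u = ip P p p + ip P p' p'"
    unfolding u_def ip_add_left ip_add_right by (simp add: ip_commute[of P "\<lambda>x. sg x * p' x" p])
  have "ip P p w = 0" by (rule Low_High1[OF g(2) w1])
  moreover have "ip P (\<lambda>x. sg x * p' x) w = ip P p' (\<lambda>x. sg x * w x)" by (simp add: ip_def mult_ac)
  moreover have "\<dots> = 0" by (rule Low_High1[OF g'(2) w2])
  ultimately have "ip P u w = 0" unfolding u_def ip_add_left by simp
  then have "ip P g g = ip P u u + ip P w w"
    unfolding gu ip_add_left ip_add_right by (simp add: ip_commute[of P w u])
  then show "ip P w w \<le> ip P g g" using ip_nonneg[of P u] by simp
qed

lemma sum_left_F:
  assumes F: "F \<subseteq> P" shows "(\<Sum>a\<in>F. \<Sum>x\<in>P. f (a \<circ> x)) = real (card F) * (\<Sum>x\<in>P. f x)"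
proof -
  have "(\<Sum>a\<in>F. \<Sum>x\<in>P. f (a \<circ> x)) = (\<Sum>a\<in>F. \<Sum>x\<in>P. f x)"
    by (rule sum.cong[OF refl sum_left]) (use F in auto)
  then show ?thesis by simp
qed

lemma left_sum_norm: assumes F: "F \<subseteq> P" shows "ip P (left_sum F v) (left_sum F v) \<le> (real (card F))\<^sup>2 * ip P v v"
proof -
  have "ip P (left_sum F v) (left_sum F v) = (\<Sum>x\<in>P. (\<Sum>a\<in>F. 1 * v (a \<circ> x))\<^sup>2)"
    by (simp add: ip_def left_sum_def power2_eq_square)
  also have "\<dots> \<le> (\<Sum>x\<in>P. (\<Sum>a\<in>F. 1\<^sup>2) * (\<Sum>a\<in>F. (v (a \<circ> x))\<^sup>2))"
    by (intro sum_mono Cauchy_Schwarz_real_sum)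
  also have "\<dots> = real (card F) * (\<Sum>a\<in>F. \<Sum>x\<in>P. (v (a \<circ> x))\<^sup>2)"
    unfolding sum_distrib_left[symmetric] by (subst sum.swap) simp
  also have "\<dots> = real (card F) * (real (card F) * (\<Sum>x\<in>P. (v x)\<^sup>2))"
    by (simp only: sum_left_F[OF F, of "\<lambda>x. (v x)\<^sup>2"])
  also have "\<dots> = (real (card F))\<^sup>2 * ip P v v" by (simp add: ip_def power2_eq_square)
  finally show ?thesis .
qed

text \<open>\<open>left_sum F g\<close> has total mass \<open>(card F)\<^sup>2\<close> and is
  supported on the quotients of \<open>F\<close>; this is Cauchy--Schwarz.\<close>

lemma quotient_set_lower_bound:
  assumes F: "F \<subseteq> P"
  defines "g \<equiv> \<lambda>x. if x \<in> F then 1 else (0::real)"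
  shows "real (card F) ^ 4 \<le> real (card {inv' a \<circ> b |a b. a \<in> F \<and> b \<in> F}) * ip P (left_sum F g) (left_sum F g)"
proof -
  let ?Q = "{inv' a \<circ> b |a b. a \<in> F \<and> b \<in> F}"
  have finF: "finite F" by (rule finite_F[OF F])
  have Q: "?Q \<subseteq> P" using F inv_P comp_P by blast
  have supp: "left_sum F g x = 0" if x: "x \<in> P - ?Q" for x
  proof -
    have "g (a \<circ> x) = 0" if a: "a \<in> F" for a
    proof -
      have "a \<circ> x \<notin> F"
      proof
        assume "a \<circ> x \<in> F"
        moreover have "x = inv' a \<circ> (a \<circ> x)" using inv_cancel(1)[of a x] a F by auto
        ultimately have "x \<in> ?Q" using a by blast
        then show False using x by blast
      qed
      then show ?thesis by (simp add: g_def)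
    qed
    then show ?thesis by (simp add: left_sum_def)
  qed
  have "(\<Sum>x\<in>P. left_sum F g x) = (\<Sum>a\<in>F. \<Sum>x\<in>P. g (a \<circ> x))" unfolding left_sum_def by (rule sum.swap)
  also have "\<dots> = real (card F) * (\<Sum>x\<in>P. g x)" by (rule sum_left_F[OF F])
  also have "(\<Sum>x\<in>P. g x) = real (card F)"
  proof -
    have "P \<inter> F = F" using F by auto
    then show ?thesis unfolding g_def using finP by (simp add: sum.If_cases)
  qed
  finally have tot: "(\<Sum>x\<in>P. left_sum F g x) = (real (card F))\<^sup>2" by (simp add: power2_eq_square)
  have "(\<Sum>x\<in>P. left_sum F g x) = (\<Sum>x\<in>?Q. 1 * left_sum F g x)"
    using supp Q finP by (intro sum.mono_neutral_cong_right) auto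
  then have s2: "(\<Sum>x\<in>?Q. 1 * left_sum F g x) = (real (card F))\<^sup>2" using tot by (rule trans[OF sym])
  have "real (card F) ^ 4 = (\<Sum>x\<in>?Q. 1 * left_sum F g x)\<^sup>2" unfolding s2 by simp
  also have "\<dots> \<le> (\<Sum>x\<in>?Q. 1\<^sup>2) * (\<Sum>x\<in>?Q. (left_sum F g x)\<^sup>2)" by (rule Cauchy_Schwarz_real_sum)
  also have "\<dots> \<le> real (card ?Q) * (\<Sum>x\<in>P. (left_sum F g x)\<^sup>2)"
    using Q finP by (simp add: mult_left_mono sum_mono2)
  finally show ?thesis by (simp add: ip_def power2_eq_square)
qed

end

context sym_lift
begin

text \<open>For \<open>d = 0\<close> the low part is the mean, giving \<open>\<phi>\<^sup>2\<close>,
  where the level inequality would give only the exponent 4/3. The better exponent lets growth start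
  at 1/32. The hypothesis on absolute values fits both the indicator and its sign twist.\<close>

lemma low_part_bound_uniform:
  assumes F: "F \<subseteq> P" "is_global F r \<phi>" and r: "r \<ge> 1" and phi: "\<phi> = real (card F) / fact m" and d: "2 * d \<le> m"
    and W: "W \<ge> 0" "d > 0 \<Longrightarrow> \<phi> ^ 4 * (81 ^ 3 * 80 * r) ^ d \<le> W ^ 3" "d = 0 \<Longrightarrow> \<phi>\<^sup>2 \<le> W"
    and f: "f = (\<lambda>x. p x + h x)" "p \<in> Low d" "h \<in> High1 d"
    and fF: "\<And>x. \<bar>f x\<bar> = (if x \<in> F then 1 else 0)"
  shows "ip P p p \<le> W * fact m"
proof (cases "d = 0")
  case True
  have "\<bar>\<Sum>x\<in>P. f x\<bar> \<le> (\<Sum>x\<in>P. \<bar>f x\<bar>)" by (rule sum_abs)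
  also have "\<dots> = real (card F)"
  proof -
    have "P \<inter> F = F" using F(1) by auto
    then show ?thesis unfolding fF using finP by (simp add: sum.If_cases)
  qed
  finally have "(\<Sum>x\<in>P. f x)\<^sup>2 \<le> (real (card F))\<^sup>2" by (rule abs_le_square_iff[THEN iffD1, OF order_trans]) simp
  moreover have "ip P p p = (\<Sum>x\<in>P. f x)\<^sup>2 / fact m" by (rule Low_0_norm) (use f True in auto)
  ultimately have "ip P p p \<le> (real (card F))\<^sup>2 / fact m" by (simp add: divide_right_mono)
  also have "\<dots> = \<phi>\<^sup>2 * fact m" unfolding phi by (simp add: power2_eq_square)
  also have "\<dots> \<le> W * fact m" using W(3)[OF True] by (intro mult_right_mono) auto
  finally show ?thesis .
next
  case False
  have "(ip P p p / fact m) ^ 3 \<le> \<phi> ^ 4 * (81 ^ 3 * 80 * r) ^ d"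
    by (rule low_part_bound[OF F r _ d f]) (auto simp: phi fF)
  also have "\<dots> \<le> W ^ 3" using False by (intro W(2)) simp
  finally have "ip P p p / fact m \<le> W" by (rule power_le_imp_le_base[of _ 2, simplified]) (rule W(1))
  then show ?thesis by (simp add: divide_le_eq)
qed

text \<open>On the low part the trivial operator norm \<open>card F\<close> suffices, because that
  part is small; on the high part the gain \<open>q\<close> is in the operator. In the factor,
  \<open>4 * W\<close> counts the two low parts (plain and sign-twisted) and the doubling in
  \<open>sq_sum_le\<close>.\<close>

theorem growth_analytic:
  assumes F: "F \<subseteq> P" "is_global F r \<phi>" and r: "r \<ge> 1" and phi: "\<phi> = real (card F) / fact m" "\<phi> > 0"
    and d: "18 * (d + 1) \<le> m"
    and q: "(1/2) ^ (m div 54) \<le> q" "(6 * real (d + 1) / real m) ^ (d + 1) \<le> q"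
    and W: "W \<ge> 0" "d > 0 \<Longrightarrow> \<phi> ^ 4 * (81 ^ 3 * 80 * r) ^ d \<le> W ^ 3" "d = 0 \<Longrightarrow> \<phi>\<^sup>2 \<le> W"
  shows "\<phi>\<^sup>2 * fact m \<le> real (card {inv' a \<circ> b |a b. a \<in> F \<and> b \<in> F}) * (4 * W + 2 * q)"
proof -
  let ?Q = "{inv' a \<circ> b |a b. a \<in> F \<and> b \<in> F}" and ?N = "fact m :: real" and ?c = "real (card F)"
  define g where "g = (\<lambda>x. if x \<in> F then 1 else (0::real))"
  have d2: "2 * d \<le> m" "2 * d + 2 \<le> m" using d by auto
  have q0: "q \<ge> 0" using q(1) by (rule order_trans[rotated]) simp
  obtain p h where g: "g = (\<lambda>x. p x + h x)" "p \<in> Low d" "h \<in> High1 d"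
    using Low_decomposition[of g d] by blast
  obtain p' h' where g': "(\<lambda>x. sg x * g x) = (\<lambda>x. p' x + h' x)" "p' \<in> Low d" "h' \<in> High1 d"
    using Low_decomposition[of "\<lambda>x. sg x * g x" d] by blast
  have pW: "ip P p p \<le> W * ?N"
    by (rule low_part_bound_uniform[OF F r phi(1) d2(1) W(1) _ _ g]) (use W(2,3) in \<open>auto simp: g_def\<close>)
  have p'W: "ip P p' p' \<le> W * ?N"
    by (rule low_part_bound_uniform[OF F r phi(1) d2(1) W(1) _ _ g']) (use W(2,3) in \<open>auto simp: g_def sign_def\<close>)
  define u where "u = (\<lambda>x. p x + sg x * p' x)"
  define w where "w = (\<lambda>x. h x - sg x * p' x)"
  note dec = low_high_decomposition[OF d2(2) g g' u_def w_def]
  have gg: "ip P g g = ?c"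
  proof -
    have "P \<inter> F = F" using F(1) by auto
    moreover have "ip P g g = (\<Sum>x\<in>P. if x \<in> F then 1 else 0)" unfolding ip_def g_def by (intro sum.cong) auto
    ultimately show ?thesis using finP by (simp add: sum.If_cases)
  qed
  have "ip P u u \<le> 2 * W * ?N" unfolding dec(3) using pW p'W by linarith
  then have Tu: "ip P (left_sum F u) (left_sum F u) \<le> ?c\<^sup>2 * (2 * W * ?N)"
    using left_sum_norm[OF F(1), of u] by (meson mult_left_mono order_trans zero_le_power2)
  have "ip P (left_sum F w) (left_sum F w) \<le> q * ?c * ?N * ip P w w"
    by (rule high_part_bound[OF F(1) d q dec(2)])
  also have "\<dots> \<le> q * ?c * ?N * ?c" using dec(4) q0 unfolding gg by (intro mult_left_mono) auto
  finally have Tw: "ip P (left_sum F w) (left_sum F w) \<le> q * ?c * ?N * ?c" .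
  have Tg: "left_sum F g x = left_sum F u x + left_sum F w x" for x by (subst dec(1)) (simp add: left_sum_def sum.distrib)
  have "ip P (left_sum F g) (left_sum F g) = (\<Sum>x\<in>P. (left_sum F u x - (- left_sum F w x))\<^sup>2)"
    unfolding ip_def Tg by (simp add: power2_eq_square)
  also have "\<dots> \<le> (\<Sum>x\<in>P. 2 * (left_sum F u x)\<^sup>2 + 2 * (- left_sum F w x)\<^sup>2)" by (intro sum_mono sq_sum_le)
  also have "\<dots> = 2 * ip P (left_sum F u) (left_sum F u) + 2 * ip P (left_sum F w) (left_sum F w)"
    by (simp add: sum.distrib sum_distrib_left[symmetric] ip_def power2_eq_square)
  also have "\<dots> \<le> 2 * (?c\<^sup>2 * (2 * W * ?N)) + 2 * (q * ?c * ?N * ?c)" using Tu Tw by linarith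
  also have "\<dots> = ?c\<^sup>2 * ?N * (4 * W + 2 * q)" by (simp add: power2_eq_square algebra_simps)
  finally have T: "ip P (left_sum F g) (left_sum F g) \<le> ?c\<^sup>2 * ?N * (4 * W + 2 * q)" .
  have "?c\<^sup>2 * ?c\<^sup>2 \<le> real (card ?Q) * ip P (left_sum F g) (left_sum F g)"
    using quotient_set_lower_bound[OF F(1)] unfolding g_def power_add[symmetric] by simp
  also have "\<dots> \<le> real (card ?Q) * (?c\<^sup>2 * ?N * (4 * W + 2 * q))" using T by (intro mult_left_mono) auto
  also have "\<dots> = ?c\<^sup>2 * (?N * (real (card ?Q) * (4 * W + 2 * q)))" by (simp only: mult_ac)
  finally have "?c\<^sup>2 * ?c\<^sup>2 \<le> ?c\<^sup>2 * (?N * (real (card ?Q) * (4 * W + 2 * q)))" .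
  moreover have "?c\<^sup>2 > 0" using phi by (simp add: zero_less_divide_iff)
  ultimately have "?c\<^sup>2 \<le> ?N * (real (card ?Q) * (4 * W + 2 * q))" by (rule mult_left_le_imp_le)
  moreover have "?c = \<phi> * ?N" by (simp add: phi)
  ultimately have "?N * (\<phi>\<^sup>2 * ?N) \<le> ?N * (real (card ?Q) * (4 * W + 2 * q))"
    by (simp add: power2_eq_square mult_ac)
  then show ?thesis by (rule mult_left_le_imp_le) simp
qed

end

section \<open>Choice of the degree and the resulting growth\<close>

lemma exp_power_bound:
  fixes x k :: real
  assumes "0 \<le> x" "x \<le> exp (-2)" "k \<le> real j"
  shows "x ^ j \<le> exp (- (2 * k))"
proof -
  have "x ^ j \<le> exp (-2) ^ j" using assms by (intro power_mono) auto
  also have "\<dots> = exp (real j * (-2))" by (simp only: exp_of_nat_mult)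
  also have "\<dots> \<le> exp (- (2 * k))" using assms(3) by simp
  finally show ?thesis .
qed

lemma exp_minus_2_ge: "exp (-2 :: real) \<ge> 1/9"
proof -
  have "exp (2::real) = exp 1 * exp 1" by (simp add: exp_add[symmetric])
  also have "\<dots> \<le> 3 * 3" using exp_le by (intro mult_mono) auto
  finally have "exp (2::real) \<le> 9" by simp
  then show ?thesis by (simp add: exp_minus field_simps)
qed

text \<open>Here \<open>d\<close> is the least number with \<open>(6 * real (d + 1) / real m) ^ (d + 1) \<le> \<phi>\<^sup>2\<close>; that \<open>d - 1\<close> fails
  this inequality gives the last bound.\<close>

lemma level_parameters:
  fixes s \<phi> r k c :: real and m :: nat
  assumes s: "0 < s" "s \<le> 1/2" and phi: "\<phi> = s ^ 5" and k: "k = - ln \<phi>" and r: "r \<ge> 1"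
    and c: "c = 1 / (16 ^ 15 * 12 * (81 ^ 3 * 80) ^ 5)" and rk: "r ^ 5 * k \<le> c * real m"
  shows "\<exists>d. 18 * (d + 1) \<le> m \<and> (1/2) ^ (m div 54) \<le> \<phi>\<^sup>2 \<and> (6 * real (d + 1) / real m) ^ (d + 1) \<le> \<phi>\<^sup>2 \<and>
    (d > 0 \<longrightarrow> \<phi> ^ 4 * (81 ^ 3 * 80 * r) ^ d \<le> (s ^ 6 / 16) ^ 3)"
proof -
  have phi0: "0 < \<phi>" using s phi by simp
  have "\<phi> \<le> (1/2) ^ 5" unfolding phi using s by (intro power_mono) auto
  then have phi1: "\<phi> \<le> 1/32" by (simp add: power_divide)
  have exp_k: "exp (- (2 * k)) = \<phi>\<^sup>2"
  proof -
    have "exp (- (2 * k)) = exp (ln \<phi> + ln \<phi>)" unfolding k by simp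
    also have "\<dots> = exp (ln \<phi>) * exp (ln \<phi>)" by (rule exp_add)
    finally show ?thesis using phi0 by (simp add: power2_eq_square)
  qed
  have k2: "k \<ge> 2"
  proof -
    have "(1/9 :: real) \<le> exp (-2)" by (rule exp_minus_2_ge)
    then have "\<phi> \<le> exp (-2)" using phi1 by linarith
    then have "ln \<phi> \<le> -2" using phi0 by (metis ln_exp ln_le_cancel_iff exp_gt_zero)
    then show ?thesis using k by linarith
  qed
  have r5: "r ^ 5 \<ge> 1" using r by simp
  have c0: "0 < c" "c \<le> 1/1000" unfolding c by simp_all
  have "k \<le> r ^ 5 * k" using r5 k2 by simp
  also have "\<dots> \<le> 1/1000 * real m" using rk mult_right_mono[OF c0(2), of "real m"] by linarith
  finally have km: "1000 * k \<le> real m" by simp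
  have m0: "real m > 0" using km k2 by linarith
  let ?Pr = "\<lambda>d. (6 * real (d + 1) / real m) ^ (d + 1) \<le> \<phi>\<^sup>2"
  \<comment> \<open>At this degree the base is at most 1/9, below \<open>exp (-2)\<close>, and the
    exponent at least \<open>k\<close>, so the power is at most \<open>exp (- (2 * k))\<close>,
    which is \<open>\<phi>\<^sup>2\<close>. Hence the least degree exists and is at most
    \<open>2 * k\<close>.\<close>
  define D where "D = nat \<lceil>k\<rceil>"
  have D: "k \<le> real D" "real D \<le> k + 1" using k2 unfolding D_def by linarith+
  have PD: "?Pr D"
    unfolding exp_k[symmetric]
  proof (rule exp_power_bound)
    have "6 * real (D + 1) \<le> (1/9) * real m" using D km k2 by simp
    then have "6 * real (D + 1) / real m \<le> 1/9" using m0 by (simp add: divide_le_eq)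
    then show "6 * real (D + 1) / real m \<le> exp (-2)" using exp_minus_2_ge by linarith
  qed (use D in auto)
  define d where "d = (LEAST d. ?Pr d)"
  have Pd: "?Pr d" unfolding d_def by (rule LeastI[of ?Pr, OF PD])
  have "d \<le> D" unfolding d_def by (rule Least_le[of ?Pr, OF PD])
  then have dk: "real d \<le> 2 * k" using D k2 by linarith
  have "18 * (real d + 1) \<le> 36 * k + 18" using dk by simp
  also have "\<dots> \<le> real m" using km k2 by simp
  finally have "real (18 * (d + 1)) \<le> real m" by simp
  then have d18: "18 * (d + 1) \<le> m" by (simp only: of_nat_le_iff)
  have half: "(1/2) ^ (m div 54) \<le> \<phi>\<^sup>2"
  proof -
    \<comment> \<open>216 is four times 54: four halvings give 1/16, below \<open>exp (-2)\<close>,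
      and \<open>1000 * k \<le> m\<close> gives \<open>k \<le> j\<close>.\<close>
    define j where "j = m div 216"
    have "m < 216 * (j + 1)" unfolding j_def by simp
    then have "real m < real (216 * (j + 1))" by (simp only: of_nat_less_iff)
    then have "1000 * k < 216 * real j + 216" using km by simp
    then have kj: "k \<le> real j" using k2 by linarith
    have "4 * j \<le> m div 54" unfolding j_def by simp
    then have "(1/2 :: real) ^ (m div 54) \<le> (1/2) ^ (4 * j)" by (intro power_decreasing) auto
    also have "\<dots> = ((1/2) ^ 4) ^ j" by (rule power_mult)
    also have "\<dots> \<le> exp (- (2 * k))"
      by (rule exp_power_bound[OF _ _ kj]) (use exp_minus_2_ge in \<open>auto simp: power_divide\<close>)
    finally show ?thesis unfolding exp_k .
  qed
  have low: "\<phi> ^ 4 * (81 ^ 3 * 80 * r) ^ d \<le> (s ^ 6 / 16) ^ 3" if d0: "d > 0"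
  proof -
    define C where "C = (81 ^ 3 * 80 :: real)"
    define Y where "Y = (6 * real d / real m) ^ d"
    have C0: "C > 0" unfolding C_def by simp
    have "\<not> ?Pr (d - 1)" using not_less_Least[of "d - 1" ?Pr] d0 unfolding d_def[symmetric] by simp
    then have Y: "s ^ 10 < Y" using d0 unfolding phi Y_def by (simp add: power_mult[symmetric])
    have Y0: "Y > 0" using Y s by (meson less_trans zero_less_power)
    \<comment> \<open>The constant \<open>c\<close> is made for this estimate: 12 absorbs the 6 and
      the bound \<open>d \<le> 2 * k\<close>, \<open>C ^ 5\<close> cancels, and
      \<open>16 ^ 15\<close> is left to pay for the fifth power of
      \<open>(1/16) ^ 3\<close>.\<close>
    have "r ^ 5 * real d \<le> r ^ 5 * (2 * k)" using dk r by (intro mult_left_mono) auto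
    then have "r ^ 5 * real d \<le> 2 * c * real m" using rk by simp
    then have "r ^ 5 * (6 * real d / real m) \<le> 12 * c" using m0 by (simp add: divide_le_eq mult_ac)
    then have "C ^ 5 * r ^ 5 * (6 * real d / real m) \<le> C ^ 5 * (12 * c)"
      unfolding mult.assoc using C0 by (intro mult_left_mono) auto
    also have "\<dots> = 1 / 16 ^ 15" using C0 unfolding c C_def[symmetric] by simp
    finally have base: "C ^ 5 * r ^ 5 * (6 * real d / real m) \<le> 1 / 16 ^ 15" .
    have "(C ^ 5 * r ^ 5) ^ d * Y = (C ^ 5 * r ^ 5 * (6 * real d / real m)) ^ d"
      unfolding Y_def by (rule power_mult_distrib[symmetric])
    also have "\<dots> \<le> (1 / 16 ^ 15) ^ d" using base C0 r m0 by (intro power_mono) auto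
    also have "\<dots> \<le> (1 / 16 ^ 15) ^ 1" using d0 by (intro power_decreasing) auto
    finally have main: "(C ^ 5 * r ^ 5) ^ d * Y \<le> 1 / 16 ^ 15" by simp
    \<comment> \<open>Fifth powers are compared since only \<open>r ^ 5\<close> is controlled.
      Minimality of \<open>d\<close>, in the form \<open>s ^ 10 < Y\<close>, allows \<open>Y\<close>
      to be cancelled at the price of the step from \<open>s ^ 100\<close> to
      \<open>s ^ 90\<close>.\<close>
    have "s ^ 100 * (C ^ 5 * r ^ 5) ^ d * Y \<le> s ^ 90 * s ^ 10 * (1 / 16 ^ 15)"
      using mult_left_mono[OF main, of "s ^ 100"] s by (simp add: power_add[symmetric] mult.assoc)
    also have "\<dots> \<le> s ^ 90 * Y * (1 / 16 ^ 15)"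
      using Y s by (intro mult_right_mono mult_left_mono) auto
    finally have "s ^ 100 * (C ^ 5 * r ^ 5) ^ d * Y \<le> (s ^ 90 * (1 / 16 ^ 15)) * Y" by (simp add: mult_ac)
    then have fifth: "s ^ 100 * (C ^ 5 * r ^ 5) ^ d \<le> s ^ 90 * (1 / 16 ^ 15)"
      using Y0 by (rule mult_right_le_imp_le)
    have "(\<phi> ^ 4 * (C * r) ^ d) ^ Suc 4 = s ^ 100 * (C ^ 5 * r ^ 5) ^ d"
      unfolding phi by (simp add: power_mult_distrib power_mult[symmetric] mult.commute)
    also note fifth
    also have "s ^ 90 * (1 / 16 ^ 15) = ((s ^ 6 / 16) ^ 3) ^ Suc 4"
      by (simp add: power_divide power_mult[symmetric])
    finally have "\<phi> ^ 4 * (C * r) ^ d \<le> (s ^ 6 / 16) ^ 3"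
      by (rule power_le_imp_le_base) (use s in auto)
    then show ?thesis by (simp add: C_def)
  qed
  show ?thesis using d18 half Pd low by blast
qed

text \<open>The factor \<open>81 ^ 3 * 80\<close> comes from \<open>low_part_bound\<close>; the rest makes \<open>level_parameters\<close> work.\<close>

definition growth_const :: real where "growth_const = 1 / (16 ^ 15 * 12 * (81 ^ 3 * 80) ^ 5)"

context sym_lift
begin

text \<open>For \<open>s\<close> the fifth root of \<phi>, take \<open>q = s ^ 10\<close> and
  \<open>W = s ^ 6 / 16\<close>. Then the factor in \<open>growth_analytic\<close> is at most
  \<open>s ^ 6\<close>, leaving density \<open>s ^ 4\<close>. The bound
  \<open>\<phi> \<le> 1/32\<close>, that is \<open>s \<le> 1/2\<close>, is what gives
  \<open>\<phi>\<^sup>2 \<le> W\<close>. Fifth powers keep roots out of the statement.\<close>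

theorem growth:
  assumes F: "F \<subseteq> P" "is_global F r \<phi>" and r: "r \<ge> 1"
    and phi: "\<phi> = real (card F) / fact m" "0 < \<phi>" "\<phi> \<le> 1/32"
    and rk: "r ^ 5 * (- ln \<phi>) \<le> growth_const * real m"
  shows "\<phi> ^ 4 * fact m ^ 5 \<le> real (card {inv' a \<circ> b |a b. a \<in> F \<and> b \<in> F}) ^ 5"
proof -
  let ?Q = "real (card {inv' a \<circ> b |a b. a \<in> F \<and> b \<in> F})" and ?N = "fact m :: real"
  define s where "s = root 5 \<phi>"
  have s0: "0 < s" using phi(2) by (simp add: s_def)
  have s5: "\<phi> = s ^ 5" using phi(2) by (simp add: s_def)
  have "s ^ Suc 4 \<le> (1/2) ^ Suc 4" using phi(3) s5 by (simp add: power_divide)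
  then have s2: "s \<le> 1/2" by (rule power_le_imp_le_base) simp
  obtain d where d: "18 * (d + 1) \<le> m" "(1/2) ^ (m div 54) \<le> \<phi>\<^sup>2" "(6 * real (d + 1) / real m) ^ (d + 1) \<le> \<phi>\<^sup>2"
    "d > 0 \<longrightarrow> \<phi> ^ 4 * (81 ^ 3 * 80 * r) ^ d \<le> (s ^ 6 / 16) ^ 3"
    using level_parameters[OF s0 s2 s5 refl r growth_const_def rk] by blast
  have "s ^ 10 = s ^ 6 * s ^ 4" by (simp add: power_add[symmetric])
  also have "\<dots> \<le> s ^ 6 * (1/2) ^ 4" using s0 s2 by (intro mult_left_mono power_mono) auto
  finally have W: "\<phi>\<^sup>2 \<le> s ^ 6 / 16" unfolding s5 by (simp add: power_mult[symmetric] power_divide)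
  have "\<phi>\<^sup>2 * ?N \<le> ?Q * (4 * (s ^ 6 / 16) + 2 * \<phi>\<^sup>2)"
    by (rule growth_analytic[OF F r phi(1,2) d(1-3)]) (use d(4) W s0 in auto)
  also have "\<dots> \<le> ?Q * s ^ 6"
  proof (rule mult_left_mono)
    have "0 < s ^ 6" using s0 by simp
    then show "4 * (s ^ 6 / 16) + 2 * \<phi>\<^sup>2 \<le> s ^ 6" using W by linarith
  qed simp
  finally have 1: "\<phi>\<^sup>2 * ?N \<le> ?Q * s ^ 6" .
  have "\<phi>\<^sup>2 = s ^ 6 * s ^ 4" unfolding s5 by (simp only: power_add[symmetric] power_mult[symmetric]) simp
  then have "s ^ 6 * (s ^ 4 * ?N) \<le> s ^ 6 * ?Q" using 1 by (simp only: mult_ac)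
  then have "s ^ 4 * ?N \<le> ?Q" by (rule mult_left_le_imp_le) (use s0 in simp)
  then have "(s ^ 4 * ?N) ^ 5 \<le> ?Q ^ 5" using s0 by (intro power_mono) auto
  then show ?thesis unfolding s5 by (simp add: power_mult_distrib power_mult[symmetric])
qed

end

section \<open>Dense approximate subgroups\<close>

context sym_space
begin

lemma self_Cyl: "x \<in> P \<Longrightarrow> x \<in> Cyl x T" by (simp add: Cyl_def)

lemma Cyl_eq: "z \<in> Cyl x T \<Longrightarrow> Cyl z T = Cyl x T" by (auto simp: Cyl_def)

lemma inj_left: "g \<in> P \<Longrightarrow> inj_on (\<lambda>x. g \<circ> x) S" for S :: "('a \<Rightarrow> 'a) set"
  using inv_cancel(1)[of g] by (intro inj_on_inverseI[where g = "\<lambda>x. inv' g \<circ> x"]) blast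

lemma card_Cyl: "x \<in> P \<Longrightarrow> T \<subseteq> V \<Longrightarrow> card (Cyl x T) = fact (m - card T)"
  using bij_betw_same_card[OF Cyl_bij, of x T] cardStab[of T] by simp

definition slice_density :: "('a \<Rightarrow> 'a) set \<Rightarrow> ('a \<Rightarrow> 'a) \<Rightarrow> 'a set \<Rightarrow> real" where
  "slice_density A z J = real (card (A \<inter> Cyl z J)) / fact (m - card J)"

text \<open>A maximiser of the density divided by \<open>r ^ card J\<close> exists by finiteness.
  Its value is positive, as \<open>J = {}\<close> shows, so the coset meets \<open>A\<close> and its
  representative can be taken there.\<close>

lemma optimal_coset:
  fixes r :: real
  assumes A: "A \<subseteq> P" "A \<noteq> {}" and r: "r > 0"
  shows "\<exists>I g. I \<subseteq> V \<and> g \<in> A \<and> (\<forall>z\<in>P. \<forall>J. J \<subseteq> V \<longrightarrow> slice_density A z J * r ^ card I \<le> slice_density A g I * r ^ card J)"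
proof -
  let ?f = "\<lambda>(z, J). slice_density A z J / r ^ card J"
  have fin: "finite (?f ` (P \<times> Pow V))" using finP finV by auto
  have "Max (?f ` (P \<times> Pow V)) \<in> ?f ` (P \<times> Pow V)"
    by (rule Max_in[OF fin]) (use id_P in blast)
  then obtain z I where zI: "z \<in> P" "I \<subseteq> V" "?f (z, I) = Max (?f ` (P \<times> Pow V))" by force
  have max: "slice_density A z' J / r ^ card J \<le> slice_density A z I / r ^ card I" if "z' \<in> P" "J \<subseteq> V" for z' J
  proof -
    have "?f (z', J) \<le> Max (?f ` (P \<times> Pow V))" by (rule Max_ge[OF fin]) (use that in blast)
    then show ?thesis using zI(3) by simp
  qed
  obtain a where a: "a \<in> A" using A(2) by auto
  have finA: "finite A" using A(1) finP finite_subset by auto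
  have "a \<in> A \<inter> Cyl a {}" using a A(1) self_Cyl by blast
  then have "card (A \<inter> Cyl a {}) > 0" using finA by (auto simp: card_gt_0_iff)
  then have "slice_density A a {} > 0" unfolding slice_density_def by simp
  then have "0 < slice_density A a {} / r ^ card ({} :: 'a set)" by simp
  also have "\<dots> \<le> slice_density A z I / r ^ card I" by (rule max) (use a A in auto)
  finally have "slice_density A z I \<noteq> 0" by auto
  then have "A \<inter> Cyl z I \<noteq> {}" unfolding slice_density_def by auto
  then obtain g where g: "g \<in> A" "g \<in> Cyl z I" by auto
  have e: "slice_density A g I = slice_density A z I" unfolding slice_density_def Cyl_eq[OF g(2)] ..
  have "slice_density A z' J * r ^ card I \<le> slice_density A g I * r ^ card J" if "z' \<in> P" "J \<subseteq> V" for z' J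
    using max[OF that] r unfolding e by (simp add: divide_simps mult_ac split: if_splits)
  then show ?thesis using zI(2) g(1) by blast
qed

lemma translate_slice:
  assumes x: "x \<in> P" and A: "A \<subseteq> P"
  shows "card ((\<lambda>a. x \<circ> a) ` A \<inter> Stab I) \<le> card (A \<inter> Cyl (inv' x) I)"
proof (rule card_inj_on_le[where f = "\<lambda>b. inv' x \<circ> b"])
  show "inj_on (\<lambda>b. inv' x \<circ> b) ((\<lambda>a. x \<circ> a) ` A \<inter> Stab I)"
    by (rule inj_left[OF inv_P[OF x]])
  show "(\<lambda>b. inv' x \<circ> b) ` ((\<lambda>a. x \<circ> a) ` A \<inter> Stab I) \<subseteq> A \<inter> Cyl (inv' x) I"
  proof (rule image_subsetI)
    fix b assume b: "b \<in> (\<lambda>a. x \<circ> a) ` A \<inter> Stab I"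
    then obtain a where a: "a \<in> A" "b = x \<circ> a" by auto
    have "inv' x \<circ> b = a" unfolding a(2) by (rule inv_cancel(1)[OF x])
    moreover have "inv' x \<circ> b \<in> Cyl (inv' x) I"
    proof -
      have "b \<in> P" using b Stab_subset by blast
      then show ?thesis using comp_P[OF inv_P[OF x]] b Stab_fix[of b I] by (simp add: Cyl_def)
    qed
    ultimately show "inv' x \<circ> b \<in> A \<inter> Cyl (inv' x) I" using a(1) by simp
  qed
  show "finite (A \<inter> Cyl (inv' x) I)" using A finP finite_subset by blast
qed

lemma coset_representatives:
  assumes A: "A \<subseteq> P"
  shows "\<exists>Y\<subseteq>A. (\<forall>a\<in>A. \<exists>y\<in>Y. a \<in> Cyl y I) \<and> (\<forall>y\<in>Y. \<forall>y'\<in>Y. y' \<in> Cyl y I \<longrightarrow> y = y')"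
proof -
  define rp where "rp C = (SOME a. a \<in> A \<inter> C)" for C
  have rp: "rp (Cyl a I) \<in> A" "rp (Cyl a I) \<in> Cyl a I" if "a \<in> A" for a
  proof -
    have "\<exists>b. b \<in> A \<inter> Cyl a I" using that A self_Cyl by blast
    then have "rp (Cyl a I) \<in> A \<inter> Cyl a I" unfolding rp_def by (rule someI_ex)
    then show "rp (Cyl a I) \<in> A" "rp (Cyl a I) \<in> Cyl a I" by auto
  qed
  let ?Y = "(\<lambda>a. rp (Cyl a I)) ` A"
  have "?Y \<subseteq> A" using rp by auto
  moreover have "\<exists>y\<in>?Y. a \<in> Cyl y I" if "a \<in> A" for a
  proof (rule bexI)
    show "a \<in> Cyl (rp (Cyl a I)) I"
      unfolding Cyl_eq[OF rp(2)[OF that]] by (rule self_Cyl) (use A that in auto)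
  qed (use that in auto)
  moreover have "y = y'" if y: "y \<in> ?Y" "y' \<in> ?Y" "y' \<in> Cyl y I" for y y'
  proof -
    obtain a a' where a: "a \<in> A" "y = rp (Cyl a I)" "a' \<in> A" "y' = rp (Cyl a' I)" using y by auto
    have "Cyl a I = Cyl y I" "Cyl a' I = Cyl y' I" using Cyl_eq rp(2) a by auto
    moreover have "Cyl y' I = Cyl y I" using Cyl_eq[OF y(3)] .
    ultimately show ?thesis unfolding a(2,4) by simp
  qed
  ultimately show ?thesis by (intro exI[of _ ?Y]) blast
qed

text \<open>The hypothesis \<open>cond\<close> speaks of every \<open>t\<close> with
  \<open>r ^ t * \<alpha> \<le> 1\<close> because this inequality, from comparing the optimal coset
  with the whole group, is all that is known of \<open>card I\<close>.\<close>

theorem coset_cover: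
  fixes r :: real and K :: nat
  assumes A: "A \<subseteq> P" "id \<in> A" "\<And>a. a \<in> A \<Longrightarrow> inv' a \<in> A"
    and X: "X \<subseteq> P" "finite X" "card X = K" "\<And>a b. a \<in> A \<Longrightarrow> b \<in> A \<Longrightarrow> \<exists>x\<in>X. \<exists>c\<in>A. a \<circ> b = x \<circ> c"
    and K: "K \<ge> 2" and r: "r \<ge> 1" and alpha: "\<alpha> = real (card A) / fact m"
    and cond: "\<And>t. r ^ t * \<alpha> \<le> 1 \<Longrightarrow> t < m \<and> r ^ 5 * (- ln \<alpha>) \<le> growth_const * real (m - t)"
  shows "\<exists>I Y. I \<subseteq> V \<and> r ^ card I * \<alpha> \<le> 1 \<and> Y \<subseteq> A \<and> (\<forall>a\<in>A. \<exists>y\<in>Y. a \<in> Cyl y I) \<and>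
    real (card Y) * fact (m - card I) \<le> real K ^ 6 * real (card A)"
proof -
  have finA: "finite A" using A(1) finP finite_subset by auto
  have ne: "A \<noteq> {}" using A(2) by auto
  obtain I g where I: "I \<subseteq> V" and g: "g \<in> A"
    and opt: "\<And>z J. z \<in> P \<Longrightarrow> J \<subseteq> V \<Longrightarrow> slice_density A z J * r ^ card I \<le> slice_density A g I * r ^ card J"
    using optimal_coset[OF A(1) ne, of r] r by auto
  have gP: "g \<in> P" using g A by auto
  have finI: "finite I" using I finV finite_subset by auto
  define M where "M = m - card I"
  define \<phi> where "\<phi> = slice_density A g I"
  have cardVI: "card (V - I) = M" unfolding M_def using finI I by (rule card_Diff_subset)
  have a0: "\<alpha> > 0" unfolding alpha using ne finA by (simp add: card_gt_0_iff)
  have "Cyl g {} = P" by (auto simp: Cyl_def)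
  moreover have "A \<inter> P = A" using A by auto
  ultimately have "slice_density A g {} = \<alpha>" unfolding slice_density_def alpha by simp
  then have ar: "\<alpha> * r ^ card I \<le> \<phi>" using opt[OF gP, of "{}"] by (simp add: \<phi>_def)
  have slice: "slice_density A z I \<le> \<phi>" if "z \<in> P" for z
    using opt[OF that I] r unfolding \<phi>_def by simp
  have phi1: "\<phi> \<le> 1"
  proof -
    have "card (A \<inter> Cyl g I) \<le> card (Cyl g I)" by (rule card_mono) (use finP finite_subset in \<open>auto simp: Cyl_def\<close>)
    then have "real (card (A \<inter> Cyl g I)) \<le> fact (m - card I)" unfolding card_Cyl[OF gP I] by (metis of_nat_fact of_nat_le_iff)
    then show ?thesis unfolding \<phi>_def slice_density_def by (simp add: divide_le_eq)
  qed
  have rI: "r ^ card I * \<alpha> \<le> 1" using ar phi1 by (simp add: mult.commute)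
  have phi_alpha: "\<alpha> \<le> \<phi>"
  proof -
    have "1 \<le> r ^ card I" using r by (rule one_le_power)
    then have "\<alpha> * 1 \<le> \<alpha> * r ^ card I" using a0 by (intro mult_left_mono) auto
    then show ?thesis using ar by simp
  qed
  have phi0: "\<phi> > 0" using a0 phi_alpha by linarith
  have tm: "card I < m" and rk: "r ^ 5 * (- ln \<alpha>) \<le> growth_const * real M"
    using cond[OF rI] unfolding M_def by auto
  have "V - I \<noteq> {}"
  proof
    assume "V - I = {}"
    then have "M = 0" using cardVI by (metis card.empty)
    then show False using tm unfolding M_def by simp
  qed
  then interpret s: sym_lift "V - I" using finV by unfold_locales auto
  have sP: "s.P = Stab I" unfolding s.P_def Stab_def ..
  define F where "F = {\<rho> \<in> Stab I. g \<circ> \<rho> \<in> A}"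
  let ?Q = "{inv' a \<circ> b |a b. a \<in> F \<and> b \<in> F}"
  let ?AA = "{a \<circ> b |a b. a \<in> A \<and> b \<in> A}"
  have phiM: "\<phi> * fact M = real (card (A \<inter> Cyl g I))" unfolding \<phi>_def slice_density_def M_def by simp
  have bF: "bij_betw (\<lambda>\<rho>. g \<circ> \<rho>) F (A \<inter> Cyl g I)"
  proof (rule bij_betw_imageI)
    show "inj_on (\<lambda>\<rho>. g \<circ> \<rho>) F" by (rule inj_left[OF gP])
    have "(\<lambda>\<rho>. g \<circ> \<rho>) ` Stab I = Cyl g I" using Cyl_bij[OF gP, of I] by (simp add: bij_betw_def)
    moreover have "f ` {\<rho> \<in> Stab I. f \<rho> \<in> A} = A \<inter> f ` Stab I" for f by blast
    ultimately show "(\<lambda>\<rho>. g \<circ> \<rho>) ` F = A \<inter> Cyl g I" unfolding F_def by simp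
  qed
  have phiF: "\<phi> = real (card F) / fact (card (V - I))"
    unfolding cardVI bij_betw_same_card[OF bF] phiM[symmetric] by simp
  have AA: "?AA \<subseteq> P" using A comp_P by blast
  have finAA: "finite ?AA" by (rule finite_subset[OF AA finP])
  have cover: "?AA \<subseteq> (\<Union>x\<in>X. (\<lambda>a. x \<circ> a) ` A)" 
  proof (rule subsetI)
    fix q assume "q \<in> ?AA"
    then obtain a b where ab: "a \<in> A" "b \<in> A" "q = a \<circ> b" by blast
    obtain x c where xc: "x \<in> X" "c \<in> A" "a \<circ> b = x \<circ> c" using X(4)[OF ab(1,2)] by blast
    have "q \<in> (\<lambda>a. x \<circ> a) ` A" by (rule image_eqI[OF _ xc(2)]) (simp only: ab(3) xc(3))
    then show "q \<in> (\<Union>x\<in>X. (\<lambda>a. x \<circ> a) ` A)" using xc(1) by (rule UN_I[rotated])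
  qed
  \<comment> \<open>The translation by \<open>g\<close> cancels in a quotient, so quotients of
    \<open>F\<close> are quotients of elements of \<open>A\<close>, and \<open>A\<close> is closed
    under inverses.\<close>
  have Q: "?Q \<subseteq> ?AA \<inter> Stab I"
  proof (rule subsetI)
    fix q assume "q \<in> ?Q"
    then obtain a b where ab: "a \<in> F" "b \<in> F" "q = inv' a \<circ> b" by blast
    have "a \<in> P" "b \<in> P" using ab Stab_subset by (auto simp: F_def)
    then have "q = inv' (g \<circ> a) \<circ> (g \<circ> b)"
      unfolding ab(3) inv_comp_P[OF gP \<open>a \<in> P\<close>] using inv_cancel(1)[OF gP, of b] by (simp only: comp_assoc)
    moreover have "inv' (g \<circ> a) \<in> A" "g \<circ> b \<in> A" using ab A(3) by (auto simp: F_def)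
    ultimately have "q \<in> ?AA" by blast
    moreover have "q \<in> Stab I" unfolding ab(3) using ab by (intro comp_Stab inv_Stab) (auto simp: F_def)
    ultimately show "q \<in> ?AA \<inter> Stab I" by simp
  qed
  have Qcard: "real (card ?Q) \<le> real K * (\<phi> * fact M)"
  proof -
    have "card ?Q \<le> card (?AA \<inter> Stab I)" using Q finAA by (intro card_mono) auto
    also have "\<dots> \<le> card (\<Union>x\<in>X. (\<lambda>a. x \<circ> a) ` A \<inter> Stab I)"
      by (rule card_mono) (use X(2) finA cover in auto)
    also have "\<dots> \<le> (\<Sum>x\<in>X. card ((\<lambda>a. x \<circ> a) ` A \<inter> Stab I))" by (rule card_UN_le[OF X(2)])
    finally have "real (card ?Q) \<le> real (\<Sum>x\<in>X. card ((\<lambda>a. x \<circ> a) ` A \<inter> Stab I))" by (simp only: of_nat_le_iff)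
    also have "\<dots> = (\<Sum>x\<in>X. real (card ((\<lambda>a. x \<circ> a) ` A \<inter> Stab I)))" by simp
    also have "\<dots> \<le> (\<Sum>x\<in>X. \<phi> * fact M)"
    proof (rule sum_mono)
      fix x assume "x \<in> X"
      then have x: "x \<in> P" using X(1) by auto
      have "real (card ((\<lambda>a. x \<circ> a) ` A \<inter> Stab I)) \<le> real (card (A \<inter> Cyl (inv' x) I))"
        using translate_slice[OF x A(1), of I] by (simp only: of_nat_le_iff)
      also have "\<dots> \<le> \<phi> * fact M"
        using slice[OF inv_P[OF x]] unfolding slice_density_def M_def by (simp add: divide_le_eq)
      finally show "real (card ((\<lambda>a. x \<circ> a) ` A \<inter> Stab I)) \<le> \<phi> * fact M" .
    qed
    also have "\<dots> = real K * (\<phi> * fact M)" by (simp add: X(3))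
    finally show ?thesis .
  qed
  have K5: "1 \<le> real K ^ 5 * \<phi>"
  proof (cases "\<phi> \<le> 1/32")
    case False
    \<comment> \<open>Above 1/32 the claim follows from \<open>K \<ge> 2\<close> alone.\<close>
    have "(2::real) ^ 5 \<le> real K ^ 5" using K by (intro power_mono) auto
    then have "32 * (1/32) \<le> real K ^ 5 * \<phi>" using False by (intro mult_mono) auto
    then show ?thesis by simp
  next
    case True
    have is_global: "s.is_global F r \<phi>"
      unfolding s.is_global_def
    proof (intro ballI allI impI)
      fix x T assume x: "x \<in> s.P" and T: "T \<subseteq> V - I"
      have xP: "x \<in> P" using x Stab_subset unfolding sP by auto
      have gx: "g \<circ> x \<in> P" by (rule comp_P[OF gP xP])
      have finT: "finite T" using T finV finite_subset by blast
      have cu: "card (I \<union> T) = card I + card T" using T finI finT by (intro card_Un_disjoint) auto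
      have "card (F \<inter> s.Cyl x T) \<le> card (A \<inter> Cyl (g \<circ> x) (I \<union> T))"
      proof (rule card_inj_on_le[where f = "\<lambda>\<rho>. g \<circ> \<rho>"])
        show "inj_on (\<lambda>\<rho>. g \<circ> \<rho>) (F \<inter> s.Cyl x T)" by (rule inj_left[OF gP])
        show "(\<lambda>\<rho>. g \<circ> \<rho>) ` (F \<inter> s.Cyl x T) \<subseteq> A \<inter> Cyl (g \<circ> x) (I \<union> T)"
        proof (rule image_subsetI)
          fix \<rho> assume "\<rho> \<in> F \<inter> s.Cyl x T"
          then have \<rho>: "\<rho> \<in> Stab I" "g \<circ> \<rho> \<in> A" "\<forall>t\<in>T. \<rho> t = x t" by (auto simp: F_def s.Cyl_def)
          have "\<rho> t = x t" if "t \<in> I \<union> T" for t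
            using that \<rho>(3) Stab_fix[OF \<rho>(1), of t] Stab_fix[of x I t] x unfolding sP by auto
          then show "g \<circ> \<rho> \<in> A \<inter> Cyl (g \<circ> x) (I \<union> T)" using \<rho>(2) A(1) by (auto simp: Cyl_def)
        qed
        show "finite (A \<inter> Cyl (g \<circ> x) (I \<union> T))" using finA by simp
      qed
      then have "real (card (F \<inter> s.Cyl x T)) \<le> real (card (A \<inter> Cyl (g \<circ> x) (I \<union> T)))" by (simp only: of_nat_le_iff)
      also have "\<dots> = slice_density A (g \<circ> x) (I \<union> T) * fact (M - card T)"
        unfolding slice_density_def cu M_def by simp
      also have "\<dots> \<le> (r ^ card T * \<phi>) * fact (M - card T)"
      proof (rule mult_right_mono)
        \<comment> \<open>Globalness is optimality of \<open>I\<close> against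
          \<open>I \<union> T\<close>; the common factor \<open>r ^ card I\<close> cancels.\<close>
        have "slice_density A (g \<circ> x) (I \<union> T) * r ^ card I \<le> \<phi> * r ^ (card I + card T)"
          using opt[OF gx, of "I \<union> T"] I T unfolding cu \<phi>_def by auto
        then have "slice_density A (g \<circ> x) (I \<union> T) * r ^ card I \<le> (r ^ card T * \<phi>) * r ^ card I"
          by (simp add: power_add mult_ac)
        then show "slice_density A (g \<circ> x) (I \<union> T) \<le> r ^ card T * \<phi>" using r by simp
      qed simp
      finally show "real (card (F \<inter> s.Cyl x T)) \<le> r ^ card T * \<phi> * fact (card (V - I) - card T)" unfolding cardVI .
    qed
    have "r ^ 5 * (- ln \<phi>) \<le> r ^ 5 * (- ln \<alpha>)" using phi_alpha a0 phi0 r by (intro mult_left_mono) auto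
    also note rk
    finally have "\<phi> ^ 4 * fact (card (V - I)) ^ 5 \<le> real (card ?Q) ^ 5"
      by (intro s.growth[OF _ is_global r phiF phi0 True]) (auto simp: sP F_def cardVI)
    also have "\<dots> \<le> (real K * (\<phi> * fact M)) ^ 5" using Qcard by (intro power_mono) auto
    also have "\<dots> = (\<phi> ^ 4 * fact M ^ 5) * (real K ^ 5 * \<phi>)"
      by (simp add: power_mult_distrib eval_nat_numeral mult_ac)
    finally have "(\<phi> ^ 4 * fact M ^ 5) * 1 \<le> (\<phi> ^ 4 * fact M ^ 5) * (real K ^ 5 * \<phi>)" unfolding cardVI by simp
    then show ?thesis by (rule mult_left_le_imp_le) (use phi0 in simp)
  qed
  obtain Y where Y: "Y \<subseteq> A" "\<forall>a\<in>A. \<exists>y\<in>Y. a \<in> Cyl y I" "\<forall>y\<in>Y. \<forall>y'\<in>Y. y' \<in> Cyl y I \<longrightarrow> y = y'"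
    using coset_representatives[OF A(1), of I] by blast
  let ?B = "A \<inter> Cyl g I"
  \<comment> \<open>For \<open>b \<in> g H\<close> the inverse of \<open>b\<close> lies in a fixed right coset of \<open>H\<close>, so \<open>y \<circ> inv' b\<close> determines the coset \<open>y H\<close>.\<close>
  have YB: "card Y * card ?B \<le> K * card A"
  proof -
    have "card (Y \<times> ?B) \<le> card ?AA"
    proof (rule card_inj_on_le[where f = "\<lambda>(y, b). y \<circ> inv' b"])
      show "inj_on (\<lambda>(y, b). y \<circ> inv' b) (Y \<times> ?B)"
      proof (rule inj_onI, clarify)
        fix y b y' b' assume y: "y \<in> Y" "y' \<in> Y" and b: "b \<in> A" "b \<in> Cyl g I" "b' \<in> A" "b' \<in> Cyl g I"
          and e: "y \<circ> inv' b = y' \<circ> inv' b'"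
        have P: "y \<in> P" "y' \<in> P" "b \<in> P" "b' \<in> P" using y b Y(1) A(1) by auto
        have "y' t = y t" if t: "t \<in> I" for t
        proof -
          have bt: "b t = g t" "b' t = g t" using b t by (auto simp: Cyl_def)
          have "y t = (y \<circ> inv' b) (b t)" using P_inv_apply[OF P(3)] by simp
          also have "\<dots> = y' (inv' b' (b' t))" unfolding e bt by simp
          also have "\<dots> = y' t" using P_inv_apply[OF P(4)] by simp
          finally show ?thesis by simp
        qed
        then have "y' \<in> Cyl y I" using P by (simp add: Cyl_def)
        then have yy: "y = y'" using Y(3) y by blast
        have "inv' b = inv' b'" using inj_left[OF P(2), of UNIV] e unfolding yy inj_on_def by blast
        then have "inv' (inv' b) = inv' (inv' b')" by simp
        then show "y = y' \<and> b = b'" using yy inv_inv_P P by simp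
      qed
      show "(\<lambda>(y, b). y \<circ> inv' b) ` (Y \<times> ?B) \<subseteq> ?AA"
      proof (rule image_subsetI)
        fix q assume "q \<in> Y \<times> ?B"
        then have "fst q \<in> A" "inv' (snd q) \<in> A" using Y(1) A(3) by auto
        then have "fst q \<circ> inv' (snd q) \<in> ?AA" by (intro CollectI exI[of _ "fst q"] exI[of _ "inv' (snd q)"] conjI refl)
        then show "(case q of (y, b) \<Rightarrow> y \<circ> inv' b) \<in> ?AA" by (simp only: case_prod_beta)
      qed
    qed (rule finAA)
    also have "\<dots> \<le> card (\<Union>x\<in>X. (\<lambda>a. x \<circ> a) ` A)" by (rule card_mono[OF _ cover]) (use X(2) finA in auto)
    also have "\<dots> \<le> (\<Sum>x\<in>X. card ((\<lambda>a. x \<circ> a) ` A))" by (rule card_UN_le[OF X(2)])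
    also have "\<dots> \<le> (\<Sum>x\<in>X. card A)" by (intro sum_mono card_image_le[OF finA])
    also have "\<dots> = K * card A" by (simp add: X(3))
    finally show ?thesis by (simp add: card_cartesian_product)
  qed
  \<comment> \<open>The factor \<open>K ^ 5 * \<phi>\<close> turns the size of \<open>H\<close> into
    that of the slice \<open>?B\<close>, so that \<open>YB\<close> applies and adds the sixth
    \<open>K\<close>.\<close>
  have "real (card Y) * fact M \<le> real (card Y) * fact M * (real K ^ 5 * \<phi>)"
    using K5 mult_left_mono[OF K5, of "real (card Y) * fact M"] by simp
  also have "\<dots> = real K ^ 5 * real (card Y * card ?B)"
    using phiM by (simp add: mult_ac)
  also have "\<dots> \<le> real K ^ 5 * real (K * card A)" using YB by (intro mult_left_mono) (simp_all only: of_nat_le_iff, simp)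
  also have "\<dots> = real K ^ 6 * real (card A)" by (simp add: eval_nat_numeral mult_ac)
  finally show ?thesis using I rI Y unfolding M_def by blast
qed

end

section \<open>The symmetric group as a group structure and the final estimates\<close>

lemma growth_const_bounds: "0 < growth_const" "growth_const \<le> 1/500"
  by (simp_all add: growth_const_def)

lemma Stab_subgroup: "subgroup {\<sigma>. \<sigma> permutes {1..n} - I} (sym_group n)"
proof (rule group.subgroupI[OF sym_group_is_group])
  have sub: "{\<sigma>. \<sigma> permutes {1..n} - I} \<subseteq> carrier (sym_group n)"
    by (auto simp: sym_group_carrier intro: permutes_subset)
  show "{\<sigma>. \<sigma> permutes {1..n} - I} \<subseteq> carrier (sym_group n)" by (rule sub)
  show "{\<sigma>. \<sigma> permutes {1..n} - I} \<noteq> {}" using permutes_id by blast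
  show "inv\<^bsub>sym_group n\<^esub> \<sigma> \<in> {\<sigma>. \<sigma> permutes {1..n} - I}" if "\<sigma> \<in> {\<sigma>. \<sigma> permutes {1..n} - I}" for \<sigma>
    using that subsetD[OF sub that] by (simp add: permutes_inv)
  show "\<sigma> \<otimes>\<^bsub>sym_group n\<^esub> \<tau> \<in> {\<sigma>. \<sigma> permutes {1..n} - I}"
    if "\<sigma> \<in> {\<sigma>. \<sigma> permutes {1..n} - I}" "\<tau> \<in> {\<sigma>. \<sigma> permutes {1..n} - I}" for \<sigma> \<tau>
    using that by (simp add: sym_group_mult permutes_compose)
qed

lemma approximate_groupD:
  assumes "approximate_group (sym_group n) K A"
  shows "A \<subseteq> carrier (sym_group n)" "id \<in> A" "a \<in> A \<Longrightarrow> inv' a \<in> A"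
    "\<exists>X\<subseteq>carrier (sym_group n). finite X \<and> card X = K \<and> (\<forall>a\<in>A. \<forall>b\<in>A. \<exists>x\<in>X. \<exists>c\<in>A. a \<circ> b = x \<circ> c)"
proof -
  show A: "A \<subseteq> carrier (sym_group n)" "id \<in> A"
    using assms by (auto simp: approximate_group_def sym_group_one)
  show "inv' a \<in> A" if a: "a \<in> A"
  proof -
    have "inv\<^bsub>sym_group n\<^esub> a \<in> set_inv\<^bsub>sym_group n\<^esub> A" using a by (auto simp: SET_INV_def)
    moreover have "set_inv\<^bsub>sym_group n\<^esub> A = A" using assms by (simp add: approximate_group_def)
    ultimately show ?thesis using subsetD[OF A(1) a] by simp
  qed
  obtain X where X: "X \<subseteq> carrier (sym_group n)" "finite X" "card X = K"
    "A <#>\<^bsub>sym_group n\<^esub> A \<subseteq> X <#>\<^bsub>sym_group n\<^esub> A"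
    using assms by (auto simp: approximate_group_def)
  have "\<exists>x\<in>X. \<exists>c\<in>A. a \<circ> b = x \<circ> c" if "a \<in> A" "b \<in> A" for a b
  proof -
    have "a \<circ> b \<in> A <#>\<^bsub>sym_group n\<^esub> A" using that by (auto simp: set_mult_def sym_group_mult)
    then have "a \<circ> b \<in> X <#>\<^bsub>sym_group n\<^esub> A" using X(4) by blast
    then show ?thesis by (auto simp: set_mult_def sym_group_mult)
  qed
  then show "\<exists>X\<subseteq>carrier (sym_group n). finite X \<and> card X = K \<and> (\<forall>a\<in>A. \<forall>b\<in>A. \<exists>x\<in>X. \<exists>c\<in>A. a \<circ> b = x \<circ> c)"
    using X by blast
qed

lemma finite_carrier_sym: "finite (carrier (sym_group n))"
  by (simp add: sym_group_def finite_permutations)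

lemma card_carrier_sym: "card (carrier (sym_group n)) = fact n"
  by (simp add: sym_group_def card_permutations)

text \<open>The single translate \<open>x \<circ> A\<close> contains all products, in particular
  \<open>A\<close> itself because of \<open>id\<close>; being no larger than \<open>A\<close> it
  equals \<open>A\<close>.\<close>

lemma approximate_group_1_subgroup:
  assumes "approximate_group (sym_group n) 1 A"
  shows "subgroup A (sym_group n)"
proof -
  note A = approximate_groupD[OF assms]
  obtain X where X: "card X = 1" "\<forall>a\<in>A. \<forall>b\<in>A. \<exists>x\<in>X. \<exists>c\<in>A. a \<circ> b = x \<circ> c"
    using A(4) by auto
  obtain x where x: "X = {x}" using X(1) by (rule card_1_singletonE)
  have finA: "finite A" using A(1) finite_carrier_sym finite_subset by blast
  let ?f = "\<lambda>a. x \<circ> a"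
  have xA: "a \<circ> b \<in> ?f ` A" if "a \<in> A" "b \<in> A" for a b
    using X(2) that unfolding x by blast
  have "A \<subseteq> ?f ` A"
  proof
    fix a assume "a \<in> A"
    from xA[OF this A(2)] show "a \<in> ?f ` A" by (simp only: comp_id)
  qed
  then have "?f ` A = A" using finA card_image_le[OF finA, of ?f] card_seteq[of "?f ` A" A] by simp
  then have "a \<circ> b \<in> A" if "a \<in> A" "b \<in> A" for a b using xA[OF that] by simp
  then show ?thesis
    using A(1,2,3) subsetD[OF A(1)]
    by (intro group.subgroupI[OF sym_group_is_group]) (auto simp: sym_group_mult)
qed

lemma fact_le_power_fact: "t \<le> n \<Longrightarrow> (fact n :: real) \<le> real n ^ t * fact (n - t)"
proof -
  assume t: "t \<le> n"
  have d: "(fact (n - t) :: nat) dvd fact n" by (rule fact_dvd) simp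
  have "(fact n :: nat) = fact n div fact (n - t) * fact (n - t)" using d by simp
  also have "\<dots> \<le> n ^ t * fact (n - t)" by (rule mult_right_mono[OF fact_div_fact_le_pow[OF t]]) simp
  finally have "real (fact n) \<le> real (n ^ t * fact (n - t))" by (simp only: of_nat_le_iff)
  then show ?thesis by simp
qed

theorem theorem1p2:
  shows "\<exists>c::real. c > 0 \<and>
    (\<forall>(n::nat) (K::nat) (\<epsilon>::real) (A::(nat \<Rightarrow> nat) set).
       n \<ge> 2 \<longrightarrow> K \<ge> 1 \<longrightarrow> \<epsilon> > 1 / ln (real n) \<longrightarrow>
       approximate_group (sym_group n) K A \<longrightarrow>
       sym_density n A \<ge> exp (- c * real n powr (1 - \<epsilon>)) \<longrightarrow>
       (\<exists>H. subgroup H (sym_group n) \<and>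
            sym_density n H \<ge> sym_density n A powr (5 / \<epsilon>) \<and>
            (\<exists>Y. Y \<subseteq> A \<and> A \<subseteq> Y <#>\<^bsub>sym_group n\<^esub> H \<and>
                 real (card Y) \<le> real K ^ 6 * real (card A) / real (card H))))"
proof (intro exI[of _ "growth_const / 2"] conjI allI impI)
  show "0 < growth_const / 2" using growth_const_bounds by simp
next
  fix n K :: nat and \<epsilon> :: real and A :: "(nat \<Rightarrow> nat) set"
  assume n: "n \<ge> 2" and K: "K \<ge> 1" and eps: "\<epsilon> > 1 / ln (real n)"
    and ap: "approximate_group (sym_group n) K A"
    and dense: "sym_density n A \<ge> exp (- (growth_const / 2) * real n powr (1 - \<epsilon>))"
  let ?G = "sym_group n"
  \<comment> \<open>Half of \<open>growth_const\<close>, because the growth theorem is applied on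
    the points outside \<open>I\<close>, of which there are at least \<open>n / 2\<close>.\<close>
  define c where "c = growth_const / 2"
  define \<alpha> where "\<alpha> = sym_density n A"
  have c: "0 < c" "c \<le> 1/1000" using growth_const_bounds by (simp_all add: c_def)
  note A = approximate_groupD[OF ap]
  have finA: "finite A" using A(1) finite_carrier_sym finite_subset by blast
  have n1: "real n > 1" using n by simp
  have lnn: "ln (real n) > 0" using n1 by simp
  have eps0: "\<epsilon> > 0" using eps lnn by (meson less_trans zero_less_divide_1_iff)
  have epsln: "\<epsilon> * ln (real n) > 1" using eps lnn by (simp add: divide_less_eq)
  have a0: "\<alpha> > 0" using dense exp_gt_zero less_le_trans unfolding \<alpha>_def by blast
  have a1: "\<alpha> \<le> 1"
  proof -
    have "card A \<le> fact n" using card_mono[OF finite_carrier_sym A(1)] by (simp add: card_carrier_sym)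
    then have "real (card A) \<le> fact n" by (metis of_nat_fact of_nat_le_iff)
    then show ?thesis by (simp add: \<alpha>_def sym_density_def)
  qed
  have ell: "- ln \<alpha> \<le> c * real n powr (1 - \<epsilon>)"
  proof -
    have "ln (exp (- c * real n powr (1 - \<epsilon>))) \<le> ln \<alpha>"
      using dense a0 unfolding \<alpha>_def c_def by (subst ln_le_cancel_iff) auto
    then show ?thesis by simp
  qed
  show "\<exists>H. subgroup H ?G \<and> sym_density n H \<ge> sym_density n A powr (5 / \<epsilon>) \<and>
            (\<exists>Y. Y \<subseteq> A \<and> A \<subseteq> Y <#>\<^bsub>?G\<^esub> H \<and> real (card Y) \<le> real K ^ 6 * real (card A) / real (card H))"
  proof (cases "K = 1")
    case True
    have sub: "subgroup A ?G" by (rule approximate_group_1_subgroup) (use ap True in simp)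
    have "\<alpha> powr (5 / \<epsilon>) \<le> \<alpha>"
    proof (cases "\<epsilon> \<le> 5")
      case True
      then have "1 \<le> 5 / \<epsilon>" using eps0 by simp
      then have "\<alpha> powr (5 / \<epsilon>) \<le> \<alpha> powr 1" using a0 a1 by (intro powr_mono') auto
      then show ?thesis using a0 by simp
    next
      case False
      \<comment> \<open>For \<open>\<epsilon> > 5\<close> the exponent is below 1, so the inequality
        holds only if \<open>A\<close> is the whole group. It is: its density exceeds 1/2, and its
        index is an integer.\<close>
      define j where "j = card (rcosets\<^bsub>?G\<^esub> A)"
      have "j * card A = order ?G"
        unfolding j_def using group.lagrange[OF sym_group_is_group sub] .
      then have "real (j * card A) = fact n" by (simp add: order_def card_carrier_sym)
      then have ja: "real j * \<alpha> = 1" unfolding \<alpha>_def sym_density_def by (simp add: field_simps)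
      have "real n powr (1 - \<epsilon>) \<le> real n powr 0" using n1 False by (intro powr_mono) auto
      then have "c * real n powr (1 - \<epsilon>) \<le> c * 1" using c n1 by (intro mult_left_mono) auto
      then have "- (1/2) < ln \<alpha>" using ell c by linarith
      moreover have "ln \<alpha> \<le> \<alpha> - 1" using a0 by (rule ln_le_minus_one)
      ultimately have a2: "\<alpha> > 1/2" by linarith
      have j0: "j \<noteq> 0" using ja by (intro notI) simp
      then have "real j * (1/2) < real j * \<alpha>" using a2 by (intro mult_strict_left_mono) auto
      then have "real j < 2" unfolding ja by simp
      then have "j = 1" using j0 by simp
      then show ?thesis using ja by simp
    qed
    then have d: "sym_density n A powr (5 / \<epsilon>) \<le> sym_density n A" by (simp add: \<alpha>_def)
    have "A \<subseteq> {id} <#>\<^bsub>?G\<^esub> A" by (auto simp: set_mult_def sym_group_mult)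
    moreover have "real (card {id :: nat \<Rightarrow> nat}) \<le> real K ^ 6 * real (card A) / real (card A)"
      using A(2) finA True by (auto simp: card_eq_0_iff)
    ultimately show ?thesis using sub d A(2) by (intro exI[of _ A] conjI exI[of _ "{id}"]) auto
  next
    case False
    then have K2: "K \<ge> 2" using K by linarith
    interpret sym_space "{1..n}" by unfold_locales simp
    have PG: "P = carrier ?G" unfolding P_def sym_group_def by simp
    have alpha: "\<alpha> = real (card A) / fact (card {1..n})" by (simp add: \<alpha>_def sym_density_def)
    \<comment> \<open>The fifth power is \<open>n powr \<epsilon>\<close>, which cancels the
      \<epsilon> in the bound on \<open>- ln \<alpha>\<close>, and \<open>r ^ card I\<close> raised
      to \<open>5 / \<epsilon>\<close> is \<open>n ^ card I\<close>, which bounds the index of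
      \<open>H\<close>.\<close>
    define r where "r = real n powr (\<epsilon> / 5)"
    have r1: "r \<ge> 1" unfolding r_def using n1 eps0 by (intro ge_one_powr_ge_zero) auto
    have r5: "r ^ 5 = real n powr \<epsilon>" unfolding r_def using n1 by (simp add: powr_power)
    have cond: "t < card {1..n} \<and> r ^ 5 * (- ln \<alpha>) \<le> growth_const * real (card {1..n} - t)"
      if t: "r ^ t * \<alpha> \<le> 1" for t
    proof -
      have "ln (r ^ t * \<alpha>) \<le> 0" using t a0 r1 by (subst ln_le_zero_iff) auto
      moreover have "ln (r ^ t * \<alpha>) = real t * (\<epsilon> / 5 * ln (real n)) + ln \<alpha>"
      proof -
        have "ln (r ^ t * \<alpha>) = ln (r ^ t) + ln \<alpha>" using a0 r1 by (simp add: ln_mult)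
        also have "ln (r ^ t) = real t * ln r" using r1 by (simp add: ln_realpow)
        also have "ln r = \<epsilon> / 5 * ln (real n)" unfolding r_def using n1 by (simp add: ln_powr)
        finally show ?thesis .
      qed
      ultimately have "real t * (\<epsilon> * ln (real n)) \<le> 5 * (- ln \<alpha>)" by simp
      \<comment> \<open>This is where \<open>\<epsilon> > 1 / ln n\<close> enters: it bounds the
        number of fixed points by \<open>5 * (- ln \<alpha>)\<close>, hence by
        \<open>n / 200\<close>.\<close>
      moreover have "real t * 1 \<le> real t * (\<epsilon> * ln (real n))" using epsln by (intro mult_left_mono) auto
      ultimately have "real t \<le> 5 * (- ln \<alpha>)" by linarith
      also have "\<dots> \<le> 5 * (c * real n powr (1 - \<epsilon>))" using ell by simp
      also have "\<dots> \<le> 5 * ((1/1000) * real n powr 1)"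
        using c n1 eps0 by (intro mult_left_mono mult_mono powr_mono) auto
      finally have "real t \<le> real n / 200" using n1 by simp
      then have t2: "real t < real n" "real n / 2 \<le> real n - real t" using n1 by linarith+
      have "r ^ 5 * (- ln \<alpha>) \<le> real n powr \<epsilon> * (c * real n powr (1 - \<epsilon>))"
        unfolding r5 using ell by (intro mult_left_mono) auto
      also have "\<dots> = c * real n" using n1 by (simp add: powr_add[symmetric])
      also have "\<dots> = growth_const * (real n / 2)" by (simp add: c_def)
      also have "\<dots> \<le> growth_const * (real n - real t)" using t2 growth_const_bounds by (intro mult_left_mono) auto
      finally have "r ^ 5 * (- ln \<alpha>) \<le> growth_const * (real n - real t)" .
      then show ?thesis using t2(1) by (simp add: of_nat_diff)
    qed
    obtain X where X: "X \<subseteq> carrier ?G" "finite X" "card X = K"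
      "\<forall>a\<in>A. \<forall>b\<in>A. \<exists>x\<in>X. \<exists>c\<in>A. a \<circ> b = x \<circ> c" using A(4) by auto
    have XA: "\<exists>x\<in>X. \<exists>c\<in>A. a \<circ> b = x \<circ> c" if "a \<in> A" "b \<in> A" for a b using X(4) that by blast
    obtain I Y where I: "I \<subseteq> {1..n}" "r ^ card I * \<alpha> \<le> 1" and Y: "Y \<subseteq> A" "\<forall>a\<in>A. \<exists>y\<in>Y. a \<in> Cyl y I"
      and cardY: "real (card Y) * fact (card {1..n} - card I) \<le> real K ^ 6 * real (card A)"
      using coset_cover[OF A(1)[folded PG] A(2) A(3) X(1)[folded PG] X(2,3) XA K2 r1 alpha cond] by blast
    define H where "H = Stab I"
    have subH: "subgroup H ?G" unfolding H_def Stab_def by (rule Stab_subgroup)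
    have cardH: "real (card H) = fact (n - card I)" unfolding H_def using cardStab[OF I(1)] by simp
    have In: "card I \<le> n" using card_mono[OF _ I(1)] by simp
    have "\<alpha> powr (5 / \<epsilon>) \<le> sym_density n H"
    proof -
      have e: "r ^ card I = real n powr (real (card I) * (\<epsilon> / 5))"
        unfolding r_def using n1 by (simp add: powr_power mult.commute)
      have "\<alpha> \<le> 1 / r ^ card I" using I(2) r1 by (simp add: field_simps)
      also have "\<dots> = real n powr (- (real (card I) * (\<epsilon> / 5)))"
        unfolding e by (rule powr_minus_divide[symmetric])
      finally have "\<alpha> powr (5 / \<epsilon>) \<le> (real n powr (- (real (card I) * (\<epsilon> / 5)))) powr (5 / \<epsilon>)"
        using a0 eps0 by (intro powr_mono2) auto
      also have "\<dots> = real n powr (- real (card I))" using eps0 by (simp add: powr_powr)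
      also have "\<dots> = 1 / real n ^ card I" using n1 by (simp add: powr_minus_divide powr_realpow)
      also have "\<dots> \<le> fact (n - card I) / fact n"
        using fact_le_power_fact[OF In] n1 by (simp add: divide_simps mult_ac)
      finally show ?thesis unfolding sym_density_def cardH .
    qed
    moreover have "A \<subseteq> Y <#>\<^bsub>?G\<^esub> H"
    proof
      fix a assume "a \<in> A"
      then obtain y where y: "y \<in> Y" "a \<in> Cyl y I" using Y(2) by blast
      have "y \<in> P" using y(1) Y(1) A(1) unfolding PG by blast
      then obtain \<rho> where "\<rho> \<in> H" "a = y \<circ> \<rho>"
        using Cyl_bij[of y I] y(2) unfolding H_def bij_betw_def by blast
      then show "a \<in> Y <#>\<^bsub>?G\<^esub> H" using y(1) by (auto simp: set_mult_def sym_group_mult)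
    qed
    moreover have "real (card Y) \<le> real K ^ 6 * real (card A) / real (card H)"
      using cardY unfolding cardH by (simp add: le_divide_eq)
    ultimately show ?thesis using subH Y(1) unfolding \<alpha>_def by blast
  qed
qed

end
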